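(* Let $\lambda=1-\beta$. Assume that $F(u)\in H^k(0,T;V^{-\beta})$ and $u\in H^1(0,T;V^{2p(k)-\beta})$, where $u$ is the exact solution on $[0,T]$ of $\frac{\partial u}{\partial t}+\epsilon\mathcal Lu=F(u)$; that $\beta+\gamma\le1$; that $\tau<1$; that the starting errors satisfy $$\|e^j\|_{V^\lambda}^2+A\tau^k\|e^j\|_{V^{p(k)+\lambda}}^2\le C\tau^{2k},\qquad j=0,1,\dots,k-1;$$ and that the local time-step ratio is bounded, i.e. there is a constant $r_c>0$ independent of the time steps such that $$\frac{\tau_n}{\tau_m}\le r_c\qquad\text{for all }n,m\text{ with }|n-m|<k.$$ Let $u^n$ be the numerical solution at $t_n$ given by the variable-step scheme $$\frac{du^{n+1}(t)}{dt}+\epsilon\mathcal L u^{n+1}(t)+A\tau^k\frac{d}{dt}\mathcal L^{p(k)}u^{n+1}(t)=\sum_{i=0}^{k-1}\ell_i(t-t_n)F(u^{n-i}),\qquad t\in[t_n,t_{n+1}],\ n\ge k-1,$$ with $u^{n+1}(t)=u^n(t)$ for $t\in[0,t_n]$, and let $e^n=u(t_n)-u^n$. Then the scheme converges with the optimal rate $k$ in the sense that $$\|e^n\|_{V^\lambda}^2+A\tau^k\|e^n\|_{V^{p(k)+\lambda}}^2\le C\tau^{2k}\qquad\text{for all }n\text{ with }t_n\le T,$$ where $C$ is a constant independent of the time-step sizes.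
   Context: Setting. $X\hookrightarrow\mathcal H\hookrightarrow X'$ is a standard triple of Hilbert spaces and $\mathcal L$ is a linear operator mapping $X$ to its dual $X'$, positive definite and self-adjoint on $\mathcal H$ (understood as: $(\mathcal Lv,v)_{\mathcal H}\ge c_0\|v\|_{\mathcal H}^2$ for some $c_0>0$). For $\alpha\ge0$, $V^\alpha$ is the domain of $\mathcal L^{\alpha/2}$ with norm $\|v\|_{V^\alpha}=\|\mathcal L^{\alpha/2}v\|_{\mathcal H}$ (so $V^0=\mathcal H$), and $V^{-\alpha}$ is the dual of $V^\alpha$ induced by the inner product of $\mathcal H$ (its norm is again $\|\mathcal L^{-\alpha/2}\cdot\|_{\mathcal H}$). $\epsilon>0$ and $T>0$ are constants. Lipschitz assumption: there are $\beta,\gamma\ge0$ and $C_L>0$ with $$\|F(u)-F(v)\|_{V^{-\beta}}\le C_L\|u-v\|_{V^\gamma}\quad\text{for all }u,v\in V^\gamma.$$ The equation is the gradient flow of $E(u)=\frac{\epsilon}{2}\|\mathcal L^{1/2}u\|_{\mathcal H}^2+\mathcal F(u)$ with $F=-\frac{\delta\mathcal F}{\delta u}$. Time grid and scheme. $k\ge1$ is an integer; $0=t_0<t_1<\cdots$ are time nodes, $\tau_n=t_{n+1}-t_n$, $\tau=\max_j\tau_j$. $u^m=u^m(t_m)$ denotes the numerical solution at time $t_m$; $u^0,\dots,u^{k-1}$ are given by a starting procedure, and for $n\ge k-1$ the scheme determines $u^{n+1}(t)$ on $[t_n,t_{n+1}]$ with $u^{n+1}(t_n)=u^n$. $A>0$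 and $p(k)\ge0$ are fixed regularization parameters independent of the time steps. For fixed $n$ and $0\le i\le k-1$, $\ell_i$ is the Lagrange basis polynomial $$\ell_i(s)=\prod_{0\le m\le k-1,\ m\ne i}\frac{\sum_{j=1}^m\tau_{n-j}+s}{\sum_{j=1}^m\tau_{n-j}-\sum_{j=1}^i\tau_{n-j}},$$ which takes the value $1$ at $s=t_{n-i}-t_n$ and $0$ at $s=t_{n-m}-t_n$ for $m\neq i$, $0\le m\le k-1$. Constants. $C$ denotes a generic constant, possibly different at each occurrence (the constant in the conclusion may differ from the one in the assumption on starting errors), which may depend on $\epsilon$, the exact solution $u$, the initial value $u_0$, $T$ and the fixed data ($k$, $A$, $p(k)$, $C_L$, $r_c$, $\mathcal L$, and the constant in the starting-error assumption), but not on the time-step sizes. The exact and numerical solutions are understood to be regular enough that the error $e(t)=u(t)-u^{n+1}(t)$ on $[t_n,t_{n+1}]$ may be tested against $\mathcal L^\lambda e(t)$ in the error equation. *)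

theory Defs
  imports "HOL-Analysis.Analysis"
begin

section \<open>The operator and its fractional powers\<close>

(* X is embedded in H by j, and H in X' by h |-> (v |-> (h, j v)); continuity and density
   of X in H give continuity and density of H in X'. *)
definition standard_triple :: "('x::{real_inner,banach} \<Rightarrow> 'h::{real_inner,banach}) \<Rightarrow> bool" where
  "standard_triple j \<longleftrightarrow> bounded_linear j \<and> inj j \<and> closure (range j) = UNIV"

(* The graph of L : X \<rightarrow> X' as an unbounded operator on H: its domain consists of the
   v in X for which the functional L v belongs to H. *)
definition realization ::
  "('x::{real_inner,banach} \<Rightarrow> 'h::{real_inner,banach}) \<Rightarrow> ('x \<Rightarrow> 'x \<Rightarrow>\<^sub>L real) \<Rightarrow> ('h \<times> 'h) set" where
  "realization j L = {(j x, h) | x h. \<forall>v. blinfun_apply (L x) v = h \<bullet> j v}"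

definition adjoint_graph :: "('h::real_inner \<times> 'h) set \<Rightarrow> ('h \<times> 'h) set" where
  "adjoint_graph G = {(y, z). \<forall>(x, w) \<in> G. w \<bullet> y = x \<bullet> z}"

definition selfadjoint :: "('h::real_inner \<times> 'h) set \<Rightarrow> bool" where
  "selfadjoint G \<longleftrightarrow> closure (Domain G) = UNIV \<and> adjoint_graph G = G"

definition positive_definite :: "real \<Rightarrow> ('h::real_inner \<times> 'h) set \<Rightarrow> bool" where
  "positive_definite c G \<longleftrightarrow> c > 0 \<and> (\<forall>(v, w) \<in> G. w \<bullet> v \<ge> c * (norm v)\<^sup>2)"

definition inverse_operator :: "('h \<times> 'h) set \<Rightarrow> 'h \<Rightarrow> 'h" where
  "inverse_operator G h = (THE v. (v, h) \<in> G)"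

(* The power S^s, s \<ge> 0, of a bounded positive self-adjoint operator S.  With M = ||S|| one has
   0 \<le> 1 - S/M \<le> 1, and the functional calculus of z^s = M^s (1 - (1 - z/M))^s is the binomial
   series, which converges absolutely because the coefficients (s gchoose i) are absolutely
   summable for s > 0.  The two lemmas below check it against S^1 = S and on eigenvectors. *)
definition frac_pow :: "('h::{real_inner,banach} \<Rightarrow> 'h) \<Rightarrow> real \<Rightarrow> 'h \<Rightarrow> 'h" where
  "frac_pow S s x =
     (onorm S powr s) *\<^sub>R
       (\<Sum>i. ((- 1) ^ i * (s gchoose i)) *\<^sub>R ((\<lambda>y. y - (1 / onorm S) *\<^sub>R S y) ^^ i) x)"

lemma frac_pow_one:
  assumes "bounded_linear S"
  shows "frac_pow S 1 x = S x"
proof (cases "onorm S = 0")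
  case True
  then show ?thesis using onorm_eq_0[OF assms] by (simp add: frac_pow_def)
next
  case False
  then have pos: "onorm S > 0" using onorm_pos_le[OF assms] by simp
  have z: "(1::real) gchoose i = 0" if "i \<notin> {0, 1}" for i
  proof -
    have "(1::nat) choose i = 0" using that by (intro binomial_eq_0) auto
    then show ?thesis by (metis binomial_gbinomial of_nat_0 of_nat_1)
  qed
  have "(\<Sum>i. ((- 1) ^ i * ((1::real) gchoose i)) *\<^sub>R ((\<lambda>y. y - (1 / onorm S) *\<^sub>R S y) ^^ i) x)
      = (\<Sum>i\<in>{0,1}. ((- 1) ^ i * ((1::real) gchoose i)) *\<^sub>R ((\<lambda>y. y - (1 / onorm S) *\<^sub>R S y) ^^ i) x)"
    by (rule suminf_finite) (auto simp: z)
  also have "\<dots> = (1 / onorm S) *\<^sub>R S x" by simp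
  finally show ?thesis using pos by (simp add: frac_pow_def)
qed

lemma frac_pow_eigenvector:
  assumes "linear S" and eig: "S x = m *\<^sub>R x" and m: "0 < m" "m \<le> onorm S"
  shows "frac_pow S s x = (m powr s) *\<^sub>R x"
proof -
  define M where "M = onorm S"
  have M: "M > 0" "m \<le> M" using m by (auto simp: M_def)
  have it: "((\<lambda>y. y - (1 / M) *\<^sub>R S y) ^^ i) x = ((1 - m / M) ^ i) *\<^sub>R x" for i
    by (induction i)
       (auto simp: linear_scale[OF assms(1)] eig algebra_simps)
  have "\<bar>m / M - 1\<bar> < 1" using M m by (simp add: abs_if field_simps)
  from gen_binomial_real[OF this, of s]
  have "(\<lambda>i. (s gchoose i) * (m / M - 1) ^ i) sums (m / M) powr s" by simp
  moreover have "(s gchoose i) * (m / M - 1) ^ i = (- 1) ^ i * (s gchoose i) * (1 - m / M) ^ i" for i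
    using power_mult_distrib[of "- 1" "1 - m / M" i] by simp
  ultimately have "(\<lambda>i. (- 1) ^ i * (s gchoose i) * (1 - m / M) ^ i) sums (m / M) powr s" by simp
  then have "(\<lambda>i. ((- 1) ^ i * (s gchoose i) * (1 - m / M) ^ i) *\<^sub>R x) sums ((m / M) powr s *\<^sub>R x)"
    by (rule sums_scaleR_left)
  then have "(\<Sum>i. ((- 1) ^ i * (s gchoose i)) *\<^sub>R ((\<lambda>y. y - (1 / M) *\<^sub>R S y) ^^ i) x)
      = (m / M) powr s *\<^sub>R x"
    by (simp add: it sums_iff)
  then show ?thesis
    using M m by (simp add: frac_pow_def M_def[symmetric] powr_divide)
qed

(* L^s for real s: the inverse of (L^-1)^s if s \<ge> 0, and (L^-1)^(-s), defined on all of H,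
   if s < 0. *)
definition op_pow :: "('h::{real_inner,banach} \<times> 'h) set \<Rightarrow> real \<Rightarrow> 'h \<Rightarrow> 'h" where
  "op_pow G s v =
     (if s \<ge> 0 then (THE w. frac_pow (inverse_operator G) s w = v)
      else frac_pow (inverse_operator G) (- s) v)"

(* The elements of H that lie in V^a: the domain of L^(a/2) if a \<ge> 0, and all of H if a < 0. *)
definition V_space :: "('h::{real_inner,banach} \<times> 'h) set \<Rightarrow> real \<Rightarrow> 'h set" where
  "V_space G a = (if a \<ge> 0 then range (frac_pow (inverse_operator G) (a / 2)) else UNIV)"

definition V_norm :: "('h::{real_inner,banach} \<times> 'h) set \<Rightarrow> real \<Rightarrow> 'h \<Rightarrow> real" where
  "V_norm G a v = norm (op_pow G (a / 2) v)"

(* V^(-a), a \<ge> 0, as the dual of V^a: only the values of a functional on V^a matter, and h in H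
   acts as v |-> (h, v). *)
definition V_dual :: "('h::{real_inner,banach} \<times> 'h) set \<Rightarrow> real \<Rightarrow> ('h \<Rightarrow> real) set" where
  "V_dual G a = {f.
     (\<forall>v\<in>V_space G a. \<forall>w\<in>V_space G a. f (v + w) = f v + f w) \<and>
     (\<forall>v\<in>V_space G a. \<forall>r. f (r *\<^sub>R v) = r * f v) \<and>
     (\<exists>B. \<forall>v\<in>V_space G a. \<bar>f v\<bar> \<le> B * V_norm G a v)}"

definition V_dual_norm :: "('h::{real_inner,banach} \<times> 'h) set \<Rightarrow> real \<Rightarrow> ('h \<Rightarrow> real) \<Rightarrow> real" where
  "V_dual_norm G a f = (SUP v\<in>{v \<in> V_space G a. V_norm G a v \<le> 1}. \<bar>f v\<bar>)"

(* The isometric isomorphism L^(-a/2) from V^(-a) onto H, extended by duality: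
   <f, v> = (L^(-a/2) f, L^(a/2) v) for v in V^a. *)
definition dual_op_pow :: "('h::{real_inner,banach} \<times> 'h) set \<Rightarrow> real \<Rightarrow> ('h \<Rightarrow> real) \<Rightarrow> 'h" where
  "dual_op_pow G a f = (THE r. \<forall>v\<in>V_space G a. f v = r \<bullet> op_pow G (a / 2) v)"


section \<open>Sobolev spaces in time\<close>

(* "measurable_on" is strong measurability (a.e. limit of continuous functions), so H need not be
   separable; for square integrable strongly measurable functions the Henstock-Kurzweil integral
   below is the Bochner integral. *)
definition L2_time :: "real \<Rightarrow> real \<Rightarrow> (real \<Rightarrow> 'h::{real_inner,banach}) \<Rightarrow> bool" where
  "L2_time a b f \<longleftrightarrow> f measurable_on {a..b} \<and> (\<lambda>t. (norm (f t))\<^sup>2) integrable_on {a..b}"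

definition test_function :: "real \<Rightarrow> real \<Rightarrow> (real \<Rightarrow> real) \<Rightarrow> (real \<Rightarrow> real) \<Rightarrow> bool" where
  "test_function a b \<phi> \<phi>' \<longleftrightarrow>
     (\<forall>t. (\<phi> has_real_derivative \<phi>' t) (at t)) \<and> continuous_on UNIV \<phi>' \<and>
     (\<exists>c d. a < c \<and> d < b \<and> (\<forall>t. t \<notin> {c..d} \<longrightarrow> \<phi> t = 0))"

definition weak_time_derivative ::
  "real \<Rightarrow> real \<Rightarrow> (real \<Rightarrow> 'h::{real_inner,banach}) \<Rightarrow> (real \<Rightarrow> 'h) \<Rightarrow> bool" where
  "weak_time_derivative a b f g \<longleftrightarrow>
     (\<forall>\<phi> \<phi>'. test_function a b \<phi> \<phi>' \<longrightarrow>
        (\<exists>I. ((\<lambda>t. \<phi>' t *\<^sub>R f t) has_integral (- I)) {a..b} \<and>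
             ((\<lambda>t. \<phi> t *\<^sub>R g t) has_integral I) {a..b}))"

primrec H_time :: "nat \<Rightarrow> real \<Rightarrow> real \<Rightarrow> (real \<Rightarrow> 'h::{real_inner,banach}) \<Rightarrow> bool" where
  "H_time 0 a b f \<longleftrightarrow> L2_time a b f"
| "H_time (Suc m) a b f \<longleftrightarrow>
     L2_time a b f \<and> (\<exists>g. weak_time_derivative a b f g \<and> H_time m a b g)"

(* H^m(a,b;V^s) for an H-valued function and any real s; the norm of V^s is transported to H by
   the isometric isomorphism L^(s/2), so for s < 0 the weak derivatives are in V^s only. *)
definition H_time_V ::
  "('h::{real_inner,banach} \<times> 'h) set \<Rightarrow> real \<Rightarrow> nat \<Rightarrow> real \<Rightarrow> real \<Rightarrow> (real \<Rightarrow> 'h) \<Rightarrow> bool" where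
  "H_time_V G s m a b u \<longleftrightarrow>
     (AE t in lebesgue_on {a..b}. u t \<in> V_space G s) \<and> H_time m a b (\<lambda>t. op_pow G (s / 2) (u t))"

(* H^m(a,b;V^(-s)), s \<ge> 0, for a function with values in the dual of V^s *)
definition H_time_V_dual ::
  "('h::{real_inner,banach} \<times> 'h) set \<Rightarrow> real \<Rightarrow> nat \<Rightarrow> real \<Rightarrow> real \<Rightarrow> (real \<Rightarrow> 'h \<Rightarrow> real) \<Rightarrow> bool" where
  "H_time_V_dual G s m a b f \<longleftrightarrow>
     (AE t in lebesgue_on {a..b}. f t \<in> V_dual G s) \<and> H_time m a b (\<lambda>t. dual_op_pow G s (f t))"


section \<open>The nonlinearity and the exact solution\<close>

definition lipschitz_V ::
  "('h::{real_inner,banach} \<times> 'h) set \<Rightarrow> real \<Rightarrow> real \<Rightarrow> real \<Rightarrow> ('h \<Rightarrow> 'h \<Rightarrow> real) \<Rightarrow> bool" where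
  "lipschitz_V G \<beta> \<gamma> CL F \<longleftrightarrow>
     (\<forall>w\<in>V_space G \<gamma>. F w \<in> V_dual G \<beta>) \<and>
     (\<forall>u\<in>V_space G \<gamma>. \<forall>v\<in>V_space G \<gamma>.
        V_dual_norm G \<beta> (\<lambda>x. F u x - F v x) \<le> CL * V_norm G \<gamma> (u - v))"

(* F = - (variational derivative of Phi), on the domain V^1 of the energy
   (eps/2) ||L^(1/2) u||^2 + Phi u *)
definition neg_variational_derivative ::
  "('h::{real_inner,banach} \<times> 'h) set \<Rightarrow> ('h \<Rightarrow> real) \<Rightarrow> ('h \<Rightarrow> 'h \<Rightarrow> real) \<Rightarrow> bool" where
  "neg_variational_derivative G \<Phi> F \<longleftrightarrow>
     (\<forall>u\<in>V_space G 1. \<forall>v\<in>V_space G 1.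
        ((\<lambda>s. \<Phi> (u + s *\<^sub>R v)) has_real_derivative (- F u v)) (at 0))"

(* u' + eps L u = F(u) on [0,T], tested with v in V^2 = D(L), for a curve that is continuous
   with values in the domain V^\<gamma> of F *)
definition exact_solution ::
  "('h::{real_inner,banach} \<times> 'h) set \<Rightarrow> real \<Rightarrow> ('h \<Rightarrow> 'h \<Rightarrow> real) \<Rightarrow> real \<Rightarrow> real \<Rightarrow> (real \<Rightarrow> 'h) \<Rightarrow> bool" where
  "exact_solution G \<gamma> F \<epsilon> T u \<longleftrightarrow>
     (\<forall>t\<in>{0..T}. u t \<in> V_space G \<gamma>) \<and>
     continuous_on {0..T} (\<lambda>t. op_pow G (\<gamma> / 2) (u t)) \<and>
     (\<forall>v\<in>V_space G 2. \<forall>t\<in>{0..T}.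
        ((\<lambda>s. u s \<bullet> v) has_real_derivative (F (u t) v - \<epsilon> * (u t \<bullet> op_pow G 1 v)))
          (at t within {0..T}))"


section \<open>Time grid and scheme\<close>

definition step :: "(nat \<Rightarrow> real) \<Rightarrow> nat \<Rightarrow> real" where
  "step t n = t (Suc n) - t n"

definition max_step :: "(nat \<Rightarrow> real) \<Rightarrow> real" where
  "max_step t = (SUP i. step t i)"

definition time_grid :: "(nat \<Rightarrow> real) \<Rightarrow> bool" where
  "time_grid t \<longleftrightarrow> t 0 = 0 \<and> strict_mono t \<and> bdd_above (range (step t))"

definition step_ratio_bounded :: "nat \<Rightarrow> real \<Rightarrow> (nat \<Rightarrow> real) \<Rightarrow> bool" where
  "step_ratio_bounded k r t \<longleftrightarrow>
     (\<forall>n m. \<bar>int n - int m\<bar> < int k \<longrightarrow> step t n / step t m \<le> r)"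

definition lagrange_basis :: "(nat \<Rightarrow> real) \<Rightarrow> nat \<Rightarrow> nat \<Rightarrow> nat \<Rightarrow> real \<Rightarrow> real" where
  "lagrange_basis t k n i s =
     (\<Prod>m\<in>{0..k - 1} - {i}.
        ((\<Sum>j = 1..m. step t (n - j)) + s) /
        ((\<Sum>j = 1..m. step t (n - j)) - (\<Sum>j = 1..i. step t (n - j))))"

(* U n s is u^n(s), so that u^n = u^n(t_n) is U n (t n); the starting values are U 0 (t 0), ...,
   U (k-1) (t (k-1)).  Each step is tested with v in D(L) intersected with D(L^p). *)
definition scheme_solution ::
  "('h::{real_inner,banach} \<times> 'h) set \<Rightarrow> real \<Rightarrow> ('h \<Rightarrow> 'h \<Rightarrow> real) \<Rightarrow> real \<Rightarrow> real \<Rightarrow> real \<Rightarrow> nat \<Rightarrow>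
     (nat \<Rightarrow> real) \<Rightarrow> (nat \<Rightarrow> real \<Rightarrow> 'h) \<Rightarrow> bool" where
  "scheme_solution G \<gamma> F \<epsilon> A p k t U \<longleftrightarrow>
     (\<forall>n\<ge>k - 1.
        (\<forall>s\<in>{0..t n}. U (Suc n) s = U n s) \<and>
        (\<forall>s\<in>{t n..t (Suc n)}. U (Suc n) s \<in> V_space G \<gamma>) \<and>
        continuous_on {t n..t (Suc n)} (\<lambda>s. op_pow G (\<gamma> / 2) (U (Suc n) s)) \<and>
        (\<forall>v\<in>V_space G 2 \<inter> V_space G (2 * p). \<forall>s\<in>{t n..t (Suc n)}.
           ((\<lambda>r. U (Suc n) r \<bullet> v + A * max_step t ^ k * (U (Suc n) r \<bullet> op_pow G p v))
              has_real_derivative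
                ((\<Sum>i = 0..k - 1. lagrange_basis t k n i (s - t n) * F (U (n - i) (t (n - i))) v)
                 - \<epsilon> * (U (Suc n) s \<bullet> op_pow G 1 v)))
             (at s within {t n..t (Suc n)})))"

end

theory Submission
  imports Defs
begin

text \<open>
On \<open>[t\<^sub>n, t\<^sub>n\<^sub>+\<^sub>1]\<close> the error \<open>e = u - U\<close> solves the linear equation
\<open>(e + A \<tau>\<^sup>k L\<^sup>p e)' + \<epsilon> L e = \<sigma> + A \<tau>\<^sup>k L\<^sup>p u'\<close>, where \<open>\<sigma>\<close> is \<open>F(u)\<close> minus the interpolant of the
computed values of \<open>F\<close>.  Test it with \<open>L\<^sup>\<lambda> e\<close>, \<open>\<lambda> = 1 - \<beta>\<close>.  The right-hand side is controlled in
\<open>V\<^sup>-\<^sup>\<beta>\<close>, so the test function is needed in \<open>V\<^sup>\<beta>\<close>, that is, \<open>e\<close> in \<open>V\<^sup>1\<^sup>+\<^sup>\<lambda>\<close>; this is exactly the norm that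
the dissipation \<open>\<epsilon> (L e, L\<^sup>\<lambda> e)\<close> provides.  By Young's inequality the energy
\<open>\<bar>e\<bar>\<^sub>\<lambda>\<^sup>2 + A \<tau>\<^sup>k \<bar>e\<bar>\<^sub>p\<^sub>+\<^sub>\<lambda>\<^sup>2\<close> grows during the step by at most \<open>1/\<epsilon>\<close> times the time integral of \<open>\<bar>\<sigma>\<bar>\<^sup>2\<close> in
\<open>V\<^sup>-\<^sup>\<beta>\<close> plus \<open>A\<^sup>2 \<tau>\<^sup>2\<^sup>k \<bar>u'\<bar>\<^sup>2\<close> in the norm of index \<open>2 p - \<beta>\<close>.  The second term already has the right order.
In \<open>\<sigma>\<close>, the interpolation error of \<open>F(u)\<close> is of order \<open>k\<close> in mean square because \<open>F(u)\<close> has \<open>k\<close> weak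
derivatives, interpolation reproduces polynomials of degree below \<open>k\<close>, and the Lagrange functions
are bounded when the step ratios are; the rest is bounded through the Lipschitz condition by the
errors at the \<open>k\<close> previous nodes, since \<open>\<gamma> \<le> \<lambda>\<close>.  A discrete Gronwall argument sums the steps.

The solutions are too irregular for this test: both equations hold only against smooth vectors, and
\<open>e\<close> is merely continuous in \<open>H\<close>.  The computation is therefore made for \<open>P\<^sub>m e\<close>, where the \<open>P\<^sub>m\<close> are
polynomials in \<open>S = L\<^sup>-\<^sup>1\<close> that map \<open>H\<close> into the domain of a high power of \<open>L\<close>, commute with all powers
of \<open>L\<close>, are uniformly bounded and converge strongly to the identity (\<open>smoothing_family_exists\<close>).
Testing with \<open>P\<^sub>m w\<close> turns the weak equations into an ordinary differential equation in \<open>H\<close>, the energy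
inequality for \<open>P\<^sub>m e\<close> has a right-hand side independent of \<open>m\<close>, and \<open>m \<rightarrow> \<infinity>\<close> gives the estimate
together with the regularity \<open>e \<in> V\<^sup>p\<^sup>+\<^sup>\<lambda>\<close> at the end of the step (\<open>energy_step\<close>).  Only powers
of \<open>S\<close> with exponent \<open>\<ge> 0\<close> occur: \<open>L\<^sup>a P\<^sub>m\<close> is written \<open>S\<^sup>N\<^sup>-\<^sup>a Q\<^sub>m\<close>.

Since \<open>H\<close> may be non-separable, a null set that depends on the vector paired with a function cannot be
removed.  Weak derivatives are hence always paired with a fixed vector first, and norm bounds are
recovered by choosing that vector afterwards (\<open>H_time_taylor\<close>, \<open>regularization_increment\<close>).
The estimate on one step is \<open>error_recursion\<close>, the summation \<open>discrete_gronwall\<close>.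
\<close>

section \<open>Hilbert space preliminaries\<close>

text \<open>
The nearest point exists because, by the parallelogram law, a minimizing sequence is Cauchy; the
difference to it is orthogonal to \<open>M\<close> since moving within \<open>M\<close> cannot shorten it.
\<close>

lemma closed_subspace_projection:
  fixes M :: "'h::{real_inner,banach} set"
  assumes "subspace M" "closed M"
  obtains m where "m \<in> M" "\<And>y. y \<in> M \<Longrightarrow> (x - m) \<bullet> y = 0"
proof -
  define d where "d = (INF m\<in>M. norm (x - m))"
  have ne: "M \<noteq> {}" using assms(1) subspace_0 by blast
  have bdd: "bdd_below ((\<lambda>m. norm (x - m)) ` M)" by (rule bdd_belowI[of _ 0]) auto
  have dle: "d \<le> norm (x - m)" if "m \<in> M" for m
    unfolding d_def using bdd that by (rule cINF_lower)
  have d0: "d \<ge> 0" unfolding d_def using ne by (intro cINF_greatest) auto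
  have "\<exists>m\<in>M. norm (x - m) < d + inverse (real (Suc n))" for n
    using cINF_less_iff[OF ne bdd, of "d + inverse (real (Suc n))"] by (simp add: d_def[symmetric])
  then obtain m where mM: "\<And>n. m n \<in> M" and md: "\<And>n. norm (x - m n) < d + inverse (real (Suc n))"
    by metis
  have lim: "(\<lambda>n. norm (x - m n)) \<longlonglongrightarrow> d"
  proof (rule tendsto_sandwich[of "\<lambda>_. d" _ _ "\<lambda>n. d + inverse (real (Suc n))"])
    show "(\<lambda>n. d + inverse (real (Suc n))) \<longlonglongrightarrow> d"
      using tendsto_add[OF tendsto_const LIMSEQ_inverse_real_of_nat, of d] by simp
  qed (auto intro!: always_eventually dle mM less_imp_le[OF md] simp del: of_nat_Suc)
  have par: "(norm (m i - m j))\<^sup>2 \<le> 2 * (norm (x - m i))\<^sup>2 + 2 * (norm (x - m j))\<^sup>2 - 4 * d\<^sup>2" for i j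
  proof -
    have "(1/2) *\<^sub>R (m i + m j) \<in> M" using assms(1) mM by (simp add: subspace_add subspace_scale)
    from dle[OF this] have "d\<^sup>2 \<le> (norm (x - (1/2) *\<^sub>R (m i + m j)))\<^sup>2"
      using d0 by (intro power_mono) auto
    moreover have "(norm (m i - m j))\<^sup>2 = 2 * (norm (x - m i))\<^sup>2 + 2 * (norm (x - m j))\<^sup>2
        - 4 * (norm (x - (1/2) *\<^sub>R (m i + m j)))\<^sup>2"
      by (simp add: power2_norm_eq_inner algebra_simps inner_commute)
    ultimately show ?thesis by linarith
  qed
  have "Cauchy m"
  proof (rule metric_CauchyI)
    fix e :: real assume "e > 0"
    have "(\<lambda>n. (norm (x - m n))\<^sup>2) \<longlonglongrightarrow> d\<^sup>2" by (intro tendsto_power lim)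
    from LIMSEQ_D[OF this, of "e\<^sup>2/4"] \<open>e > 0\<close>
    obtain N where N: "\<And>n. n \<ge> N \<Longrightarrow> \<bar>(norm (x - m n))\<^sup>2 - d\<^sup>2\<bar> < e\<^sup>2/4" by auto
    show "\<exists>M. \<forall>i\<ge>M. \<forall>j\<ge>M. dist (m i) (m j) < e"
    proof (intro exI allI impI)
      fix i j assume "N \<le> i" "N \<le> j"
      then have "(norm (m i - m j))\<^sup>2 < e\<^sup>2" using par[of i j] N[of i] N[of j] by linarith
      then show "dist (m i) (m j) < e" using \<open>e > 0\<close> by (simp add: dist_norm power2_less_imp_less)
    qed
  qed
  then obtain m0 where m0: "m \<longlonglongrightarrow> m0" using Cauchy_convergent_iff convergent_def by blast
  have m0M: "m0 \<in> M" using assms(2) mM m0 closed_sequentially by blast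
  have "(\<lambda>n. norm (x - m n)) \<longlonglongrightarrow> norm (x - m0)" by (intro tendsto_intros m0)
  then have nd: "norm (x - m0) = d" using lim LIMSEQ_unique by blast
  have "(x - m0) \<bullet> y = 0" if "y \<in> M" for y
  proof (cases "y = 0")
    case False
    define s where "s = ((x - m0) \<bullet> y) / (y \<bullet> y)"
    have yy: "y \<bullet> y > 0" using False by simp
    have "m0 + s *\<^sub>R y \<in> M" using assms(1) m0M that by (simp add: subspace_add subspace_scale)
    from dle[OF this] have "(norm (x - m0))\<^sup>2 \<le> (norm ((x - m0) - s *\<^sub>R y))\<^sup>2"
      using nd d0 by (intro power_mono) (auto simp: algebra_simps)
    also have "\<dots> = (norm (x - m0))\<^sup>2 - 2 * s * ((x - m0) \<bullet> y) + s\<^sup>2 * (y \<bullet> y)"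
      unfolding power2_norm_eq_inner
      by (simp add: inner_diff_left inner_diff_right inner_commute power2_eq_square)
    also have "\<dots> = (norm (x - m0))\<^sup>2 - ((x - m0) \<bullet> y)\<^sup>2 / (y \<bullet> y)"
      using yy by (simp add: s_def power2_eq_square field_simps)
    finally have "((x - m0) \<bullet> y)\<^sup>2 / (y \<bullet> y) \<le> 0" by linarith
    then have "((x - m0) \<bullet> y)\<^sup>2 \<le> 0" using yy by (simp add: divide_le_0_iff)
    then show ?thesis by simp
  qed simp
  with m0M show ?thesis using that by blast
qed

text \<open>
Subtract from a point its projection onto the closure: the difference is orthogonal to \<open>M\<close>.
\<close>

lemma dense_subspace_if_orthogonal_trivial:
  fixes M :: "'h::{real_inner,banach} set"
  assumes "subspace M" and orth: "\<And>h. (\<And>y. y \<in> M \<Longrightarrow> h \<bullet> y = 0) \<Longrightarrow> h = 0"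
  shows "closure M = UNIV"
proof -
  have "x \<in> closure M" for x
  proof -
    have "subspace (closure M)"
      unfolding subspace_def
    proof (intro conjI ballI allI)
      show "0 \<in> closure M" using subspace_0[OF assms(1)] closure_subset by blast
      show "x + y \<in> closure M" if xy: "x \<in> closure M" "y \<in> closure M" for x y
      proof -
        obtain f g where "\<And>n. f n \<in> M" "f \<longlonglongrightarrow> x" "\<And>n. g n \<in> M" "g \<longlonglongrightarrow> y"
          using xy unfolding closure_sequential by blast
        then show ?thesis unfolding closure_sequential
          by (intro exI[of _ "\<lambda>n. f n + g n"]) (auto intro: tendsto_add subspace_add[OF assms(1)])
      qed
      show "c *\<^sub>R x \<in> closure M" if x: "x \<in> closure M" for c x
      proof -
        obtain f where "\<And>n. f n \<in> M" "f \<longlonglongrightarrow> x"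
          using x unfolding closure_sequential by blast
        then show ?thesis unfolding closure_sequential
          by (intro exI[of _ "\<lambda>n. c *\<^sub>R f n"])
             (auto intro: tendsto_scaleR subspace_scale[OF assms(1)])
      qed
    qed
    then obtain m where m: "m \<in> closure M" "\<And>y. y \<in> closure M \<Longrightarrow> (x - m) \<bullet> y = 0"
      using closed_subspace_projection[of "closure M" x] by auto
    then have "x - m = 0" using closure_subset by (intro orth) blast
    with m show ?thesis by simp
  qed
  then show ?thesis by auto
qed

text \<open>
The representing vector spans the orthogonal complement of the kernel.
\<close>

lemma riesz_representation:
  fixes f :: "'h::{real_inner,banach} \<Rightarrow> real"
  assumes "bounded_linear f"
  obtains r where "\<And>x. f x = r \<bullet> x"
proof (cases "\<forall>x. f x = 0")
  case True
  then show ?thesis using that[of 0] by simp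
next
  case False
  then obtain x where x: "f x \<noteq> 0" by blast
  interpret f: bounded_linear f by fact
  have "closed (f -` {0})" by (intro closed_vimage) (auto intro!: linear_continuous_on assms)
  moreover have "subspace (f -` {0})" by (auto simp: subspace_def f.add f.scaleR)
  ultimately obtain m where m: "f m = 0" "\<And>y. f y = 0 \<Longrightarrow> (x - m) \<bullet> y = 0"
    using closed_subspace_projection[of "f -` {0}" x] by auto
  define z where "z = x - m"
  have fz: "f z \<noteq> 0" using x m by (simp add: z_def f.diff)
  then have zz: "z \<bullet> z \<noteq> 0" using f.zero by auto
  have "f y = ((f z / (z \<bullet> z)) *\<^sub>R z) \<bullet> y" for y
  proof -
    have "f (y - (f y / f z) *\<^sub>R z) = 0" using fz by (simp add: f.diff f.scaleR)
    then have "z \<bullet> (y - (f y / f z) *\<^sub>R z) = 0" using m(2) unfolding z_def by blast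
    then have "z \<bullet> y = (f y / f z) * (z \<bullet> z)" by (simp add: inner_diff_right)
    then show ?thesis using fz zz by simp
  qed
  then show ?thesis using that by blast
qed

text \<open>
The indefinite integral \<open>Y\<close> of the continuous right-hand side is differentiable in norm, and
\<open>y - Y\<close> is constant because it is constant against every vector.  Both weak equations become
differential equations in \<open>H\<close> through this lemma.
\<close>

lemma vector_derivative_if_tested:
  fixes y r :: "real \<Rightarrow> 'h::{real_inner,banach}"
  assumes cont: "continuous_on {a..b} r"
    and der: "\<And>w s. s \<in> {a..b} \<Longrightarrow>
      ((\<lambda>s. y s \<bullet> w) has_real_derivative (r s \<bullet> w)) (at s within {a..b})"
    and s: "s \<in> {a..b}"
  shows "(y has_vector_derivative r s) (at s within {a..b})"
proof -
  define Y where "Y = (\<lambda>s. integral {a..s} r)"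
  have Y: "(Y has_vector_derivative r s) (at s within {a..b})" if "s \<in> {a..b}" for s
    unfolding Y_def using cont that by (rule integral_has_vector_derivative)
  have eq: "y s = y a + Y s" if s: "s \<in> {a..b}" for s
  proof -
    have "(y s - Y s - y a) \<bullet> w = 0" for w
    proof -
      have d: "((\<lambda>s. (y s - Y s) \<bullet> w) has_real_derivative 0) (at x within {a..b})"
        if "x \<in> {a..b}" for x
      proof -
        have "((\<lambda>s. Y s \<bullet> w) has_vector_derivative (r x \<bullet> w)) (at x within {a..b})"
          by (rule bounded_linear.has_vector_derivative[OF bounded_linear_inner_left Y[OF that]])
        then have "((\<lambda>s. Y s \<bullet> w) has_real_derivative (r x \<bullet> w)) (at x within {a..b})"
          by (simp add: has_real_derivative_iff_has_vector_derivative)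
        from DERIV_diff[OF der[OF that, of w] this]
        show ?thesis by (simp add: inner_diff_left)
      qed
      have "\<exists>c. \<forall>x\<in>{a..b}. (y x - Y x) \<bullet> w = c"
        by (rule has_field_derivative_zero_constant[OF _ d]) auto
      then have "(y s - Y s) \<bullet> w = (y a - Y a) \<bullet> w" using s by fastforce
      moreover have "Y a = 0" by (simp add: Y_def)
      ultimately show ?thesis by (simp add: inner_diff_left)
    qed
    from this[of "y s - Y s - y a"] have "y s - Y s - y a = 0" by simp
    then show ?thesis by (simp add: algebra_simps)
  qed
  have "((\<lambda>s. y a + Y s) has_vector_derivative r s) (at s within {a..b})"
    using has_vector_derivative_add[OF has_vector_derivative_const Y[OF s], of "y a"] by simp
  then show ?thesis
    by (rule has_vector_derivative_transform[rotated 2]) (use s in \<open>auto intro!: eq\<close>)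
qed

section \<open>Fractional powers of a bounded positive operator\<close>

text \<open>
Coefficients of \<open>(1 - z)\<^sup>s\<close>, as in \<open>frac_pow\<close>.
\<close>

definition pow_coeff :: "real \<Rightarrow> nat \<Rightarrow> real" where
  "pow_coeff s i = (- 1) ^ i * (s gchoose i)"

lemma pow_coeff_Suc: "pow_coeff s (Suc i) = pow_coeff s i * ((real i - s) / real (Suc i))"
proof -
  have "s gchoose Suc i = (s gchoose i) * ((s - real i) / real (Suc i))"
    using gbinomial_absorb_comp[of s i] gbinomial_absorption[of i s]
    by (simp add: field_simps del: of_nat_Suc)
  moreover have "(s - real i) / real (Suc i) = - ((real i - s) / real (Suc i))"
    by (simp add: minus_divide_left)
  ultimately show ?thesis by (simp add: pow_coeff_def del: of_nat_Suc)
qed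

text \<open>
Multiplying \<open>(1 - z)\<^sup>s\<^sup>-\<^sup>1\<close> by \<open>1 - z\<close> takes differences of the coefficients, so they telescope.
\<close>

lemma sum_pow_coeff: "(\<Sum>i\<le>n. pow_coeff s i) = pow_coeff (s - 1) n"
  using gbinomial_sum_lower_neg[of s n] by (simp add: pow_coeff_def mult.commute)

text \<open>
From index \<open>N \<ge> s\<close> on the coefficients have one sign, so their absolute sums are, up to sign, sums of
coefficients; these are coefficients of \<open>(1 - z)\<^sup>s\<^sup>-\<^sup>1\<close>, whose absolute values decrease from \<open>N\<close> on
for \<open>s \<ge> 0\<close>.
\<close>

lemma summable_abs_pow_coeff:
  assumes "s \<ge> 0"
  shows "summable (\<lambda>i. \<bar>pow_coeff s i\<bar>)"
proof -
  define N where "N = nat \<lceil>s\<rceil>"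
  have N: "real N \<ge> s" unfolding N_def by (rule real_nat_ceiling_ge)
  define \<sigma> :: real where "\<sigma> = (if pow_coeff s N \<ge> 0 then 1 else - 1)"
  have sign: "\<bar>pow_coeff s (i + N)\<bar> = \<sigma> * pow_coeff s (i + N)" for i
  proof (induction i)
    case (Suc i)
    have ge: "(real (i + N) - s) / real (Suc (i + N)) \<ge> 0" using N by simp
    have "\<bar>pow_coeff s (Suc i + N)\<bar> = \<bar>pow_coeff s (i + N)\<bar> * ((real (i + N) - s) / real (Suc (i + N)))"
      unfolding add_Suc pow_coeff_Suc abs_mult abs_of_nonneg[OF ge] ..
    then show ?case unfolding Suc.IH by (simp add: pow_coeff_Suc del: of_nat_Suc of_nat_add)
  qed (simp add: \<sigma>_def)
  have dec: "\<bar>pow_coeff (s - 1) (i + N)\<bar> \<le> \<bar>pow_coeff (s - 1) N\<bar>" for i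
  proof (induction i)
    case (Suc i)
    have "\<bar>(real (i + N) - (s - 1)) / real (Suc (i + N))\<bar> \<le> 1"
      using N assms by (simp add: abs_le_iff field_simps)
    then have "\<bar>pow_coeff (s - 1) (Suc i + N)\<bar> \<le> \<bar>pow_coeff (s - 1) (i + N)\<bar>"
      unfolding add_Suc pow_coeff_Suc abs_mult by (intro mult_left_le) auto
    then show ?case using Suc.IH by linarith
  qed simp
  have "summable (\<lambda>i. \<bar>pow_coeff s (i + N)\<bar>)"
  proof (rule bounded_imp_summable)
    fix n
    have "(\<Sum>i\<le>n. \<bar>pow_coeff s (i + N)\<bar>) = \<sigma> * (\<Sum>i\<le>n. pow_coeff s (i + N))"
      by (simp add: sign sum_distrib_left)
    also have "(\<Sum>i\<le>n. pow_coeff s (i + N)) = (\<Sum>i\<le>n + N. pow_coeff s i) - (\<Sum>i<N. pow_coeff s i)"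
    proof -
      have "(\<Sum>i\<le>n + N. pow_coeff s i) = (\<Sum>i<Suc n + N. pow_coeff s i)"
        by (simp add: lessThan_Suc_atMost)
      also have "\<dots> = (\<Sum>i<N. pow_coeff s i) + (\<Sum>i<Suc n. pow_coeff s (i + N))"
        by (induction n) auto
      finally show ?thesis by (simp add: lessThan_Suc_atMost)
    qed
    also have "\<sigma> * ((\<Sum>i\<le>n + N. pow_coeff s i) - (\<Sum>i<N. pow_coeff s i))
        \<le> \<bar>pow_coeff (s - 1) N\<bar> + \<bar>\<Sum>i<N. pow_coeff s i\<bar>"
      using dec[of n] unfolding sum_pow_coeff by (auto simp: \<sigma>_def)
    finally show "(\<Sum>i\<le>n. \<bar>pow_coeff s (i + N)\<bar>)
        \<le> \<bar>pow_coeff (s - 1) N\<bar> + \<bar>\<Sum>i<N. pow_coeff s i\<bar>" .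
  qed simp
  then show ?thesis using summable_iff_shift[of "\<lambda>i. \<bar>pow_coeff s i\<bar>" N] by blast
qed

text \<open>
Vandermonde's identity; it is the group law \<open>z\<^sup>s z\<^sup>t = z\<^sup>s\<^sup>+\<^sup>t\<close> on the level of coefficients.
\<close>

lemma pow_coeff_convolution:
  "(\<Sum>i\<le>n. pow_coeff s i * pow_coeff t (n - i)) = pow_coeff (s + t) n"
proof -
  have "(\<Sum>i\<le>n. pow_coeff s i * pow_coeff t (n - i))
      = (\<Sum>i\<le>n. (- 1) ^ n * ((s gchoose i) * (t gchoose (n - i))))"
  proof (rule sum.cong[OF refl])
    fix i assume "i \<in> {..n}"
    then have "(- 1 :: real) ^ n = (- 1) ^ i * (- 1) ^ (n - i)" by (simp flip: power_add)
    then show "pow_coeff s i * pow_coeff t (n - i) = (- 1) ^ n * ((s gchoose i) * (t gchoose (n - i)))"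
      by (simp add: pow_coeff_def)
  qed
  also have "\<dots> = pow_coeff (s + t) n"
    using gbinomial_Vandermonde[of s t n] by (simp add: pow_coeff_def atMost_atLeast0 flip: sum_distrib_left)
  finally show ?thesis .
qed

text \<open>
\<open>S\<close> plays the role of \<open>L\<^sup>-\<^sup>1\<close>.  The nonzero vector makes \<open>onorm S\<close> positive, by which \<open>frac_pow\<close>
divides.
\<close>

locale positive_operator =
  fixes S :: "'h::{real_inner,banach} \<Rightarrow> 'h"
  assumes bounded: "bounded_linear S"
    and symmetric: "S x \<bullet> y = x \<bullet> S y"
    and nonneg: "0 \<le> S x \<bullet> x"
    and injective: "S x = 0 \<Longrightarrow> x = 0"
    and nontrivial: "\<exists>x::'h. x \<noteq> 0"
begin

sublocale S: bounded_linear S by (rule bounded)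

abbreviation M :: real where "M \<equiv> onorm S"

definition K :: "'h \<Rightarrow> 'h" where "K y = y - (1 / M) *\<^sub>R S y"

lemma M_pos: "M > 0"
proof -
  obtain x :: 'h where x: "x \<noteq> 0" using nontrivial by blast
  then have "S x \<noteq> 0" using injective by blast
  then show ?thesis using onorm_pos_lt[OF bounded] by blast
qed

lemma norm_S_le: "norm (S x) \<le> M * norm x"
  by (rule onorm[OF bounded])

text \<open>
Operator form of \<open>0 \<le> S \<le> M\<close> \<open>\<Longrightarrow>\<close> \<open>S\<^sup>2 \<le> M S\<close>: nonnegativity of \<open>S\<close> is applied at
\<open>y = x - S x / M\<close>.
\<close>

lemma norm_S_sq_le: "(norm (S x))\<^sup>2 \<le> M * (S x \<bullet> x)"
proof -
  define y where "y = x - (1 / M) *\<^sub>R S x"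
  have "S (S x) \<bullet> S x \<le> norm (S (S x)) * norm (S x)" by (rule norm_cauchy_schwarz)
  also have "\<dots> \<le> M * (norm (S x))\<^sup>2"
    using mult_right_mono[OF norm_S_le[of "S x"], of "norm (S x)"] by (simp add: power2_eq_square)
  finally have SS: "S (S x) \<bullet> S x \<le> M * (norm (S x))\<^sup>2" .
  have "0 \<le> M * (S y \<bullet> y)" using nonneg M_pos by simp
  also have "M * (S y \<bullet> y) = M * (S x \<bullet> x) - 2 * (norm (S x))\<^sup>2 + (S (S x) \<bullet> S x) / M"
    using M_pos symmetric[of "S x" x] by (simp add: y_def S.diff S.scaleR inner_diff_left inner_diff_right
        dot_square_norm field_simps power2_eq_square)
  also have "\<dots> \<le> M * (S x \<bullet> x) - 2 * (norm (S x))\<^sup>2 + (norm (S x))\<^sup>2"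
    using SS M_pos by (simp add: field_simps)
  finally show ?thesis by simp
qed

text \<open>
The gain \<open>\<bar>S x\<bar>\<^sup>2 / M\<^sup>2\<close> over \<open>\<bar>K x\<bar> \<le> \<bar>x\<bar>\<close> is what forces \<open>K\<^sup>n x \<rightarrow> 0\<close> in \<open>K_pow_tendsto_0\<close>.
\<close>

lemma norm_K_sq_le: "(norm (K x))\<^sup>2 \<le> (norm x)\<^sup>2 - (norm (S x))\<^sup>2 / M\<^sup>2"
proof -
  have "(norm (K x))\<^sup>2 = (norm x)\<^sup>2 - 2 / M * (S x \<bullet> x) + (norm (S x))\<^sup>2 / M\<^sup>2"
    unfolding K_def power2_norm_eq_inner
    by (simp add: inner_diff_left inner_diff_right inner_commute power2_eq_square field_simps)
  moreover have "(norm (S x))\<^sup>2 / M\<^sup>2 \<le> 1 / M * (S x \<bullet> x)"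
    using norm_S_sq_le[of x] M_pos by (simp add: field_simps power2_eq_square)
  ultimately show ?thesis by simp
qed

lemma norm_K_le: "norm (K x) \<le> norm x"
proof (rule power2_le_imp_le)
  have "(norm (S x))\<^sup>2 / M\<^sup>2 \<ge> 0" by simp
  then show "(norm (K x))\<^sup>2 \<le> (norm x)\<^sup>2" using norm_K_sq_le[of x] by linarith
qed simp

lemma norm_K_pow_le: "norm ((K ^^ n) x) \<le> norm x"
  by (induction n) (auto intro: order_trans[OF norm_K_le])

text \<open>
Symmetric members of the bicommutant of \<open>S\<close>.  Everything built from \<open>S\<close> below lies in this class, and
its members commute with each other without any computation.
\<close>

definition calculus :: "('h \<Rightarrow> 'h) \<Rightarrow> bool" where
  "calculus R \<longleftrightarrow> bounded_linear R \<and> (\<forall>x y. R x \<bullet> y = x \<bullet> R y) \<and>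
     (\<forall>Q. bounded_linear Q \<longrightarrow> (\<forall>x. Q (S x) = S (Q x)) \<longrightarrow> (\<forall>x. Q (R x) = R (Q x)))"

lemma calculus_bounded_linear: "calculus R \<Longrightarrow> bounded_linear R"
  and calculus_inner: "calculus R \<Longrightarrow> R x \<bullet> y = x \<bullet> R y"
  by (auto simp: calculus_def)

lemma calculus_bicommutant:
  "calculus R \<Longrightarrow> bounded_linear A \<Longrightarrow> (\<And>x. A (S x) = S (A x)) \<Longrightarrow> A (R x) = R (A x)"
  by (simp add: calculus_def)

lemma calculusI:
  assumes "bounded_linear R" "\<And>x y. R x \<bullet> y = x \<bullet> R y"
    "\<And>A x. bounded_linear A \<Longrightarrow> (\<And>x. A (S x) = S (A x)) \<Longrightarrow> A (R x) = R (A x)"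
  shows "calculus R"
  using assms unfolding calculus_def by blast

lemma calculus_S: "calculus S"
  by (simp add: calculus_def bounded symmetric)

lemma calculus_commute: "calculus Q \<Longrightarrow> calculus R \<Longrightarrow> Q (R x) = R (Q x)"
  by (rule calculus_bicommutant)
     (auto simp: calculus_bounded_linear intro: calculus_bicommutant[OF _ bounded, symmetric])

lemma calculus_id: "calculus (\<lambda>x. x)"
  by (simp add: calculus_def bounded_linear_ident)

lemma calculus_compose:
  assumes "calculus Q" "calculus R" shows "calculus (\<lambda>x. Q (R x))"
proof (rule calculusI)
  show "bounded_linear (\<lambda>x. Q (R x))"
    by (intro bounded_linear_compose[of Q R] calculus_bounded_linear assms)
  show "Q (R x) \<bullet> y = x \<bullet> Q (R y)" for x y
    by (simp add: calculus_inner[OF assms(1)] calculus_inner[OF assms(2)] calculus_commute[OF assms])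
  show "A (Q (R x)) = Q (R (A x))" if "bounded_linear A" "\<And>x. A (S x) = S (A x)" for A x
    using calculus_bicommutant[OF assms(1) that] calculus_bicommutant[OF assms(2) that] that(1) by simp
qed

lemma calculus_diff:
  assumes "calculus Q" "calculus R" shows "calculus (\<lambda>x. Q x - R x)"
proof (rule calculusI)
  show "bounded_linear (\<lambda>x. Q x - R x)"
    by (intro bounded_linear_sub calculus_bounded_linear assms)
  show "(Q x - R x) \<bullet> y = x \<bullet> (Q y - R y)" for x y
    using calculus_inner assms by (simp add: inner_diff_left inner_diff_right)
  show "A (Q x - R x) = Q (A x) - R (A x)"
    if "bounded_linear A" "\<And>x. A (S x) = S (A x)" for A x
    using calculus_bicommutant[OF assms(1) that] calculus_bicommutant[OF assms(2) that] that(1)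
    by (simp add: linear_diff[OF bounded_linear.linear])
qed

lemma calculus_scaleR:
  assumes "calculus R" shows "calculus (\<lambda>x. c *\<^sub>R R x)"
proof (rule calculusI)
  show "bounded_linear (\<lambda>x. c *\<^sub>R R x)"
    by (intro bounded_linear_const_scaleR calculus_bounded_linear assms)
  show "c *\<^sub>R R x \<bullet> y = x \<bullet> c *\<^sub>R R y" for x y
    using calculus_inner assms by simp
  show "A (c *\<^sub>R R x) = c *\<^sub>R R (A x)"
    if "bounded_linear A" "\<And>x. A (S x) = S (A x)" for A x
    using calculus_bicommutant[OF assms that] that(1) by (simp add: linear_scale[OF bounded_linear.linear])
qed

lemma calculus_K: "calculus K"
  unfolding K_def by (intro calculus_diff calculus_id calculus_scaleR calculus_S)

lemma calculus_K_pow: "calculus (K ^^ n)"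
proof (induction n)
  case (Suc n)
  then show ?case using calculus_compose[OF calculus_K Suc] by (simp add: o_def)
qed (simp add: calculus_id id_def)

lemma calculus_zero: "calculus (\<lambda>x. 0)"
  using calculus_scaleR[OF calculus_id, of 0] by simp

lemma calculus_add:
  assumes "calculus Q" "calculus R" shows "calculus (\<lambda>x. Q x + R x)"
  using calculus_diff[OF assms(1) calculus_scaleR[OF assms(2), of "- 1"]] by simp

lemma calculus_sum: "(\<And>i. i < n \<Longrightarrow> calculus (R i)) \<Longrightarrow> calculus (\<lambda>x. \<Sum>i<n. R i x)" for n :: nat
  by (induction n) (auto intro: calculus_zero calculus_add)

definition K_series :: "(nat \<Rightarrow> real) \<Rightarrow> 'h \<Rightarrow> 'h" where
  "K_series a x = (\<Sum>i. a i *\<^sub>R (K ^^ i) x)"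

lemma summable_K_series:
  assumes "summable (\<lambda>i. \<bar>a i\<bar>)"
  shows "summable (\<lambda>i. norm (a i *\<^sub>R (K ^^ i) x))"
  by (rule summable_comparison_test[OF _ summable_mult2[OF assms, of "norm x"]])
     (auto intro!: exI[of _ 0] mult_left_mono norm_K_pow_le)

lemmas K_series_sums = summable_norm_cancel[OF summable_K_series, THEN summable_sums, folded K_series_def]

lemma calculus_K_series:
  assumes a: "summable (\<lambda>i. \<bar>a i\<bar>)"
  shows "calculus (K_series a)"
proof (rule calculusI)
  note sums = K_series_sums[OF a]
  show "bounded_linear (K_series a)"
  proof (rule bounded_linear_intro[where K = "\<Sum>i. \<bar>a i\<bar>"])
    have lin: "linear (K ^^ i)" for i
      using calculus_K_pow by (simp add: calculus_def bounded_linear.linear)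
    show "K_series a (x + y) = K_series a x + K_series a y" for x y
      using sums_unique2[OF sums[of "x + y"]] sums_add[OF sums[of x] sums[of y]]
      by (simp add: linear_add[OF lin] scaleR_add_right)
    show "K_series a (r *\<^sub>R x) = r *\<^sub>R K_series a x" for r x
    proof -
      have "(\<lambda>i. a i *\<^sub>R (K ^^ i) (r *\<^sub>R x)) = (\<lambda>i. r *\<^sub>R (a i *\<^sub>R (K ^^ i) x))"
        by (simp add: linear_scale[OF lin] mult.commute)
      then show ?thesis
        using sums[of "r *\<^sub>R x"] sums_scaleR_right[OF sums[of x], of r] sums_unique2 by metis
    qed
    show "norm (K_series a x) \<le> norm x * (\<Sum>i. \<bar>a i\<bar>)" for x
    proof -
      have "norm (K_series a x) \<le> (\<Sum>i. norm (a i *\<^sub>R (K ^^ i) x))"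
        unfolding K_series_def by (rule summable_norm[OF summable_K_series[OF a]])
      also have "\<dots> \<le> (\<Sum>i. \<bar>a i\<bar> * norm x)"
        by (intro suminf_le summable_K_series summable_mult2 a) (auto intro!: mult_left_mono norm_K_pow_le)
      also have "\<dots> = (\<Sum>i. \<bar>a i\<bar>) * norm x" using suminf_mult2[OF a, of "norm x"] by simp
      finally show ?thesis by (simp add: mult.commute)
    qed
  qed
  show "K_series a x \<bullet> y = x \<bullet> K_series a y" for x y
  proof -
    have "(\<lambda>i. (a i *\<^sub>R (K ^^ i) x) \<bullet> y) sums (K_series a x \<bullet> y)"
      by (rule bounded_linear.sums[OF bounded_linear_inner_left sums])
    moreover have "(\<lambda>i. x \<bullet> (a i *\<^sub>R (K ^^ i) y)) sums (x \<bullet> K_series a y)"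
      by (rule bounded_linear.sums[OF bounded_linear_inner_right sums])
    moreover have "(\<lambda>i. (a i *\<^sub>R (K ^^ i) x) \<bullet> y) = (\<lambda>i. x \<bullet> (a i *\<^sub>R (K ^^ i) y))"
      using calculus_inner[OF calculus_K_pow] by simp
    ultimately show ?thesis by (metis sums_unique2)
  qed
  show "A (K_series a x) = K_series a (A x)"
    if A: "bounded_linear A" "\<And>x. A (S x) = S (A x)" for A x
  proof -
    have "(\<lambda>i. A (a i *\<^sub>R (K ^^ i) x)) sums A (K_series a x)"
      by (rule bounded_linear.sums[OF A(1) sums])
    moreover have "A (a i *\<^sub>R (K ^^ i) x) = a i *\<^sub>R (K ^^ i) (A x)" for i
      using calculus_bicommutant[OF calculus_K_pow A] A(1)
      by (simp add: linear_scale[OF bounded_linear.linear])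
    ultimately show ?thesis using sums[of "A x"] sums_unique2 by fastforce
  qed
qed

text \<open>
Cauchy product of operator series.  The terms left over when the partial products are compared with
the partial sums of \<open>c\<close> have indices in a square minus a triangle; they are dominated by the same
leftover for the numerical series of \<open>\<bar>a i\<bar>\<close> and \<open>\<bar>b i\<bar>\<close>, which tends to 0.
\<close>

lemma K_series_compose:
  assumes a: "summable (\<lambda>i. \<bar>a i\<bar>)" and b: "summable (\<lambda>i. \<bar>b i\<bar>)"
    and c: "summable (\<lambda>i. \<bar>c i\<bar>)" and conv: "\<And>n. (\<Sum>i\<le>n. a i * b (n - i)) = c n"
  shows "K_series a (K_series b x) = K_series c x"
proof -
  have lin: "linear (K ^^ i)" for i
    using calculus_K_pow by (simp add: calculus_def bounded_linear.linear)
  define A where "A n y = (\<Sum>i<n. a i *\<^sub>R (K ^^ i) y)" for n y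
  define B where "B n = (\<Sum>i<n. b i *\<^sub>R (K ^^ i) x)" for n
  define y where "y = K_series b x"
  have B: "B \<longlonglongrightarrow> y" using K_series_sums[OF b] unfolding sums_def B_def y_def .
  have Ay: "(\<lambda>n. A n y) \<longlonglongrightarrow> K_series a y" using K_series_sums[OF a] unfolding sums_def A_def .
  have Abd: "norm (A n z) \<le> (\<Sum>i. \<bar>a i\<bar>) * norm z" for n z
  proof -
    have "norm (A n z) \<le> (\<Sum>i<n. \<bar>a i\<bar> * norm z)"
      unfolding A_def by (rule sum_norm_le) (auto intro!: mult_left_mono norm_K_pow_le)
    also have "\<dots> \<le> (\<Sum>i. \<bar>a i\<bar>) * norm z"
      unfolding sum_distrib_right[symmetric] by (intro mult_right_mono sum_le_suminf a) auto
    finally show ?thesis .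
  qed
  have "(\<lambda>n. A n (B n - y)) \<longlonglongrightarrow> 0"
  proof (rule Lim_null_comparison)
    show "\<forall>\<^sub>F n in sequentially. norm (A n (B n - y)) \<le> (\<Sum>i. \<bar>a i\<bar>) * norm (B n - y)"
      using Abd by simp
    show "(\<lambda>n. (\<Sum>i. \<bar>a i\<bar>) * norm (B n - y)) \<longlonglongrightarrow> 0"
      by (intro tendsto_mult_right_zero tendsto_norm_zero LIM_zero B)
  qed
  from tendsto_add[OF this Ay] have AB: "(\<lambda>n. A n (B n)) \<longlonglongrightarrow> K_series a y"
    by (simp add: A_def linear_diff[OF lin] scaleR_diff_right sum_subtractf)
  let ?sq = "\<lambda>n::nat. {..<n} \<times> {..<n}" and ?tri = "\<lambda>n::nat. {(i,j). i + j < n}"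
  have tri: "?tri n \<subseteq> ?sq n" for n by auto
  have fin: "finite (?sq n)" for n by simp
  define f where "f = (\<lambda>(i,j). (a i * b j) *\<^sub>R (K ^^ (i + j)) x)"
  define g where "g = (\<lambda>(i,j). \<bar>a i\<bar> * \<bar>b j\<bar>)"
  have ABf: "A n (B n) = sum f (?sq n)" for n
    unfolding A_def B_def f_def sum.cartesian_product[symmetric]
    by (simp add: linear_sum[OF lin] linear_scale[OF lin] scaleR_sum_right funpow_add)
  have cf: "(\<Sum>m<n. c m *\<^sub>R (K ^^ m) x) = sum f (?tri n)" for n
    unfolding f_def sum.triangle_reindex
    by (simp add: conv[symmetric] scaleR_sum_left)
  have "(\<lambda>n. A n (B n) - (\<Sum>m<n. c m *\<^sub>R (K ^^ m) x)) \<longlonglongrightarrow> 0"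
  proof (rule Lim_null_comparison)
    show "\<forall>\<^sub>F n in sequentially. norm (A n (B n) - (\<Sum>m<n. c m *\<^sub>R (K ^^ m) x))
        \<le> (sum g (?sq n) - sum g (?tri n)) * norm x"
    proof (rule always_eventually, rule allI)
      fix n
      have "A n (B n) - (\<Sum>m<n. c m *\<^sub>R (K ^^ m) x) = sum f (?sq n - ?tri n)"
        unfolding ABf cf by (rule sum_diff[OF fin tri, symmetric])
      also have "norm \<dots> \<le> (\<Sum>z\<in>?sq n - ?tri n. g z * norm x)"
        by (rule sum_norm_le)
           (auto simp: f_def g_def abs_mult intro!: mult_left_mono norm_K_pow_le)
      also have "\<dots> = (sum g (?sq n) - sum g (?tri n)) * norm x"
        unfolding sum_diff[OF fin tri, symmetric] by (simp add: sum_distrib_right)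
      finally show "norm (A n (B n) - (\<Sum>m<n. c m *\<^sub>R (K ^^ m) x))
          \<le> (sum g (?sq n) - sum g (?tri n)) * norm x" .
    qed
    have sq: "sum g (?sq n) = (\<Sum>i<n. \<bar>a i\<bar>) * (\<Sum>i<n. \<bar>b i\<bar>)" for n
      unfolding g_def sum.cartesian_product[symmetric] sum_product ..
    have "(\<lambda>n. sum g (?sq n)) \<longlonglongrightarrow> (\<Sum>i. \<bar>a i\<bar>) * (\<Sum>i. \<bar>b i\<bar>)"
      unfolding sq by (intro tendsto_mult summable_LIMSEQ a b)
    moreover have "(\<lambda>n. sum g (?tri n)) \<longlonglongrightarrow> (\<Sum>i. \<bar>a i\<bar>) * (\<Sum>i. \<bar>b i\<bar>)"
      unfolding g_def sum.triangle_reindex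
      using Cauchy_product_sums[of "\<lambda>i. \<bar>a i\<bar>" "\<lambda>i. \<bar>b i\<bar>"] a b by (simp add: sums_def)
    ultimately have "(\<lambda>n. sum g (?sq n) - sum g (?tri n)) \<longlonglongrightarrow> 0"
      using tendsto_diff by fastforce
    then show "(\<lambda>n. (sum g (?sq n) - sum g (?tri n)) * norm x) \<longlonglongrightarrow> 0"
      by (rule tendsto_mult_left_zero)
  qed
  moreover have "(\<lambda>n. A n (B n) - (\<Sum>m<n. c m *\<^sub>R (K ^^ m) x)) \<longlonglongrightarrow> K_series a y - K_series c x"
    using K_series_sums[OF c] unfolding sums_def by (intro tendsto_diff AB)
  ultimately show ?thesis unfolding y_def using LIMSEQ_unique by fastforce
qed

abbreviation W :: "real \<Rightarrow> 'h \<Rightarrow> 'h" where "W \<equiv> frac_pow S"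

lemma W_eq: "W s = (\<lambda>x. (M powr s) *\<^sub>R K_series (pow_coeff s) x)"
  by (simp add: frac_pow_def K_series_def pow_coeff_def K_def[abs_def] fun_eq_iff)

lemma calculus_W: "s \<ge> 0 \<Longrightarrow> calculus (W s)"
  unfolding W_eq by (intro calculus_scaleR calculus_K_series summable_abs_pow_coeff)

lemma W_linear: "s \<ge> 0 \<Longrightarrow> linear (W s)"
  using calculus_W calculus_bounded_linear bounded_linear.linear by blast

lemma W_add: 
  assumes "s \<ge> 0" "t \<ge> 0" shows "W s (W t x) = W (s + t) x"
proof -
  have "linear (K_series (pow_coeff s))"
    using assms calculus_K_series summable_abs_pow_coeff
    by (simp add: calculus_def bounded_linear.linear)
  then show ?thesis
    unfolding W_eq using assms
    by (simp add: linear_scale powr_add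
        K_series_compose[OF summable_abs_pow_coeff summable_abs_pow_coeff summable_abs_pow_coeff
          pow_coeff_convolution])
qed

lemma W_0: "W 0 x = x"
proof -
  have "pow_coeff 0 i = (if i = 0 then 1 else 0)" for i
    by (simp add: pow_coeff_def gbinomial_0_left)
  then have "K_series (pow_coeff 0) x = (\<Sum>i\<in>{0}. pow_coeff 0 i *\<^sub>R (K ^^ i) x)"
    unfolding K_series_def by (intro suminf_finite) auto
  then show ?thesis using M_pos by (simp add: W_eq pow_coeff_def)
qed

lemma W_1: "W 1 x = S x" by (rule frac_pow_one[OF bounded])

text \<open>
A further power brings the exponent up to a natural number, where injectivity is that of \<open>S\<close>.
\<close>

lemma W_injective:
  assumes "s \<ge> 0" "W s x = 0" shows "x = 0"
proof -
  have nat: "W (real n) z = 0 \<Longrightarrow> z = 0" for n z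
  proof (induction n arbitrary: z)
    case (Suc n)
    have "W (real n) (S z) = 0" using W_add[of "real n" 1 z] Suc.prems by (simp add: W_1 add.commute)
    then show ?case using Suc.IH injective by blast
  qed (simp add: W_0)
  define n where "n = nat \<lceil>s\<rceil>"
  have n: "real n - s \<ge> 0" using real_nat_ceiling_ge[of s] by (simp add: n_def)
  have "W (real n) x = W (real n - s) (W s x)" using W_add[OF n assms(1)] by simp
  also have "\<dots> = 0" using assms(2) linear_0[OF W_linear[OF n]] by simp
  finally show ?thesis by (rule nat)
qed

lemma W_inject: "s \<ge> 0 \<Longrightarrow> W s x = W s y \<longleftrightarrow> x = y"
  using W_injective[of s "x - y"] by (auto simp: linear_diff[OF W_linear])

lemma W_inner: "s \<ge> 0 \<Longrightarrow> W s x \<bullet> y = x \<bullet> W s y"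
  by (rule calculus_inner[OF calculus_W])

lemma W_commute: "s \<ge> 0 \<Longrightarrow> calculus R \<Longrightarrow> R (W s x) = W s (R x)"
  using calculus_commute calculus_W by blast

lemma dense_range_W:
  assumes "s \<ge> 0" shows "closure (range (W s)) = UNIV"
proof (rule dense_subspace_if_orthogonal_trivial)
  show "subspace (range (W s))" using linear_subspace_image[OF W_linear[OF assms]] by simp
  fix h assume h: "\<And>y. y \<in> range (W s) \<Longrightarrow> h \<bullet> y = 0"
  have "W s h \<bullet> W s h = h \<bullet> W s (W s h)" by (rule W_inner[OF assms])
  also have "\<dots> = 0" by (rule h) simp
  finally show "h = 0" using W_injective[OF assms] by simp
qed

text \<open>
How regularity is gained in a limit: if \<open>x\<close> is a limit of \<open>W s (y n)\<close> with \<open>y n\<close> bounded, then \<open>y n\<close>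
converges weakly, because it converges against the dense range of \<open>W s\<close>, and \<open>x\<close> is the image of the
weak limit.
\<close>

lemma in_range_W_if_bounded:
  assumes s: "s \<ge> 0" and bd: "\<And>n. norm (y n) \<le> C" and lim: "(\<lambda>n. W s (y n)) \<longlonglongrightarrow> x"
  shows "x \<in> range (W s)"
proof -
  have C: "C \<ge> 0" using bd[of 0] norm_ge_zero order_trans by blast
  \<comment> \<open>An \<open>\<epsilon>/3\<close> argument: replace \<open>w\<close> by a nearby \<open>W s v\<close>.\<close>
  have cau: "Cauchy (\<lambda>n. y n \<bullet> w)" for w
  proof (rule metric_CauchyI)
    fix e :: real assume e: "e > 0"
    have "w \<in> closure (range (W s))" by (simp add: dense_range_W[OF s])
    then obtain v where v: "norm (W s v - w) < e / (3 * (C + 1))"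
      using e C unfolding closure_approachable dist_norm by (force dest!: spec[of _ "e / (3 * (C + 1))"])
    have "(\<lambda>n. W s (y n) \<bullet> v) \<longlonglongrightarrow> x \<bullet> v" by (intro tendsto_intros lim)
    then have "Cauchy (\<lambda>n. y n \<bullet> W s v)" by (simp add: W_inner[OF s] LIMSEQ_imp_Cauchy)
    from metric_CauchyD[OF this, of "e/3"] e obtain N where
      N: "\<And>m n. m \<ge> N \<Longrightarrow> n \<ge> N \<Longrightarrow> \<bar>y m \<bullet> W s v - y n \<bullet> W s v\<bar> < e / 3"
      by (auto simp: dist_real_def)
    have small: "\<bar>y n \<bullet> (W s v - w)\<bar> \<le> e / 3" for n
    proof -
      have "\<bar>y n \<bullet> (W s v - w)\<bar> \<le> norm (y n) * norm (W s v - w)" by (rule Cauchy_Schwarz_ineq2)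
      also have "\<dots> \<le> (C + 1) * (e / (3 * (C + 1)))"
        using bd[of n] v C by (intro mult_mono) auto
      also have "\<dots> = e / 3" using C by (simp add: divide_simps)
      finally show ?thesis .
    qed
    show "\<exists>N. \<forall>m\<ge>N. \<forall>n\<ge>N. dist (y m \<bullet> w) (y n \<bullet> w) < e"
    proof (intro exI allI impI)
      fix m n assume "m \<ge> N" "n \<ge> N"
      then show "dist (y m \<bullet> w) (y n \<bullet> w) < e"
        using N[of m n] small[of m] small[of n] unfolding dist_real_def inner_diff_right by linarith
    qed
  qed
  define f where "f w = lim (\<lambda>n. y n \<bullet> w)" for w
  have f: "(\<lambda>n. y n \<bullet> w) \<longlonglongrightarrow> f w" for w
    unfolding f_def using cau real_Cauchy_convergent convergent_LIMSEQ_iff by blast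
  have "bounded_linear f"
  proof (rule bounded_linear_intro[where K = C])
    show "f (v + w) = f v + f w" for v w
      using LIMSEQ_unique[OF f[of "v + w"]] tendsto_add[OF f[of v] f[of w]]
      by (simp add: inner_add_right)
    show "f (r *\<^sub>R w) = r *\<^sub>R f w" for r w
      using LIMSEQ_unique[OF f[of "r *\<^sub>R w"]] tendsto_mult_left[OF f[of w], of r] by simp
    show "norm (f w) \<le> norm w * C" for w
    proof (rule tendsto_upperbound[OF tendsto_norm[OF f]])
      have "norm (y n \<bullet> w) \<le> norm w * C" for n
        using order_trans[OF Cauchy_Schwarz_ineq2 mult_right_mono[OF bd[of n] norm_ge_zero[of w]]]
        by (simp add: mult.commute)
      then show "\<forall>\<^sub>F n in sequentially. norm (y n \<bullet> w) \<le> norm w * C" by simp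
    qed simp
  qed
  then obtain r where r: "\<And>w. f w = r \<bullet> w" using riesz_representation by blast
  have "x \<bullet> w = W s r \<bullet> w" for w
  proof -
    have "(\<lambda>n. W s (y n) \<bullet> w) \<longlonglongrightarrow> x \<bullet> w" by (intro tendsto_intros lim)
    then have "(\<lambda>n. y n \<bullet> W s w) \<longlonglongrightarrow> x \<bullet> w" by (simp add: W_inner[OF s])
    then have "x \<bullet> w = f (W s w)" using f LIMSEQ_unique by blast
    then show ?thesis by (simp add: r W_inner[OF s])
  qed
  then have "x = W s r" by (metis inner_commute vector_eq_rdot)
  then show ?thesis by simp
qed

text \<open>
The squares \<open>\<bar>K\<^sup>n z\<bar>\<^sup>2\<close> decrease, hence converge, and their differences bound \<open>\<bar>S K\<^sup>n z\<bar>\<^sup>2\<close>.  So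
\<open>K\<^sup>n\<close> tends to 0 on the range of \<open>S\<close>, which is dense, and \<open>K\<close> is a contraction.
\<close>

lemma K_pow_tendsto_0: "(\<lambda>n. (K ^^ n) x) \<longlonglongrightarrow> 0"
proof -
  have S0: "(\<lambda>n. (K ^^ n) (S z)) \<longlonglongrightarrow> 0" for z
  proof -
    define d where "d n = (norm ((K ^^ n) z))\<^sup>2" for n
    have drop: "(norm (S ((K ^^ n) z)))\<^sup>2 \<le> M\<^sup>2 * (d n - d (Suc n))" for n
      using norm_K_sq_le[of "(K ^^ n) z"] M_pos by (simp add: d_def field_simps)
    have "decseq d"
      unfolding d_def by (rule decseq_SucI) (simp add: power_mono norm_K_le)
    then have "convergent d"
      by (intro Bseq_monoseq_convergent decseq_bounded[of _ 0] decseq_imp_monoseq) (auto simp: d_def)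
    then obtain l where l: "d \<longlonglongrightarrow> l" by (auto simp: convergent_def)
    have lim: "(\<lambda>n. M\<^sup>2 * (d n - d (Suc n))) \<longlonglongrightarrow> 0"
      using tendsto_mult_left[OF tendsto_diff[OF l LIMSEQ_Suc[OF l]], of "M\<^sup>2"]
      unfolding diff_self mult_zero_right .
    have "(\<lambda>n. (norm (S ((K ^^ n) z)))\<^sup>2) \<longlonglongrightarrow> 0"
    proof (rule Lim_null_comparison[OF always_eventually lim], rule allI)
      show "norm ((norm (S ((K ^^ n) z)))\<^sup>2) \<le> M\<^sup>2 * (d n - d (Suc n))" for n
        using drop[of n] by (simp only: real_norm_def abs_of_nonneg[OF zero_le_power2])
    qed
    then have "(\<lambda>n. sqrt ((norm (S ((K ^^ n) z)))\<^sup>2)) \<longlonglongrightarrow> sqrt 0"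
      by (rule tendsto_real_sqrt)
    then show ?thesis
      unfolding calculus_commute[OF calculus_S calculus_K_pow] real_sqrt_abs abs_norm_cancel real_sqrt_zero
      by (rule tendsto_norm_zero_cancel)
  qed
  show ?thesis
  proof (rule LIMSEQ_I)
    fix e :: real assume e: "e > 0"
    have "x \<in> closure (range S)" using dense_range_W[of 1] by (simp add: W_1[abs_def])
    then obtain z where z: "norm (S z - x) < e / 2"
      using e unfolding closure_approachable dist_norm by (force dest!: spec[of _ "e / 2"])
    obtain N where N: "\<And>n. n \<ge> N \<Longrightarrow> norm ((K ^^ n) (S z)) < e / 2"
      using LIMSEQ_D[OF S0[of z], of "e / 2"] e by auto
    have "norm ((K ^^ n) x) < e" if "n \<ge> N" for n
    proof -
      have "(K ^^ n) x = (K ^^ n) (S z) - (K ^^ n) (S z - x)"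
        using calculus_K_pow[of n] by (simp add: calculus_def bounded_linear.linear linear_diff)
      then have "norm ((K ^^ n) x) \<le> norm ((K ^^ n) (S z)) + norm ((K ^^ n) (S z - x))"
        by (metis norm_triangle_ineq4)
      then show ?thesis using N[OF that] norm_K_pow_le[of n "S z - x"] z by linarith
    qed
    then show "\<exists>N. \<forall>n\<ge>N. norm ((K ^^ n) x - 0) < e" by auto
  qed
qed

text \<open>
\<open>P n\<close> approximates the identity and equals \<open>S\<^sup>N\<close> times a bounded operator, so \<open>L\<^sup>a (P n)\<close> is the bounded
operator \<open>W (N - a) (Q n)\<close> for \<open>0 \<le> a \<le> N\<close>.
\<close>

definition smoothing_family :: "nat \<Rightarrow> real \<Rightarrow> (nat \<Rightarrow> 'h \<Rightarrow> 'h) \<Rightarrow> (nat \<Rightarrow> 'h \<Rightarrow> 'h) \<Rightarrow> bool" where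
  "smoothing_family N B P Q \<longleftrightarrow>
     (\<forall>n. calculus (P n) \<and> calculus (Q n)) \<and> (\<forall>n x. P n x = W (real N) (Q n x)) \<and>
     (\<forall>n x. norm (P n x) \<le> B * norm x) \<and> (\<forall>x. (\<lambda>n. P n x) \<longlonglongrightarrow> x)"

text \<open>
\<open>P n = (1 - K\<^sup>n)\<^sup>N\<close>.  The geometric sum \<open>R n\<close> gives \<open>1 - K\<^sup>n = S (R n)\<close>, hence one factor \<open>S\<close> for
each factor of \<open>P n\<close>.
\<close>

lemma smoothing_family_exists: "\<exists>B\<ge>0. \<exists>P Q. smoothing_family N B P Q"
proof (induction N)
  case 0
  have "smoothing_family 0 1 (\<lambda>n x. x) (\<lambda>n x. x)"
    by (simp add: smoothing_family_def calculus_id W_0)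
  then show ?case by (meson zero_le_one)
next
  case (Suc N)
  then obtain B P Q where B: "B \<ge> 0" and PQ: "smoothing_family N B P Q" by blast
  have P: "calculus (P n)" and Q: "calculus (Q n)" and PW: "P n x = W (real N) (Q n x)"
    and PB: "norm (P n x) \<le> B * norm x" and Plim: "(\<lambda>n. P n x) \<longlonglongrightarrow> x" for n x
    using PQ by (auto simp: smoothing_family_def)
  define R where "R n x = (1 / M) *\<^sub>R (\<Sum>i<n. (K ^^ i) x)" for n x
  have R: "calculus (R n)" for n
    unfolding R_def by (intro calculus_scaleR calculus_sum calculus_K_pow)
  have SR: "S (R n x) = x - (K ^^ n) x" for n x
  proof (induction n)
    case (Suc n)
    have "S (R (Suc n) x) = S (R n x) + (1 / M) *\<^sub>R S ((K ^^ n) x)"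
      by (simp add: R_def scaleR_add_right S.add S.scaleR)
    then show ?case by (simp add: Suc.IH K_def[of "(K ^^ n) x"])
  qed (simp add: R_def S.zero)
  have "smoothing_family (Suc N) (2 * B) (\<lambda>n x. P n (S (R n x))) (\<lambda>n x. Q n (R n x))"
    unfolding smoothing_family_def
  proof (intro conjI allI)
    show "calculus (\<lambda>x. P n (S (R n x)))" for n
      by (rule calculus_compose[OF P calculus_compose[OF calculus_S R]])
    show "calculus (\<lambda>x. Q n (R n x))" for n
      by (rule calculus_compose[OF Q R])
    show "P n (S (R n x)) = W (real (Suc N)) (Q n (R n x))" for n x
      using W_add[of "real N" 1 "Q n (R n x)"]
      by (simp add: PW W_1 add.commute calculus_commute[OF Q calculus_S])
    show "norm (P n (S (R n x))) \<le> 2 * B * norm x" for n x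
    proof -
      have "norm (S (R n x)) \<le> 2 * norm x"
        unfolding SR using norm_triangle_ineq4[of x "(K ^^ n) x"] norm_K_pow_le[of n x] by linarith
      then have "B * norm (S (R n x)) \<le> B * (2 * norm x)" using B by (rule mult_left_mono)
      then show ?thesis using PB[of n "S (R n x)"] by simp
    qed
    show "(\<lambda>n. P n (S (R n x))) \<longlonglongrightarrow> x" for x
    proof -
      have "(\<lambda>n. P n ((K ^^ n) x)) \<longlonglongrightarrow> 0"
      proof (rule Lim_null_comparison)
        show "\<forall>\<^sub>F n in sequentially. norm (P n ((K ^^ n) x)) \<le> B * norm ((K ^^ n) x)"
          by (simp add: PB)
        show "(\<lambda>n. B * norm ((K ^^ n) x)) \<longlonglongrightarrow> 0"
          by (intro tendsto_mult_right_zero tendsto_norm_zero K_pow_tendsto_0)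
      qed
      from tendsto_diff[OF Plim[of x] this] show ?thesis
        unfolding SR using P by (simp add: calculus_def bounded_linear.linear linear_diff)
    qed
  qed
  then show ?case using B by (intro exI[of _ "2 * B"]) auto
qed

end

section \<open>The inverse of a positive definite self-adjoint operator\<close>

lemma adjoint_graph_subspace: "subspace (adjoint_graph G)"
  by (auto simp: subspace_def adjoint_graph_def inner_add_right split_beta)

lemma selfadjoint_symmetric:
  assumes "selfadjoint G" "(x, w) \<in> G" "(y, z) \<in> G"
  shows "w \<bullet> y = x \<bullet> z"
proof -
  have "(y, z) \<in> adjoint_graph G" using assms by (simp add: selfadjoint_def)
  then show ?thesis using assms(2) by (auto simp: adjoint_graph_def)
qed

lemma selfadjoint_closed:
  assumes "selfadjoint G" "\<And>n. (x n, w n) \<in> G" "x \<longlonglongrightarrow> x0" "w \<longlonglongrightarrow> w0"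
  shows "(x0, w0) \<in> G"
proof -
  have "b \<bullet> x0 = a \<bullet> w0" if ab: "(a, b) \<in> G" for a b
  proof -
    have "(\<lambda>n. b \<bullet> x n) \<longlonglongrightarrow> b \<bullet> x0" "(\<lambda>n. a \<bullet> w n) \<longlonglongrightarrow> a \<bullet> w0"
      using assms(3,4) by (auto intro: tendsto_intros)
    moreover have "b \<bullet> x n = a \<bullet> w n" for n
      by (rule selfadjoint_symmetric[OF assms(1) ab assms(2)])
    ultimately show ?thesis using LIMSEQ_unique by fastforce
  qed
  then have "(x0, w0) \<in> adjoint_graph G" by (auto simp: adjoint_graph_def)
  then show ?thesis using assms(1) by (simp add: selfadjoint_def)
qed

text \<open>
Coercivity makes the graph the graph of an injective operator with closed range.  A vector orthogonal
to the range lies, with value 0, in the graph of the adjoint, which is \<open>G\<close> itself, so it vanishes by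
coercivity; hence the operator is onto and has a bounded inverse.
\<close>

lemma positive_operator_inverse_operator:
  fixes G :: "('h::{real_inner,banach} \<times> 'h) set"
  assumes sa: "selfadjoint G" and pd: "positive_definite c G" and nt: "\<exists>x::'h. x \<noteq> 0"
  shows "positive_operator (inverse_operator G)"
proof -
  have c: "c > 0" and coer: "\<And>v w. (v, w) \<in> G \<Longrightarrow> c * (norm v)\<^sup>2 \<le> w \<bullet> v"
    using pd by (auto simp: positive_definite_def)
  have sub: "subspace G"
    using adjoint_graph_subspace[of G] sa by (simp add: selfadjoint_def)
  have bound: "c * norm v \<le> norm w" if "(v, w) \<in> G" for v w
  proof (cases "v = 0")
    case False
    have "c * norm v * norm v \<le> norm w * norm v"
      using coer[OF that] norm_cauchy_schwarz[of w v] by (simp add: power2_eq_square)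
    then show ?thesis using False by simp
  qed simp
  have inj: "v = 0" if "(v, 0) \<in> G" for v using bound[OF that] c by (simp add: mult_le_0_iff)
  have uniq: "v = v'" if "(v, h) \<in> G" "(v', h) \<in> G" for v v' h
    using inj[of "v - v'"] subspace_diff[OF sub that] by simp
  have "h \<in> Range G" for h
  proof -
    have "subspace (Range G)"
      using sub linear_subspace_image[OF linear_snd sub] by (simp add: Range_snd)
    moreover have "h = 0" if "\<And>y. y \<in> Range G \<Longrightarrow> h \<bullet> y = 0" for h
    proof -
      have "(h, 0) \<in> adjoint_graph G" using that by (auto simp: adjoint_graph_def inner_commute)
      then show ?thesis using inj sa by (simp add: selfadjoint_def)
    qed
    ultimately have "closure (Range G) = UNIV" by (rule dense_subspace_if_orthogonal_trivial)
    then have "h \<in> closure (Range G)" by simp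
    then obtain w where wR: "\<And>n. w n \<in> Range G" and w: "w \<longlonglongrightarrow> h"
      unfolding closure_sequential by blast
    have "\<forall>n. \<exists>v. (v, w n) \<in> G" using wR by blast
    then obtain v where v: "\<And>n. (v n, w n) \<in> G" by metis
    have "Cauchy v"
    proof (rule metric_CauchyI)
      fix e :: real assume "e > 0"
      then have "c * e > 0" using c by simp
      from metric_CauchyD[OF LIMSEQ_imp_Cauchy[OF w] this]
      obtain N where N: "\<And>m n. m \<ge> N \<Longrightarrow> n \<ge> N \<Longrightarrow> dist (w m) (w n) < c * e" by blast
      have "dist (v m) (v n) < e" if "m \<ge> N" "n \<ge> N" for m n
      proof -
        have "c * norm (v m - v n) \<le> norm (w m - w n)"
          using bound[of "v m - v n" "w m - w n"] subspace_diff[OF sub v[of m] v[of n]] by simp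
        then have "c * dist (v m) (v n) < c * e" using N[OF that] by (simp add: dist_norm)
        then show ?thesis using c by simp
      qed
      then show "\<exists>N. \<forall>m\<ge>N. \<forall>n\<ge>N. dist (v m) (v n) < e" by blast
    qed
    then obtain v0 where "v \<longlonglongrightarrow> v0" using Cauchy_convergent_iff convergent_def by blast
    from selfadjoint_closed[OF sa v this w] show ?thesis by blast
  qed
  then have ex1: "\<exists>!v. (v, h) \<in> G" for h using uniq by blast
  let ?S = "inverse_operator G"
  have S: "(?S h, h) \<in> G" for h unfolding inverse_operator_def by (rule theI'[OF ex1])
  show ?thesis
  proof (rule positive_operator.intro)
    show "bounded_linear ?S"
    proof (rule bounded_linear_intro[where K = "1 / c"])
      show "?S (x + y) = ?S x + ?S y" for x y
        by (rule uniq[OF S]) (use subspace_add[OF sub S[of x] S[of y]] in simp)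
      show "?S (r *\<^sub>R x) = r *\<^sub>R ?S x" for r x
        by (rule uniq[OF S]) (use subspace_scale[OF sub S[of x]] in simp)
      show "norm (?S x) \<le> norm x * (1 / c)" for x
        using bound[OF S[of x]] c by (simp add: field_simps)
    qed
    show "?S x \<bullet> y = x \<bullet> ?S y" for x y
      using selfadjoint_symmetric[OF sa S[of x] S[of y]] by simp
    show "0 \<le> ?S x \<bullet> x" for x
    proof -
      have "0 \<le> c * (norm (?S x))\<^sup>2" using c by simp
      then show ?thesis using coer[OF S[of x]] by (simp add: inner_commute)
    qed
    show "x = 0" if "?S x = 0" for x
    proof -
      have "x \<bullet> y = 0" if "y \<in> Domain G" for y
        using that selfadjoint_symmetric[OF sa S[of x]] \<open>?S x = 0\<close> by auto
      then have "Domain G \<subseteq> {y. x \<bullet> y = 0}" by blast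
      then have "closure (Domain G) \<subseteq> {y. x \<bullet> y = 0}"
        by (rule closure_minimal) (rule closed_hyperplane)
      then have "x \<in> {y. x \<bullet> y = 0}" using sa unfolding selfadjoint_def by blast
      then show ?thesis by simp
    qed
    show "\<exists>x::'h. x \<noteq> 0" by (rule nt)
  qed
qed

text \<open>
From here on \<open>W s\<close> is \<open>L\<^sup>-\<^sup>s\<close>, and the lemmas below translate the spaces and norms of the operator
into statements about \<open>W\<close>.
\<close>

locale operator_graph =
  fixes G :: "('h::{real_inner,banach} \<times> 'h) set"
  assumes positive_inverse: "positive_operator (inverse_operator G)"
begin

sublocale positive_operator "inverse_operator G" by (rule positive_inverse)

lemma V_space_eq: "a \<ge> 0 \<Longrightarrow> V_space G a = range (W (a / 2))"
  by (simp add: V_space_def)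

lemma op_pow_W: "s \<ge> 0 \<Longrightarrow> op_pow G s (W s w) = w"
  unfolding op_pow_def by (simp add: W_inject)

lemma op_pow_neg: "s < 0 \<Longrightarrow> op_pow G s v = W (- s) v"
  by (simp add: op_pow_def)

lemma W_op_pow: "a \<ge> 0 \<Longrightarrow> v \<in> V_space G a \<Longrightarrow> W (a / 2) (op_pow G (a / 2) v) = v"
  by (auto simp: V_space_eq op_pow_W)

lemma op_pow_W_ge:
  assumes "0 \<le> s" "s \<le> t" shows "op_pow G s (W t w) = W (t - s) w"
proof -
  have "W t w = W s (W (t - s) w)" using assms W_add[of s "t - s"] by simp
  then show ?thesis using op_pow_W assms(1) by simp
qed

lemma W_in_V_space: "0 \<le> a \<Longrightarrow> a \<le> 2 * t \<Longrightarrow> W t w \<in> V_space G a"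
  using W_add[of "a / 2" "t - a / 2" w] by (auto simp: V_space_eq intro!: image_eqI[of _ _ "W (t - a / 2) w"])

lemma V_norm_W: "0 \<le> a \<Longrightarrow> a \<le> 2 * t \<Longrightarrow> V_norm G a (W t w) = norm (W (t - a / 2) w)"
  by (simp add: V_norm_def op_pow_W_ge)

lemma V_space_diff: 
  assumes "a \<ge> 0" "u \<in> V_space G a" "v \<in> V_space G a"
  shows "u - v \<in> V_space G a" "op_pow G (a / 2) (u - v) = op_pow G (a / 2) u - op_pow G (a / 2) v"
proof -
  obtain x y where xy: "u = W (a / 2) x" "v = W (a / 2) y" using assms by (auto simp: V_space_eq)
  then have "u - v = W (a / 2) (x - y)" using assms(1) by (simp add: linear_diff[OF W_linear])
  then show "u - v \<in> V_space G a" "op_pow G (a / 2) (u - v) = op_pow G (a / 2) u - op_pow G (a / 2) v"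
    using assms(1) xy by (auto simp: V_space_eq op_pow_W)
qed

text \<open>
The functional \<open>w \<mapsto> f (W (\<beta>/2) w)\<close> is bounded on \<open>H\<close>, so the Riesz representation shows that the
description by which \<open>dual_op_pow\<close> is defined has a solution.
\<close>

lemma dual_op_pow_W:
  assumes "\<beta> \<ge> 0" and f: "f \<in> V_dual G \<beta>"
  shows "f (W (\<beta> / 2) w) = dual_op_pow G \<beta> f \<bullet> w"
proof -
  have b: "\<beta> / 2 \<ge> 0" using assms(1) by simp
  have WV: "W (\<beta> / 2) w \<in> V_space G \<beta>" for w by (rule W_in_V_space) (use assms(1) in auto)
  obtain B where B: "\<And>v. v \<in> V_space G \<beta> \<Longrightarrow> \<bar>f v\<bar> \<le> B * V_norm G \<beta> v"
    using f unfolding V_dual_def by blast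
  have "bounded_linear (\<lambda>w. f (W (\<beta> / 2) w))"
  proof (rule bounded_linear_intro[where K = B])
    show "f (W (\<beta> / 2) (x + y)) = f (W (\<beta> / 2) x) + f (W (\<beta> / 2) y)" for x y
      using f WV by (simp add: V_dual_def linear_add[OF W_linear[OF b]])
    show "f (W (\<beta> / 2) (r *\<^sub>R x)) = r *\<^sub>R f (W (\<beta> / 2) x)" for r x
      using f WV by (simp add: V_dual_def linear_scale[OF W_linear[OF b]])
    show "norm (f (W (\<beta> / 2) x)) \<le> norm x * B" for x
      using B[OF WV[of x]] V_norm_W[of \<beta> "\<beta> / 2" x] assms(1) by (simp add: W_0 mult.commute)
  qed
  then obtain r where r: "\<And>w. f (W (\<beta> / 2) w) = r \<bullet> w" using riesz_representation by blast
  have "dual_op_pow G \<beta> f = r"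
    unfolding dual_op_pow_def
  proof (rule the_equality)
    show "\<forall>v\<in>V_space G \<beta>. f v = r \<bullet> op_pow G (\<beta> / 2) v"
      using r b assms(1) by (auto simp: V_space_eq op_pow_W)
    fix r' assume r': "\<forall>v\<in>V_space G \<beta>. f v = r' \<bullet> op_pow G (\<beta> / 2) v"
    have "r' \<bullet> w = r \<bullet> w" for w using bspec[OF r' WV[of w]] by (simp add: r op_pow_W[OF b])
    then show "r' = r" by (metis inner_commute vector_eq_rdot)
  qed
  then show ?thesis by (simp add: r)
qed

text \<open>
Evaluated at the direction of its representing vector, the functional \<open>F u - F v\<close> attains the norm of
that vector, so the norm in \<open>H\<close> is at most the dual norm in the Lipschitz condition.
\<close>

lemma lipschitz_dual_op_pow:
  assumes "\<beta> \<ge> 0" and lip: "lipschitz_V G \<beta> \<gamma> CL F"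
    and u: "u \<in> V_space G \<gamma>" and v: "v \<in> V_space G \<gamma>"
  shows "norm (dual_op_pow G \<beta> (F u) - dual_op_pow G \<beta> (F v)) \<le> CL * V_norm G \<gamma> (u - v)"
proof -
  define r where "r = dual_op_pow G \<beta> (F u) - dual_op_pow G \<beta> (F v)"
  have b: "\<beta> / 2 \<ge> 0" using assms(1) by simp
  have F: "F u \<in> V_dual G \<beta>" "F v \<in> V_dual G \<beta>" using lip u v by (auto simp: lipschitz_V_def)
  have r: "F u (W (\<beta> / 2) w) - F v (W (\<beta> / 2) w) = r \<bullet> w" for w
    using dual_op_pow_W[OF assms(1)] F by (simp add: r_def inner_diff_left)
  have VN: "V_norm G \<beta> (W (\<beta> / 2) w) = norm w" for w
    using V_norm_W[of \<beta> "\<beta> / 2" w] assms(1) by (simp add: W_0)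
  have bdd: "bdd_above ((\<lambda>x. \<bar>F u x - F v x\<bar>) ` {x \<in> V_space G \<beta>. V_norm G \<beta> x \<le> 1})"
  proof (rule bdd_aboveI2[of _ _ "norm r"])
    fix x assume "x \<in> {x \<in> V_space G \<beta>. V_norm G \<beta> x \<le> 1}"
    then obtain w where w: "x = W (\<beta> / 2) w" "norm w \<le> 1" using assms(1) VN by (auto simp: V_space_eq)
    have "\<bar>r \<bullet> w\<bar> \<le> norm r * norm w" by (rule Cauchy_Schwarz_ineq2)
    also have "\<dots> \<le> norm r" using w(2) by (simp add: mult_left_le)
    finally show "\<bar>F u x - F v x\<bar> \<le> norm r" by (simp add: w(1) r)
  qed
  have "norm r \<le> V_dual_norm G \<beta> (\<lambda>x. F u x - F v x)"
    unfolding V_dual_norm_def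
  proof (rule cSUP_upper2[OF bdd])
    let ?w = "(1 / norm r) *\<^sub>R r"
    show "W (\<beta> / 2) ?w \<in> {x \<in> V_space G \<beta>. V_norm G \<beta> x \<le> 1}"
      using W_in_V_space[of \<beta> "\<beta> / 2" ?w] assms(1) VN[of ?w] by simp
    show "norm r \<le> \<bar>F u (W (\<beta> / 2) ?w) - F v (W (\<beta> / 2) ?w)\<bar>"
      unfolding r by (simp add: dot_square_norm power2_eq_square)
  qed
  also have "\<dots> \<le> CL * V_norm G \<gamma> (u - v)" using lip u v by (simp add: lipschitz_V_def)
  finally show ?thesis by (simp add: r_def)
qed

end

section \<open>Weak time derivatives\<close>

text \<open>
For \<open>r\<close> the positive part and \<open>s + \<delta> \<le> s'\<close> this is a trapezoid: it rises from 0 to \<open>\<delta>\<close> on \<open>[s, s + \<delta>]\<close>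
and falls back to 0 on \<open>[s', s' + \<delta>]\<close>.  With \<open>ramp\<close>, a \<open>C\<^sup>1\<close> approximation of the positive part, it is
a test function; the derivative is the same second difference of \<open>ramp'\<close>.
\<close>

definition second_difference :: "real \<Rightarrow> real \<Rightarrow> real \<Rightarrow> (real \<Rightarrow> real) \<Rightarrow> real \<Rightarrow> real" where
  "second_difference s s' \<delta> r t = r (t - s) - r (t - s - \<delta>) - r (t - s') + r (t - s' - \<delta>)"

definition pos_part :: "real \<Rightarrow> real" where "pos_part x = max 0 x"

definition ramp :: "real \<Rightarrow> real \<Rightarrow> real" where
  "ramp n x = n / 2 * ((pos_part x)\<^sup>2 - (pos_part (x - 1 / n))\<^sup>2)"

definition ramp' :: "real \<Rightarrow> real \<Rightarrow> real" where
  "ramp' n x = n * (pos_part x - pos_part (x - 1 / n))"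

lemma pos_part_sq_derivative: "((\<lambda>x. (pos_part x)\<^sup>2) has_real_derivative 2 * pos_part x) (at x)"
proof (cases x "0 :: real" rule: linorder_cases)
  case less
  have "((\<lambda>x. 0) has_real_derivative 2 * pos_part x) (at x)" using less by (simp add: pos_part_def)
  then show ?thesis
    by (rule has_field_derivative_transform_within_open[of _ _ _ "{..<0}"])
       (use less in \<open>auto simp: pos_part_def\<close>)
next
  case greater
  have "((\<lambda>x. x\<^sup>2) has_real_derivative 2 * pos_part x) (at x)"
    using greater by (auto intro!: derivative_eq_intros simp: pos_part_def)
  then show ?thesis
    by (rule has_field_derivative_transform_within_open[of _ _ _ "{0<..}"])
       (use greater in \<open>auto simp: pos_part_def\<close>)
next
  case equal
  have "((\<lambda>h. (pos_part (0 + h))\<^sup>2 / h) \<longlongrightarrow> 0) (at 0)"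
  proof (rule Lim_null_comparison)
    show "\<forall>\<^sub>F h in at 0. norm ((pos_part (0 + h))\<^sup>2 / h) \<le> \<bar>h\<bar>"
      by (auto simp: pos_part_def max_def power2_eq_square eventually_at intro!: exI[of _ 1])
    show "((\<lambda>h. \<bar>h\<bar>) \<longlongrightarrow> 0) (at (0::real))"
      by (rule tendsto_rabs_zero) (rule tendsto_ident_at)
  qed
  then show ?thesis using equal by (simp add: DERIV_def pos_part_def)
qed

lemma shift_derivative: "((\<lambda>x. x - y) has_real_derivative 1) (at (x::real))"
  by (auto intro!: derivative_eq_intros)

lemma ramp_derivative: "(ramp n has_real_derivative ramp' n x) (at x)"
proof -
  have "((\<lambda>x. (pos_part (x - 1 / n))\<^sup>2) has_real_derivative 2 * pos_part (x - 1 / n)) (at x)"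
    using DERIV_chain2[where f = "\<lambda>x. (pos_part x)\<^sup>2", OF pos_part_sq_derivative shift_derivative] by simp
  from DERIV_cmult[OF DERIV_diff[OF pos_part_sq_derivative this], of "n / 2"]
  show ?thesis unfolding ramp_def[abs_def] ramp'_def by (simp add: algebra_simps)
qed

lemma continuous_pos_part: "continuous_on UNIV pos_part"
  unfolding pos_part_def[abs_def] by (intro continuous_intros)

lemma continuous_ramp': "continuous_on UNIV (ramp' n)"
  unfolding ramp'_def[abs_def] pos_part_def by (intro continuous_intros)

lemma pos_part_shift:
  assumes "n > 0" "1 / n \<le> x"
  shows "pos_part x = x" "pos_part (x - 1 / n) = x - 1 / n"
proof -
  have "0 < 1 / n" using assms by simp
  then have "0 \<le> x" using assms by linarith
  then show "pos_part x = x" "pos_part (x - 1 / n) = x - 1 / n"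
    using assms by (auto simp: pos_part_def)
qed

lemma ramp'_eq_1:
  assumes "n > 0" "1 / n \<le> x" shows "ramp' n x = 1"
  unfolding ramp'_def pos_part_shift[OF assms] using assms(1) by simp

lemma ramp'_bounds:
  assumes "n > 0" shows "0 \<le> ramp' n x" "ramp' n x \<le> 1"
proof -
  have "0 \<le> ramp' n x \<and> ramp' n x \<le> 1"
  proof (cases "1 / n \<le> x")
    case False
    then have "ramp' n x = n * pos_part x" "pos_part x \<le> 1 / n" "0 \<le> pos_part x"
      using assms by (auto simp: ramp'_def pos_part_def)
    then show ?thesis using assms by (simp add: field_simps)
  qed (simp add: ramp'_eq_1 assms)
  then show "0 \<le> ramp' n x" "ramp' n x \<le> 1" by auto
qed

lemma ramp_nonpos:
  assumes "n > 0" "x \<le> 0" shows "ramp n x = 0" "ramp' n x = 0"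
proof -
  have "x - 1 / n \<le> 0" using assms by (simp add: order_trans[of x 0])
  then have "pos_part x = 0" "pos_part (x - 1 / n) = 0" using assms by (auto simp: pos_part_def)
  then show "ramp n x = 0" "ramp' n x = 0" by (simp_all add: ramp_def ramp'_def)
qed

lemma ramp_eq:
  assumes "n > 0" "1 / n \<le> x" shows "ramp n x = x - 1 / (2 * n)"
  unfolding ramp_def pos_part_shift[OF assms] using assms(1) by (simp add: power2_eq_square field_simps)

lemma ramp_approx:
  assumes "n > 0" shows "\<bar>ramp n x - pos_part x\<bar> \<le> 1 / n"
proof -
  \<comment> \<open>\<open>ramp n\<close> is 0, then the parabola \<open>n x\<^sup>2 / 2\<close>, then \<open>x - 1 / (2 n)\<close>.\<close>
  consider "x \<le> 0" | "0 < x" "x < 1 / n" | "1 / n \<le> x" by linarith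
  then show ?thesis
  proof cases
    case 2
    have eq: "ramp n x = n / 2 * x\<^sup>2" "pos_part x = x"
      using 2 by (auto simp: ramp_def pos_part_def max_def)
    have "n / 2 * x\<^sup>2 = (n * x) * x / 2" by (simp add: power2_eq_square)
    also have "\<dots> \<le> 1 * x / 2" using 2 assms
      by (intro divide_right_mono mult_right_mono) (auto simp: field_simps)
    finally have "n / 2 * x\<^sup>2 \<le> x" using 2 by simp
    moreover have "0 \<le> n / 2 * x\<^sup>2" using assms by simp
    ultimately show ?thesis using 2 unfolding eq by linarith
  next
    case 3
    then show ?thesis using assms unfolding ramp_eq[OF assms 3] pos_part_shift[OF assms 3]
      by (simp add: field_simps)
  qed (use assms in \<open>auto simp: ramp_nonpos pos_part_def\<close>)
qed

lemma test_function_second_difference: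
  assumes n: "n > 0" and "a < s" "s \<le> s'" "\<delta> > 0" "s' + \<delta> + 1 / n < b"
  shows "test_function a b (second_difference s s' \<delta> (ramp n)) (second_difference s s' \<delta> (ramp' n))"
  unfolding test_function_def
proof (intro conjI allI)
  have sh: "((\<lambda>t. ramp n (t - y)) has_real_derivative ramp' n (t - y)) (at t)" for t y
    using DERIV_chain2[where f = "ramp n", OF ramp_derivative shift_derivative] by simp
  show "(second_difference s s' \<delta> (ramp n) has_real_derivative second_difference s s' \<delta> (ramp' n) t) (at t)" for t
    unfolding second_difference_def[abs_def] diff_diff_eq
    by (intro DERIV_add DERIV_diff sh)
  show "continuous_on UNIV (second_difference s s' \<delta> (ramp' n))"
    unfolding second_difference_def[abs_def]
    by (intro continuous_intros continuous_on_compose2[OF continuous_ramp']) auto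
  show "\<exists>c d. a < c \<and> d < b \<and> (\<forall>t. t \<notin> {c..d} \<longrightarrow> second_difference s s' \<delta> (ramp n) t = 0)"
  proof (intro exI conjI allI impI)
    show "a < s" "s' + \<delta> + 1 / n < b" by fact+
    fix t assume t: "t \<notin> {s..s' + \<delta> + 1 / n}"
    show "second_difference s s' \<delta> (ramp n) t = 0"
    proof (cases "t < s")
      case True
      then show ?thesis using assms by (simp add: second_difference_def ramp_nonpos)
    next
      case False
      then have "s' + \<delta> + 1 / n < t" using t by simp
      then show ?thesis using assms by (simp add: second_difference_def ramp_eq)
    qed
  qed
qed

lemma second_difference_bound:
  assumes "\<And>x. 0 \<le> r x" "\<And>x. r x \<le> (1::real)"
  shows "\<bar>second_difference s s' \<delta> r t\<bar> \<le> 2"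
  using assms[of "t - s"] assms[of "t - s - \<delta>"] assms[of "t - s'"] assms[of "t - s' - \<delta>"]
  unfolding second_difference_def by linarith

lemma second_difference_pos_part_bound:
  assumes "\<delta> > 0" shows "\<bar>second_difference s s' \<delta> pos_part t\<bar> \<le> \<delta>"
  using assms by (auto simp: second_difference_def pos_part_def max_def)

lemma integral_interval_indicator:
  fixes f :: "real \<Rightarrow> real"
  assumes "a \<le> s" "s' \<le> b"
  shows "integral {a..b} (\<lambda>t. (if s < t \<and> t \<le> s' then 1 else 0) * f t) = integral {s..s'} f"
proof -
  have "integral {a..b} (\<lambda>t. (if s < t \<and> t \<le> s' then 1 else 0) * f t)
      = integral {a..b} (\<lambda>t. if t \<in> {s..s'} then f t else 0)"
    by (rule integral_spike[of "{s}"]) auto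
  also have "\<dots> = integral ({s..s'} \<inter> {a..b}) f" by (rule integral_restrict_Int)
  also have "{s..s'} \<inter> {a..b} = {s..s'}" using assms by auto
  finally show ?thesis .
qed

text \<open>
Test with the second difference of \<open>ramp n\<close> and let \<open>n \<rightarrow> \<infinity>\<close> by dominated convergence on both sides.
\<close>

lemma weak_derivative_averages:
  fixes f g :: "real \<Rightarrow> real"
  assumes w: "weak_time_derivative a b f g"
    and f: "f absolutely_integrable_on {a..b}" and g: "g absolutely_integrable_on {a..b}"
    and s: "a < s" "s \<le> s'" "\<delta> > 0" "s' + \<delta> < b"
  shows "integral {s..s + \<delta>} f - integral {s'..s' + \<delta>} f
     = - integral {a..b} (\<lambda>t. second_difference s s' \<delta> pos_part t * g t)"
proof -
  \<comment> \<open>The support of the test function exceeds \<open>s' + \<delta>\<close> by \<open>1 / N n\<close>, which must stay below \<open>b\<close>.\<close>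
  obtain m where m: "1 / real (Suc m) < b - s' - \<delta>"
    using reals_Archimedean[of "b - s' - \<delta>"] s by (auto simp: inverse_eq_divide)
  define N where "N n = real (Suc (n + m))" for n
  have N: "N n > 0" for n by (simp add: N_def)
  have N1: "s' + \<delta> + 1 / N n < b" for n
  proof -
    have "1 / N n \<le> 1 / real (Suc m)" unfolding N_def by (intro divide_left_mono) auto
    then show ?thesis using m by simp
  qed
  have Nlim: "(\<lambda>n. 1 / N n) \<longlonglongrightarrow> 0"
    using LIMSEQ_ignore_initial_segment[OF LIMSEQ_inverse_real_of_nat, of m]
    by (simp add: N_def inverse_eq_divide)
  define \<phi> where "\<phi> n = second_difference s s' \<delta> (ramp (N n))" for n
  define \<phi>' where "\<phi>' n = second_difference s s' \<delta> (ramp' (N n))" for n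
  have "\<exists>I. ((\<lambda>t. \<phi>' n t * f t) has_integral (- I)) {a..b} \<and> ((\<lambda>t. \<phi> n t * g t) has_integral I) {a..b}" for n
    using w test_function_second_difference[OF N s(1,2,3) N1]
    unfolding weak_time_derivative_def \<phi>_def \<phi>'_def real_scaleR_def by blast
  then obtain I where I: "\<And>n. ((\<lambda>t. \<phi>' n t * f t) has_integral (- I n)) {a..b}"
      "\<And>n. ((\<lambda>t. \<phi> n t * g t) has_integral I n) {a..b}" by metis
  define st where "st x = (if x > 0 then 1 else 0 :: real)" for x :: real
  have ramp_lim: "(\<lambda>n. ramp (N n) x) \<longlonglongrightarrow> pos_part x" for x
    by (rule LIM_zero_cancel, rule Lim_null_comparison[OF _ Nlim]) (simp add: ramp_approx N)
  have ramp'_lim: "(\<lambda>n. ramp' (N n) x) \<longlonglongrightarrow> st x" for x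
  proof (cases "x > 0")
    case True
    have "\<forall>\<^sub>F n in sequentially. 1 / N n < x" using order_tendstoD(2)[OF Nlim True] .
    then have "\<forall>\<^sub>F n in sequentially. ramp' (N n) x = st x"
      by eventually_elim (use True N in \<open>simp add: st_def ramp'_eq_1\<close>)
    then show ?thesis by (rule tendsto_eventually)
  qed (simp add: st_def ramp_nonpos N)
  have limf: "(\<lambda>n. integral {a..b} (\<lambda>t. \<phi>' n t * f t))
      \<longlonglongrightarrow> integral {a..b} (\<lambda>t. second_difference s s' \<delta> st t * f t)"
  proof (rule dominated_convergence(2))
    show "(\<lambda>t. \<phi>' n t * f t) integrable_on {a..b}" for n using I by blast
    show "(\<lambda>t. 2 * \<bar>f t\<bar>) integrable_on {a..b}"
      using f by (intro integrable_on_mult_right) (simp add: absolutely_integrable_on_def)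
    show "norm (\<phi>' n t * f t) \<le> 2 * \<bar>f t\<bar>" for n t
      unfolding \<phi>'_def real_norm_def abs_mult
      by (intro mult_right_mono second_difference_bound ramp'_bounds N) auto
    show "(\<lambda>n. \<phi>' n t * f t) \<longlonglongrightarrow> second_difference s s' \<delta> st t * f t" for t
      unfolding \<phi>'_def second_difference_def by (intro tendsto_intros ramp'_lim)
  qed
  have limg: "(\<lambda>n. integral {a..b} (\<lambda>t. \<phi> n t * g t))
      \<longlonglongrightarrow> integral {a..b} (\<lambda>t. second_difference s s' \<delta> pos_part t * g t)"
  proof (rule dominated_convergence(2))
    show "(\<lambda>t. \<phi> n t * g t) integrable_on {a..b}" for n using I by blast
    show "(\<lambda>t. (\<delta> + 4) * \<bar>g t\<bar>) integrable_on {a..b}"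
      using g by (intro integrable_on_mult_right) (simp add: absolutely_integrable_on_def)
    show "norm (\<phi> n t * g t) \<le> (\<delta> + 4) * \<bar>g t\<bar>" for n t
    proof -
      have r: "\<bar>ramp (N n) x - pos_part x\<bar> \<le> 1" for x
      proof -
        have "1 / N n \<le> 1" by (simp add: N_def)
        then show ?thesis using ramp_approx[OF N, of n x] by linarith
      qed
      have "\<bar>\<phi> n t\<bar> \<le> \<delta> + 4"
        using second_difference_pos_part_bound[OF s(3), of s s' t]
          r[of "t - s"] r[of "t - s - \<delta>"] r[of "t - s'"] r[of "t - s' - \<delta>"]
        unfolding \<phi>_def second_difference_def by linarith
      then show ?thesis by (simp add: abs_mult mult_right_mono)
    qed
    show "(\<lambda>n. \<phi> n t * g t) \<longlonglongrightarrow> second_difference s s' \<delta> pos_part t * g t" for t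
      unfolding \<phi>_def second_difference_def by (intro tendsto_intros ramp_lim)
  qed
  have "integral {a..b} (\<lambda>t. second_difference s s' \<delta> st t * f t)
      = - integral {a..b} (\<lambda>t. second_difference s s' \<delta> pos_part t * g t)"
  proof (rule LIMSEQ_unique[OF limf])
    have "integral {a..b} (\<lambda>t. \<phi>' n t * f t) = - integral {a..b} (\<lambda>t. \<phi> n t * g t)" for n
      using I[of n] by (simp add: integral_unique)
    then show "(\<lambda>n. integral {a..b} (\<lambda>t. \<phi>' n t * f t))
        \<longlonglongrightarrow> - integral {a..b} (\<lambda>t. second_difference s s' \<delta> pos_part t * g t)"
      using tendsto_minus[OF limg] by simp
  qed
  moreover have "integral {a..b} (\<lambda>t. second_difference s s' \<delta> st t * f t)
      = integral {s..s + \<delta>} f - integral {s'..s' + \<delta>} f"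
  proof -
    \<comment> \<open>In the limit the derivative of the trapezoid is the difference of two indicators.\<close>
    let ?i = "\<lambda>x t. (if x < t \<and> t \<le> x + \<delta> then 1 else 0) * f t"
    have ii: "?i x integrable_on {a..b}" if "a \<le> x" "x + \<delta> \<le> b" for x
    proof -
      have sub: "{x..x + \<delta>} \<inter> {a..b} = {x..x + \<delta>}" using that by auto
      have "(\<lambda>t. if t \<in> {x..x + \<delta>} then f t else 0) integrable_on {a..b}"
        unfolding integrable_restrict_Int sub
      proof (rule integrable_on_subinterval[of f "{a..b}"])
        show "f integrable_on {a..b}" using f absolutely_integrable_on_def by blast
      qed (use that in auto)
      then show ?thesis by (rule integrable_spike[of _ _ "{x}"]) auto
    qed
    have "second_difference s s' \<delta> st t * f t = ?i s t - ?i s' t" for t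
      using s(3) by (auto simp: second_difference_def st_def)
    then have "integral {a..b} (\<lambda>t. second_difference s s' \<delta> st t * f t)
        = integral {a..b} (?i s) - integral {a..b} (?i s')"
      using ii[of s] ii[of s'] s by (simp add: integral_diff)
    then show ?thesis using s by (simp add: integral_interval_indicator)
  qed
  ultimately show ?thesis by simp
qed

text \<open>
Divide \<open>weak_derivative_averages\<close> by \<open>\<delta>\<close> and let \<open>\<delta> \<rightarrow> 0\<close>.  On the right the trapezoids become the indicator
of \<open>(s, s']\<close>; on the left the averages converge at almost every point by Lebesgue differentiation.
\<close>

lemma weak_derivative_integral:
  fixes f g :: "real \<Rightarrow> real"
  assumes w: "weak_time_derivative a b f g"
    and f: "f absolutely_integrable_on {a..b}" and g: "g absolutely_integrable_on {a..b}"
  obtains N where "negligible N"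
    "\<And>s s'. \<lbrakk>a < s; s \<le> s'; s' < b; s \<notin> N; s' \<notin> N\<rbrakk> \<Longrightarrow> f s' - f s = integral {s..s'} g"
proof -
  let ?f = "\<lambda>x. if x \<in> {a..b} then f x else 0"
  have int: "?f integrable_on cbox c d" for c d
    by (rule integrable_altD(1)) (use f absolutely_integrable_on_def in blast)
  from integrable_ccontinuous_explicit[OF int]
  obtain N where N: "negligible N" and N0: "\<And>x e. \<lbrakk>x \<notin> N; 0 < e\<rbrakk> \<Longrightarrow>
      \<exists>d>0. \<forall>h. 0 < h \<and> h < d \<longrightarrow>
        norm (integral (cbox x (x + h *\<^sub>R One)) ?f /\<^sub>R h ^ DIM(real) - ?f x) < e" by blast
  have Nd: "\<exists>d>0. \<forall>h. 0 < h \<and> h < d \<longrightarrow> \<bar>integral {x..x + h} ?f / h - ?f x\<bar> < e"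
    if "x \<notin> N" "0 < e" for x e
    using N0[OF that] by (simp add: divide_inverse_commute)
  have avg: "(\<lambda>n. integral {x..x + \<delta> n} f / \<delta> n) \<longlonglongrightarrow> f x"
    if x: "a < x" "x < b" "x \<notin> N" and \<delta>: "\<delta> \<longlonglongrightarrow> 0" "\<And>n. \<delta> n > 0" "\<And>n. x + \<delta> n < b" for x \<delta>
  proof (rule LIMSEQ_I)
    fix e :: real assume "e > 0"
    from Nd[OF x(3) this] obtain d where d: "d > 0"
      "\<And>h. 0 < h \<Longrightarrow> h < d \<Longrightarrow> \<bar>integral {x..x + h} ?f / h - ?f x\<bar> < e" by blast
    from LIMSEQ_D[OF \<delta>(1) d(1)] obtain n0 where n0: "\<And>n. n \<ge> n0 \<Longrightarrow> \<delta> n < d" by fastforce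
    have "norm (integral {x..x + \<delta> n} f / \<delta> n - f x) < e" if "n \<ge> n0" for n
    proof -
      have "integral {x..x + \<delta> n} ?f = integral {x..x + \<delta> n} f"
        by (rule Henstock_Kurzweil_Integration.integral_cong) (use x \<delta>(3)[of n] in auto)
      then show ?thesis using d(2)[OF \<delta>(2) n0[OF that]] x by simp
    qed
    then show "\<exists>n0. \<forall>n\<ge>n0. norm (integral {x..x + \<delta> n} f / \<delta> n - f x) < e" by blast
  qed
  have "f s' - f s = integral {s..s'} g" if s: "a < s" "s \<le> s'" "s' < b" "s \<notin> N" "s' \<notin> N" for s s'
  proof -
    define \<delta> where "\<delta> n = (b - s') / 2 * inverse (real (Suc n))" for n
    have \<delta>pos: "\<delta> n > 0" for n using s by (simp add: \<delta>_def)
    have \<delta>le: "s' + \<delta> n < b" for n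
    proof -
      have "\<delta> n \<le> (b - s') / 2 * 1"
        unfolding \<delta>_def using s by (intro mult_left_mono) (auto simp: field_simps)
      then show ?thesis using s by simp
    qed
    have \<delta>lim: "\<delta> \<longlonglongrightarrow> 0"
      unfolding \<delta>_def by (intro tendsto_mult_right_zero LIMSEQ_inverse_real_of_nat)
    let ?q = "\<lambda>n t. (second_difference s s' (\<delta> n) pos_part t / \<delta> n) * g t"
    have gi: "g integrable_on {a..b}" "(\<lambda>t. \<bar>g t\<bar>) integrable_on {a..b}"
      using g by (auto simp: absolutely_integrable_on_def)
    have "(\<lambda>n. integral {a..b} (?q n)) \<longlonglongrightarrow>
        integral {a..b} (\<lambda>t. (if s < t \<and> t \<le> s' then 1 else 0) * g t)"
    proof (rule dominated_convergence(2)[OF _ gi(2)])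
      show "?q n integrable_on {a..b}" for n
      proof -
        have "(\<lambda>t. second_difference s s' (\<delta> n) pos_part t / \<delta> n * g t) absolutely_integrable_on {a..b}"
        proof (rule absolutely_integrable_bounded_measurable_product_real[OF _ _ _ g])
          have c: "continuous_on {a..b} (\<lambda>t. second_difference s s' (\<delta> n) pos_part t / \<delta> n)"
            unfolding second_difference_def divide_inverse
            by (intro continuous_intros continuous_on_compose2[OF continuous_pos_part]) auto
          then show "(\<lambda>t. second_difference s s' (\<delta> n) pos_part t / \<delta> n) \<in> borel_measurable (lebesgue_on {a..b})"
            by (rule continuous_imp_measurable_on_sets_lebesgue) auto
          show "bounded ((\<lambda>t. second_difference s s' (\<delta> n) pos_part t / \<delta> n) ` {a..b})"
            by (intro compact_imp_bounded compact_continuous_image c compact_Icc)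
        qed auto
        then show ?thesis using absolutely_integrable_on_def by blast
      qed
      show "norm (?q n t) \<le> \<bar>g t\<bar>" for n t
      proof -
        have "\<bar>second_difference s s' (\<delta> n) pos_part t / \<delta> n\<bar> \<le> 1"
          using second_difference_pos_part_bound[OF \<delta>pos, of s s' n t] \<delta>pos[of n] by simp
        from mult_right_mono[OF this abs_ge_zero[of "g t"]] show ?thesis
          by (simp only: real_norm_def abs_mult mult_1)
      qed
      show "(\<lambda>n. ?q n t) \<longlonglongrightarrow> (if s < t \<and> t \<le> s' then 1 else 0) * g t" for t
      proof (rule tendsto_mult_right)
        have one: "(\<lambda>n. (pos_part (x) - pos_part (x - \<delta> n)) / \<delta> n) \<longlonglongrightarrow> (if x > 0 then 1 else 0)" for x
        proof (cases "x > 0")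
          case True
          have "\<forall>\<^sub>F n in sequentially. \<delta> n < x" using order_tendstoD(2)[OF \<delta>lim True] .
          then have "\<forall>\<^sub>F n in sequentially. (pos_part x - pos_part (x - \<delta> n)) / \<delta> n = 1"
            by eventually_elim (use True in \<open>simp add: pos_part_def less_imp_neq[OF \<delta>pos, symmetric]\<close>)
          then show ?thesis using True by (simp add: tendsto_eventually)
        next
          case False
          then have "pos_part x - pos_part (x - \<delta> n) = 0" for n
            using \<delta>pos[of n] by (simp add: pos_part_def)
          then show ?thesis using False by simp
        qed
        have eq: "(\<lambda>n. second_difference s s' (\<delta> n) pos_part t / \<delta> n)
          = (\<lambda>n. (pos_part (t - s) - pos_part (t - s - \<delta> n)) / \<delta> n
               - (pos_part (t - s') - pos_part (t - s' - \<delta> n)) / \<delta> n)"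
          by (simp add: second_difference_def diff_divide_distrib add_divide_distrib fun_eq_iff)
        have "(if s < t \<and> t \<le> s' then 1 else 0) = (if t - s > 0 then 1 else 0) - (if t - s' > 0 then 1 else 0 :: real)"
          using s(2) by auto
        then show "(\<lambda>n. second_difference s s' (\<delta> n) pos_part t / \<delta> n) \<longlonglongrightarrow> (if s < t \<and> t \<le> s' then 1 else 0)"
          unfolding eq by (simp only:) (intro tendsto_diff one)
      qed
    qed
    then have limR: "(\<lambda>n. integral {a..b} (?q n)) \<longlonglongrightarrow> integral {s..s'} g"
      using s by (simp add: integral_interval_indicator)
    have limL: "(\<lambda>n. integral {s..s + \<delta> n} f / \<delta> n - integral {s'..s' + \<delta> n} f / \<delta> n) \<longlonglongrightarrow> f s - f s'"
    proof (intro tendsto_diff avg \<delta>lim \<delta>pos \<delta>le)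
      show "s + \<delta> n < b" for n using \<delta>le[of n] s by linarith
    qed (use s in auto)
    have eq: "integral {s..s + \<delta> n} f / \<delta> n - integral {s'..s' + \<delta> n} f / \<delta> n = - integral {a..b} (?q n)" for n
    proof -
      have "integral {a..b} (?q n) = integral {a..b} (\<lambda>t. (1 / \<delta> n) * (second_difference s s' (\<delta> n) pos_part t * g t))"
        by simp
      also have "\<dots> = (1 / \<delta> n) * integral {a..b} (\<lambda>t. second_difference s s' (\<delta> n) pos_part t * g t)"
        by (rule integral_mult_right)
      finally show ?thesis
        using weak_derivative_averages[OF w f g s(1,2) \<delta>pos \<delta>le, of n]
        by (simp add: diff_divide_distrib[symmetric])
    qed
    have "f s - f s' = - integral {s..s'} g"
      using LIMSEQ_unique[OF limL] tendsto_minus[OF limR] unfolding eq by blast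
    then show ?thesis by simp
  qed
  with N show ?thesis using that by blast
qed

text \<open>
\<open>Z\<close> minus the indefinite integral of \<open>g\<close> is continuous and constant outside a null set, whose
complement is dense.
\<close>

lemma weak_derivative_continuous_representative:
  fixes f g Z :: "real \<Rightarrow> real"
  assumes w: "weak_time_derivative a b f g" and ab: "a < b"
    and f: "f absolutely_integrable_on {a..b}" and g: "g absolutely_integrable_on {a..b}"
    and Z: "continuous_on {a..b} Z" and N0: "negligible N0" "\<And>t. t \<in> {a..b} - N0 \<Longrightarrow> f t = Z t"
    and s: "a \<le> s" "s \<le> s'" "s' \<le> b"
  shows "Z s' - Z s = integral {s..s'} g"
proof -
  obtain N1 where N1: "negligible N1"
    "\<And>s s'. \<lbrakk>a < s; s \<le> s'; s' < b; s \<notin> N1; s' \<notin> N1\<rbrakk> \<Longrightarrow> f s' - f s = integral {s..s'} g"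
    using weak_derivative_integral[OF w f g] by blast
  define N where "N = N0 \<union> N1"
  have N: "negligible N" using N0(1) N1(1) by (simp add: N_def)
  have gi: "g integrable_on {a..b}" using g absolutely_integrable_on_def by blast
  define Y where "Y t = Z t - integral {a..t} g" for t
  have Yc: "continuous_on {a..b} Y"
    unfolding Y_def by (intro continuous_intros Z indefinite_integral_continuous_1 gi)
  define D where "D = {a<..<b} - N"
  have split: "integral {a..s'} g - integral {a..s} g = integral {s..s'} g"
    if "a \<le> s" "s \<le> s'" "s' \<le> b" for s s'
  proof -
    have "g integrable_on {a..s'}" by (rule integrable_on_subinterval[OF gi]) (use that in auto)
    then show ?thesis
      using Henstock_Kurzweil_Integration.integral_combine[of a s s' g] that by simp
  qed
  have const: "Y t = Y t'" if "t \<in> D" "t' \<in> D" "t \<le> t'" for t t'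
    using that N1(2)[of t t'] N0(2)[of t] N0(2)[of t'] split[of t t']
    by (auto simp: D_def N_def Y_def)
  have dense: "x \<in> closure D" if x: "x \<in> {a..b}" for x
  proof -
    have "closure {a<..<b} \<subseteq> closure D"
    proof (rule closure_minimal)
      show "{a<..<b} \<subseteq> closure D"
      proof
        fix y assume y: "y \<in> {a<..<b}"
        show "y \<in> closure D"
        proof (rule ccontr)
          assume "y \<notin> closure D"
          then have "y \<in> {a<..<b} - closure D" using y by blast
          moreover have "open ({a<..<b} - closure D)" by (intro open_Diff) auto
          moreover have "{a<..<b} - closure D \<subseteq> N" using closure_subset[of D] by (auto simp: D_def)
          ultimately show False
            using N negligible_subset open_not_negligible by blast
        qed
      qed
    qed simp
    then show ?thesis using x ab by (auto simp: closure_greaterThanLessThan)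
  qed
  obtain t0 where t0: "t0 \<in> D"
    using dense[of a] ab by (metis atLeastAtMost_iff closure_empty empty_iff equals0I less_imp_le order_refl)
  have "Y x = Y t0" if x: "x \<in> {a..b}" for x
  proof (rule continuous_constant_on_closure[of D Y "Y t0" x])
    have cl: "closure D \<subseteq> {a..b}" by (rule closure_minimal) (auto simp: D_def)
    show "continuous_on (closure D) Y" by (rule continuous_on_subset[OF Yc cl])
    show "Y y = Y t0" if "y \<in> D" for y
    proof (cases "y \<le> t0")
      case True
      then show ?thesis by (rule const[OF that t0])
    next
      case False
      then have "t0 \<le> y" by simp
      from const[OF t0 that this] show ?thesis by simp
    qed
    show "x \<in> closure D" by (rule dense[OF x])
  qed
  then have "Y s' = Y s" using s by (metis atLeastAtMost_iff order_trans)
  then show ?thesis using split[OF s] by (simp add: Y_def)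
qed

lemma L2_time_real_absolutely_integrable:
  fixes f :: "real \<Rightarrow> real"
  assumes "L2_time a b f" shows "f absolutely_integrable_on {a..b}"
proof (rule measurable_bounded_by_integrable_imp_absolutely_integrable)
  show "f \<in> borel_measurable (lebesgue_on {a..b})"
    using assms by (simp add: L2_time_def measurable_on_iff_borel_measurable)
  show "(\<lambda>t. 1 + (norm (f t))\<^sup>2) integrable_on {a..b}"
    using assms by (intro integrable_add) (auto simp: L2_time_def)
  show "norm (f t) \<le> 1 + (norm (f t))\<^sup>2" for t
    using sum_squares_bound[of "norm (f t)" 1] by (simp add: power2_eq_square)
qed simp

lemma L2_time_norm:
  assumes "L2_time a b f" shows "L2_time a b (\<lambda>t. norm (f t))"
  using assms measurable_on_compose_continuous_0[of f "{a..b}" norm]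
  by (simp add: L2_time_def o_def continuous_on_norm_id)

lemma L2_time_inner:
  assumes "L2_time a b f" shows "L2_time a b (\<lambda>t. f t \<bullet> w)"
  unfolding L2_time_def
proof
  have "((\<lambda>x. x \<bullet> w) \<circ> f) measurable_on {a..b}"
    using assms by (intro measurable_on_compose_continuous_0) (auto simp: L2_time_def intro!: continuous_intros)
  then show m: "(\<lambda>t. f t \<bullet> w) measurable_on {a..b}" by (simp add: o_def)
  show "(\<lambda>t. (norm (f t \<bullet> w))\<^sup>2) integrable_on {a..b}"
  proof (rule measurable_bounded_by_integrable_imp_integrable)
    have "((\<lambda>x. (norm (x \<bullet> w))\<^sup>2) \<circ> f) measurable_on {a..b}"
      using assms by (intro measurable_on_compose_continuous_0) (auto simp: L2_time_def intro!: continuous_intros)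
    then show "(\<lambda>t. (norm (f t \<bullet> w))\<^sup>2) \<in> borel_measurable (lebesgue_on {a..b})"
      by (simp add: o_def measurable_on_iff_borel_measurable)
    show "(\<lambda>t. (norm w)\<^sup>2 * (norm (f t))\<^sup>2) integrable_on {a..b}"
      using assms by (intro integrable_on_mult_right) (simp add: L2_time_def)
    show "norm ((norm (f t \<bullet> w))\<^sup>2) \<le> (norm w)\<^sup>2 * (norm (f t))\<^sup>2" for t
    proof -
      have "(norm (f t \<bullet> w))\<^sup>2 \<le> (norm (f t) * norm w)\<^sup>2"
        by (intro power_mono) (auto simp: Cauchy_Schwarz_ineq2)
      then show ?thesis by (simp add: power_mult_distrib mult.commute)
    qed
  qed simp
qed

lemma weak_time_derivative_inner:
  assumes "weak_time_derivative a b f g"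
  shows "weak_time_derivative a b (\<lambda>t. f t \<bullet> w) (\<lambda>t. g t \<bullet> w)"
  unfolding weak_time_derivative_def
proof (intro allI impI)
  fix \<phi> \<phi>' assume "test_function a b \<phi> \<phi>'"
  then obtain I where I: "((\<lambda>t. \<phi>' t *\<^sub>R f t) has_integral (- I)) {a..b}"
      "((\<lambda>t. \<phi> t *\<^sub>R g t) has_integral I) {a..b}"
    using assms unfolding weak_time_derivative_def by blast
  show "\<exists>I. ((\<lambda>t. \<phi>' t *\<^sub>R (f t \<bullet> w)) has_integral (- I)) {a..b} \<and>
            ((\<lambda>t. \<phi> t *\<^sub>R (g t \<bullet> w)) has_integral I) {a..b}"
    using has_integral_linear[OF I(1) bounded_linear_inner_left[of w]]
      has_integral_linear[OF I(2) bounded_linear_inner_left[of w]]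
    by (intro exI[of _ "I \<bullet> w"]) (simp add: o_def)
qed

lemma H_time_L2_time: "H_time m a b f \<Longrightarrow> L2_time a b f"
  by (cases m) auto

text \<open>
Polynomials of degree below \<open>m\<close>; for \<open>m = 0\<close> only the zero function.
\<close>

definition poly_functions :: "nat \<Rightarrow> (real \<Rightarrow> real) set" where
  "poly_functions m = {q. \<exists>\<alpha>. q = (\<lambda>t. \<Sum>i<m. \<alpha> i * t ^ i)}"

lemma poly_functions_integral:
  assumes q: "q \<in> poly_functions m"
  obtains Q where "Q \<in> poly_functions (Suc m)" "\<And>t. c \<le> t \<Longrightarrow> integral {c..t} q = Q t - \<kappa>"
proof -
  obtain \<alpha> where q: "q = (\<lambda>t. \<Sum>i<m. \<alpha> i * t ^ i)" using q by (auto simp: poly_functions_def)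
  define R where "R t = (\<Sum>i<m. \<alpha> i / real (Suc i) * t ^ Suc i)" for t
  \<comment> \<open>Coefficients of the primitive with value \<open>\<kappa>\<close> at \<open>c\<close>.\<close>
  define \<alpha>' where "\<alpha>' i = (case i of 0 \<Rightarrow> \<kappa> - R c | Suc i \<Rightarrow> \<alpha> i / real (Suc i))" for i
  have "(\<lambda>t. \<Sum>i<Suc m. \<alpha>' i * t ^ i) = (\<lambda>t. \<kappa> - R c + R t)"
    unfolding sum.lessThan_Suc_shift by (simp add: \<alpha>'_def R_def)
  then have "(\<lambda>t. \<kappa> - R c + R t) \<in> poly_functions (Suc m)"
    unfolding poly_functions_def mem_Collect_eq by metis
  moreover have "integral {c..t} q = (\<kappa> - R c + R t) - \<kappa>" if "c \<le> t" for t
  proof -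
    have "(q has_integral R t - R c) {c..t}"
    proof (rule fundamental_theorem_of_calculus[OF that])
      fix x
      have "((\<lambda>t. \<alpha> i / real (Suc i) * t ^ Suc i) has_real_derivative \<alpha> i * x ^ i) (at x within {c..t})" for i
        using DERIV_cmult[OF DERIV_pow[of "Suc i" x "{c..t}"], of "\<alpha> i / real (Suc i)"] by (simp del: of_nat_Suc)
      then have "(R has_real_derivative q x) (at x within {c..t})"
        unfolding R_def[abs_def] q by (intro DERIV_sum)
      then show "(R has_vector_derivative q x) (at x within {c..t})"
        by (simp add: has_real_derivative_iff_has_vector_derivative)
    qed
    then show ?thesis by (simp add: integral_unique)
  qed
  ultimately show ?thesis using that by blast
qed

lemma poly_functions_continuous: "q \<in> poly_functions m \<Longrightarrow> continuous_on S q"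
  by (auto simp: poly_functions_def intro!: continuous_intros)

text \<open>
One step of Taylor's formula: integrating an approximation \<open>q\<close> of the derivative \<open>g\<close> approximates \<open>f\<close>.
The constant of integration is read off at a point outside the exceptional null set.
\<close>

lemma weak_derivative_taylor_step:
  fixes f g :: "real \<Rightarrow> real"
  assumes w: "weak_time_derivative a b f g"
    and f: "f absolutely_integrable_on {a..b}" and g: "g absolutely_integrable_on {a..b}"
    and cd: "a \<le> c" "c < d" "d \<le> b"
    and q: "q \<in> poly_functions m" and E: "integral {c..d} (\<lambda>t. \<bar>g t - q t\<bar>) \<le> E"
  obtains Q N where "Q \<in> poly_functions (Suc m)" "negligible N"
    "\<And>t. t \<in> {c..d} - N \<Longrightarrow> \<bar>f t - Q t\<bar> \<le> E"
proof -
  obtain N1 where N1: "negligible N1"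
    "\<And>s s'. \<lbrakk>a < s; s \<le> s'; s' < b; s \<notin> N1; s' \<notin> N1\<rbrakk> \<Longrightarrow> f s' - f s = integral {s..s'} g"
    using weak_derivative_integral[OF w f g] by blast
  define N where "N = N1 \<union> {c, d}"
  have N: "negligible N" using N1(1) by (simp add: N_def)
  have "\<not> {c<..<d} \<subseteq> N"
    using N negligible_subset open_not_negligible[of "{c<..<d}"] cd by auto
  then obtain t0 where "t0 \<in> {c<..<d}" "t0 \<notin> N" by blast
  then have t0: "c < t0" "t0 < d" "t0 \<notin> N" by auto
  have gcd: "g integrable_on {c..d}" "g absolutely_integrable_on {c..d}"
    using absolutely_integrable_on_subinterval[OF g, of c d] cd absolutely_integrable_on_def by auto
  have qc: "continuous_on S q" for S by (rule poly_functions_continuous[OF q])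
  have gq: "(\<lambda>t. g t - q t) integrable_on {c..d}" "(\<lambda>t. \<bar>g t - q t\<bar>) integrable_on {c..d}"
    using set_integral_diff(1)[OF gcd(2) absolutely_integrable_continuous_real[OF qc, of c d]]
    by (auto simp: absolutely_integrable_on_def)
  define \<kappa> where "\<kappa> = f t0 - integral {c..t0} g"
  obtain Q where Q: "Q \<in> poly_functions (Suc m)" "\<And>t. c \<le> t \<Longrightarrow> integral {c..t} q = Q t - \<kappa>"
    using poly_functions_integral[OF q] by blast
  have split: "integral {c..s'} g - integral {c..s} g = integral {s..s'} g"
    if "c \<le> s" "s \<le> s'" "s' \<le> d" for s s'
  proof -
    have "g integrable_on {c..s'}" by (rule integrable_on_subinterval[OF gcd(1)]) (use that in auto)
    then show ?thesis
      using Henstock_Kurzweil_Integration.integral_combine[of c s s' g] that by simp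
  qed
  have "\<bar>f t - Q t\<bar> \<le> E" if t: "t \<in> {c..d} - N" for t
  proof -
    have t': "c < t" "t < d" "t \<notin> N1" "t0 \<notin> N1" using t t0 by (auto simp: N_def less_le)
    have "f t = \<kappa> + integral {c..t} g"
    proof (cases "t0 \<le> t")
      case True
      then show ?thesis using N1(2)[of t0 t] split[of t0 t] t' t0 cd by (simp add: \<kappa>_def)
    next
      case False
      then show ?thesis using N1(2)[of t t0] split[of t t0] t' t0 cd by (simp add: \<kappa>_def)
    qed
    moreover have "integral {c..t} g - integral {c..t} q = integral {c..t} (\<lambda>t. g t - q t)"
    proof (rule Henstock_Kurzweil_Integration.integral_diff[symmetric])
      show "g integrable_on {c..t}" by (rule integrable_on_subinterval[OF gcd(1)]) (use t' in auto)
      show "q integrable_on {c..t}" by (rule integrable_continuous_real[OF qc])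
    qed
    ultimately have "f t - Q t = integral {c..t} (\<lambda>t. g t - q t)" using Q(2)[of t] t' by simp
    also have "\<bar>\<dots>\<bar> \<le> integral {c..t} (\<lambda>t. \<bar>g t - q t\<bar>)"
      using integral_norm_bound_integral[of "\<lambda>t. g t - q t" "{c..t}" "\<lambda>t. \<bar>g t - q t\<bar>"]
        integrable_on_subinterval[OF gq(1), of c t] integrable_on_subinterval[OF gq(2), of c t] t' by simp
    also have "\<dots> \<le> integral {c..d} (\<lambda>t. \<bar>g t - q t\<bar>)"
      by (rule integral_subset_le) (use t' gq(2) in \<open>auto intro: integrable_on_subinterval\<close>)
    finally show ?thesis using E by simp
  qed
  then show ?thesis using that Q(1) N by blast
qed

text \<open>
Taylor's formula with the top weak derivative \<open>h\<close>, in the mean, by induction on the order.  The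
intermediate derivatives are determined only up to null sets, and the mean value does not see those.
One \<open>h\<close> serves all vectors \<open>w\<close>, while the polynomial and the null sets depend on \<open>w\<close>.
\<close>

lemma H_time_taylor_mean:
  fixes f :: "real \<Rightarrow> 'h::{real_inner,banach}"
  assumes "H_time m a b f"
  shows "\<exists>h :: real \<Rightarrow> 'h. L2_time a b h \<and> (\<forall>w c d. a \<le> c \<and> c \<le> d \<and> d \<le> b \<longrightarrow>
    (\<exists>q\<in>poly_functions m. integral {c..d} (\<lambda>t. \<bar>f t \<bullet> w - q t\<bar>)
        \<le> (d - c) ^ m * (norm w * integral {c..d} (\<lambda>t. norm (h t)))))"
  using assms
proof (induction m arbitrary: f)
  case 0
  then have f: "L2_time a b f" by simp
  have "(\<lambda>t. 0) \<in> poly_functions 0" by (simp add: poly_functions_def)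
  moreover have "integral {c..d} (\<lambda>t. \<bar>f t \<bullet> w - 0\<bar>) \<le> (d - c) ^ 0 * (norm w * integral {c..d} (\<lambda>t. norm (f t)))"
    if "a \<le> c" "c \<le> d" "d \<le> b" for w c d
  proof -
    have s: "{c..d} \<subseteq> {a..b}" using that by auto
    have n: "(\<lambda>t. norm (f t)) integrable_on {c..d}" "(\<lambda>t. \<bar>f t \<bullet> w\<bar>) integrable_on {c..d}"
      using absolutely_integrable_on_subinterval[OF L2_time_real_absolutely_integrable[OF L2_time_norm[OF f]] s]
       absolutely_integrable_on_subinterval[OF L2_time_real_absolutely_integrable[OF L2_time_inner[OF f]] s]
      by (auto simp: absolutely_integrable_on_def)
    have "integral {c..d} (\<lambda>t. \<bar>f t \<bullet> w\<bar>) \<le> integral {c..d} (\<lambda>t. norm w * norm (f t))"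
      by (intro integral_le n integrable_on_mult_right) (metis Cauchy_Schwarz_ineq2 mult.commute)
    then show ?thesis by simp
  qed
  ultimately show ?case by (intro exI[of _ f] conjI f allI impI bexI[of _ "\<lambda>t. 0"]) auto
next
  case (Suc m)
  then obtain g where f: "L2_time a b f" and w: "weak_time_derivative a b f g" and g: "H_time m a b g"
    by auto
  obtain h :: "real \<Rightarrow> 'h" where h: "L2_time a b h" and IH: "\<And>w c d. a \<le> c \<and> c \<le> d \<and> d \<le> b \<Longrightarrow>
    \<exists>q\<in>poly_functions m. integral {c..d} (\<lambda>t. \<bar>g t \<bullet> w - q t\<bar>)
        \<le> (d - c) ^ m * (norm w * integral {c..d} (\<lambda>t. norm (h t)))"
    using Suc.IH[OF g] by blast
  note ai = L2_time_real_absolutely_integrable[OF L2_time_inner]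
  have "\<exists>q\<in>poly_functions (Suc m). integral {c..d} (\<lambda>t. \<bar>f t \<bullet> v - q t\<bar>)
        \<le> (d - c) ^ Suc m * (norm v * integral {c..d} (\<lambda>t. norm (h t)))"
    if cd: "a \<le> c" "c \<le> d" "d \<le> b" for v c d
  proof (cases "c = d")
    case True
    have "(\<lambda>t. 0) \<in> poly_functions (Suc m)"
      by (auto simp: poly_functions_def fun_eq_iff intro!: exI[of _ "\<lambda>_. 0"])
    then show ?thesis using True by auto
  next
    case False
    define E where "E = (d - c) ^ m * (norm v * integral {c..d} (\<lambda>t. norm (h t)))"
    obtain q where q: "q \<in> poly_functions m" "integral {c..d} (\<lambda>t. \<bar>g t \<bullet> v - q t\<bar>) \<le> E"
      using IH[of c d v] cd unfolding E_def by blast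
    obtain Q N where Q: "Q \<in> poly_functions (Suc m)" "negligible N"
        "\<And>t. t \<in> {c..d} - N \<Longrightarrow> \<bar>f t \<bullet> v - Q t\<bar> \<le> E"
      using weak_derivative_taylor_step[OF weak_time_derivative_inner[OF w, of v] ai[OF f] ai[OF H_time_L2_time[OF g]]
          cd(1) _ cd(3) q] cd(2) False by auto
    have s: "{c..d} \<subseteq> {a..b}" using cd by auto
    have "(\<lambda>t. f t \<bullet> v - Q t) absolutely_integrable_on {c..d}"
      by (intro set_integral_diff(1) absolutely_integrable_on_subinterval[OF ai[OF f] s]
          absolutely_integrable_continuous_real poly_functions_continuous[OF Q(1)])
    then have "(\<lambda>t. \<bar>f t \<bullet> v - Q t\<bar>) integrable_on {c..d}" by (simp add: absolutely_integrable_on_def)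
    then have "integral {c..d} (\<lambda>t. \<bar>f t \<bullet> v - Q t\<bar>) \<le> integral {c..d} (\<lambda>t. E)"
    proof -
      assume i: "(\<lambda>t. \<bar>f t \<bullet> v - Q t\<bar>) integrable_on {c..d}"
      let ?F = "\<lambda>t. if t \<in> N then E else \<bar>f t \<bullet> v - Q t\<bar>"
      have "integral {c..d} (\<lambda>t. \<bar>f t \<bullet> v - Q t\<bar>) = integral {c..d} ?F"
        by (rule integral_spike[OF Q(2)]) auto
      also have "\<dots> \<le> integral {c..d} (\<lambda>t. E)"
        using integrable_spike[OF i Q(2), of ?F] Q(3) by (intro integral_le) auto
      finally show ?thesis .
    qed
    also have "\<dots> = (d - c) ^ Suc m * (norm v * integral {c..d} (\<lambda>t. norm (h t)))"
      using cd by (simp add: E_def)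
    finally show ?thesis using Q(1) by blast
  qed
  then show ?case using h by blast
qed

text \<open>
For continuous \<open>f\<close> the last integration gives the bound at every point, which interpolation needs.
\<close>

lemma H_time_taylor:
  fixes f :: "real \<Rightarrow> 'h::{real_inner,banach}"
  assumes H: "H_time (Suc m) a b f" and ab: "a < b" and cont: "continuous_on {a..b} f"
  obtains h :: "real \<Rightarrow> 'h" where "L2_time a b h" "\<And>w c d. a \<le> c \<Longrightarrow> c \<le> d \<Longrightarrow> d \<le> b \<Longrightarrow>
    \<exists>q\<in>poly_functions (Suc m). \<forall>t\<in>{c..d}. \<bar>f t \<bullet> w - q t\<bar>
        \<le> (d - c) ^ m * (norm w * integral {c..d} (\<lambda>t. norm (h t)))"
proof -
  obtain g where f: "L2_time a b f" and w: "weak_time_derivative a b f g" and g: "H_time m a b g"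
    using H by auto
  obtain h :: "real \<Rightarrow> 'h" where h: "L2_time a b h" and gh: "\<And>w c d. a \<le> c \<and> c \<le> d \<and> d \<le> b \<Longrightarrow>
    \<exists>q\<in>poly_functions m. integral {c..d} (\<lambda>t. \<bar>g t \<bullet> w - q t\<bar>)
        \<le> (d - c) ^ m * (norm w * integral {c..d} (\<lambda>t. norm (h t)))"
    using H_time_taylor_mean[OF g] by blast
  note ai = L2_time_real_absolutely_integrable[OF L2_time_inner]
  have main: "\<exists>q\<in>poly_functions (Suc m). \<forall>t\<in>{c..d}. \<bar>f t \<bullet> v - q t\<bar>
        \<le> (d - c) ^ m * (norm v * integral {c..d} (\<lambda>t. norm (h t)))"
    if cd: "a \<le> c" "c \<le> d" "d \<le> b" for v c d
  proof -
    define E where "E = (d - c) ^ m * (norm v * integral {c..d} (\<lambda>t. norm (h t)))"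
    have s: "{c..d} \<subseteq> {a..b}" using cd by auto
    obtain q where q: "q \<in> poly_functions m" "integral {c..d} (\<lambda>t. \<bar>g t \<bullet> v - q t\<bar>) \<le> E"
      using gh[of c d v] cd unfolding E_def by blast
    obtain Q where Q: "Q \<in> poly_functions (Suc m)"
        "\<And>t. c \<le> t \<Longrightarrow> integral {c..t} q = Q t - f c \<bullet> v"
      using poly_functions_integral[OF q(1)] by blast
    have qc: "continuous_on S q" for S by (rule poly_functions_continuous[OF q(1)])
    have ga: "(\<lambda>t. g t \<bullet> v) absolutely_integrable_on {c..d}"
      by (rule absolutely_integrable_on_subinterval[OF ai[OF H_time_L2_time[OF g]] s])
    have gi: "(\<lambda>t. g t \<bullet> v) integrable_on {c..d}" using ga absolutely_integrable_on_def by blast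
    have gq: "(\<lambda>t. g t \<bullet> v - q t) integrable_on {c..d}" "(\<lambda>t. \<bar>g t \<bullet> v - q t\<bar>) integrable_on {c..d}"
      using set_integral_diff(1)[OF ga absolutely_integrable_continuous_real[OF qc, of c d]]
      by (auto simp: absolutely_integrable_on_def)
    have "\<bar>f t \<bullet> v - Q t\<bar> \<le> E" if t: "t \<in> {c..d}" for t
    proof -
      have sub: "{c..t} \<subseteq> {c..d}" using t by auto
      have "f t \<bullet> v - f c \<bullet> v = integral {c..t} (\<lambda>t. g t \<bullet> v)"
        by (rule weak_derivative_continuous_representative[OF weak_time_derivative_inner[OF w, of v] ab
              ai[OF f] ai[OF H_time_L2_time[OF g]], of "\<lambda>t. f t \<bullet> v" "{}"])
           (use t cd in \<open>auto intro!: continuous_intros cont\<close>)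
      moreover have "integral {c..t} (\<lambda>t. g t \<bullet> v) - integral {c..t} q = integral {c..t} (\<lambda>t. g t \<bullet> v - q t)"
        by (rule Henstock_Kurzweil_Integration.integral_diff[symmetric])
           (auto intro: integrable_on_subinterval[OF gi sub] integrable_continuous_real[OF qc])
      ultimately have "f t \<bullet> v - Q t = integral {c..t} (\<lambda>t. g t \<bullet> v - q t)" using Q(2)[of t] t by simp
      also have "\<bar>\<dots>\<bar> \<le> integral {c..t} (\<lambda>t. \<bar>g t \<bullet> v - q t\<bar>)"
        using integral_norm_bound_integral[of "\<lambda>t. g t \<bullet> v - q t" "{c..t}" "\<lambda>t. \<bar>g t \<bullet> v - q t\<bar>"]
          integrable_on_subinterval[OF gq(1) sub] integrable_on_subinterval[OF gq(2) sub] by simp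
      also have "\<dots> \<le> integral {c..d} (\<lambda>t. \<bar>g t \<bullet> v - q t\<bar>)"
        by (rule integral_subset_le) (use t gq(2) integrable_on_subinterval[OF gq(2) sub] in auto)
      finally show ?thesis using q(2) by simp
    qed
    then show ?thesis using Q(1) unfolding E_def by blast
  qed
  show ?thesis
  proof (rule that[OF h])
    fix w c d assume "a \<le> c" "c \<le> d" "d \<le> b"
    from main[OF this, of w] show "\<exists>q\<in>poly_functions (Suc m). \<forall>t\<in>{c..d}. \<bar>f t \<bullet> w - q t\<bar>
        \<le> (d - c) ^ m * (norm w * integral {c..d} (\<lambda>t. norm (h t)))" .
  qed
qed

text \<open>
Cauchy-Schwarz in time, from the nonnegativity of the variance.
\<close>

lemma square_integral_norm_le:
  assumes h: "L2_time a b h" and cd: "a \<le> c" "c \<le> d" "d \<le> b"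
  shows "(integral {c..d} (\<lambda>t. norm (h t)))\<^sup>2 \<le> (d - c) * integral {c..d} (\<lambda>t. (norm (h t))\<^sup>2)"
proof (cases "c = d")
  case False
  have s: "{c..d} \<subseteq> {a..b}" using cd by auto
  have i1: "(\<lambda>t. norm (h t)) integrable_on {c..d}"
    using absolutely_integrable_on_subinterval[OF L2_time_real_absolutely_integrable[OF L2_time_norm[OF h]] s]
    by (auto simp: absolutely_integrable_on_def)
  have i2: "(\<lambda>t. (norm (h t))\<^sup>2) integrable_on {c..d}"
    using h s by (auto simp: L2_time_def intro: integrable_on_subinterval)
  define I where "I = integral {c..d} (\<lambda>t. norm (h t))"
  define m where "m = I / (d - c)"
  have "0 \<le> integral {c..d} (\<lambda>t. (norm (h t) - m)\<^sup>2)"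
  proof (rule Henstock_Kurzweil_Integration.integral_nonneg)
    show "(\<lambda>t. (norm (h t) - m)\<^sup>2) integrable_on {c..d}"
      unfolding power2_diff
      by (intro integrable_add integrable_diff i1 i2 integrable_on_mult_right integrable_on_mult_left) auto
  qed simp
  also have "integral {c..d} (\<lambda>t. (norm (h t) - m)\<^sup>2)
     = integral {c..d} (\<lambda>t. ((norm (h t))\<^sup>2 + m\<^sup>2) - (2 * m) * norm (h t))"
    by (simp add: power2_diff mult.commute mult.left_commute)
  also have "\<dots> = integral {c..d} (\<lambda>t. (norm (h t))\<^sup>2) + (d - c) * m\<^sup>2 - 2 * m * I"
  proof -
    have "((\<lambda>t. ((norm (h t))\<^sup>2 + m\<^sup>2) - (2 * m) * norm (h t)) has_integral
      (integral {c..d} (\<lambda>t. (norm (h t))\<^sup>2) + (d - c) *\<^sub>R m\<^sup>2) - (2 * m) * I) {c..d}"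
      unfolding I_def using cd
      by (intro has_integral_diff has_integral_add has_integral_mult_right integrable_integral i1 i2
          has_integral_const_real[of "m\<^sup>2" c d, unfolded content_real[OF cd(2)]])
    then show ?thesis by (simp add: integral_unique)
  qed
  also have "\<dots> = integral {c..d} (\<lambda>t. (norm (h t))\<^sup>2) - I\<^sup>2 / (d - c)"
  proof -
    have "(d - c) * m = I" using False by (simp add: m_def)
    then have "(d - c) * m\<^sup>2 = I * m" by (simp add: power2_eq_square flip: mult.assoc)
    moreover have "I\<^sup>2 / (d - c) = I * m" by (simp add: m_def power2_eq_square)
    ultimately show ?thesis by simp
  qed
  finally show ?thesis using False cd by (simp add: I_def field_simps)
qed simp

section \<open>Lagrange interpolation on a grid with bounded step ratios\<close>

text \<open>
Both sides are polynomials in \<open>y\<close> of degree below \<open>k\<close> that agree at the \<open>k\<close> nodes.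
\<close>

lemma lagrange_interpolation_exact:
  fixes x :: "nat \<Rightarrow> real"
  assumes q: "q \<in> poly_functions k" and inj: "inj_on x {..<k}"
  shows "(\<Sum>i<k. (\<Prod>m\<in>{..<k} - {i}. (y - x m) / (x i - x m)) * q (x i)) = q y"
proof (cases "k = 0")
  case True
  then show ?thesis using q by (simp add: poly_functions_def)
next
  case False
  obtain \<alpha> where q: "q = (\<lambda>t. \<Sum>i<k. \<alpha> i * t ^ i)" using q by (auto simp: poly_functions_def)
  define p where "p = (\<Sum>i<k. monom (\<alpha> i) i)"
  define l where "l i = (\<Prod>m\<in>{..<k} - {i}. [:- x m / (x i - x m), 1 / (x i - x m):])" for i
  define r where "r = (\<Sum>i<k. smult (q (x i)) (l i))"
  have pq: "poly p t = q t" for t by (simp add: p_def q poly_sum poly_monom)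
  have pl: "poly (l i) t = (\<Prod>m\<in>{..<k} - {i}. (t - x m) / (x i - x m))" for i t
    unfolding l_def poly_prod by (intro prod.cong refl) (simp add: diff_divide_distrib)
  have degp: "degree p < k"
  proof -
    have "degree p \<le> k - 1" unfolding p_def
      by (rule degree_sum_le) (auto intro: order_trans[OF degree_monom_le])
    then show ?thesis using False by simp
  qed
  have degr: "degree r < k"
  proof -
    have "degree (l i) \<le> k - 1" if "i < k" for i
    proof -
      have "degree (l i) \<le> (\<Sum>m\<in>{..<k} - {i}. degree [:- x m / (x i - x m), 1 / (x i - x m):])"
        unfolding l_def by (rule degree_prod_sum_le[OF finite_Diff, unfolded o_def]) simp
      also have "\<dots> \<le> (\<Sum>m\<in>{..<k} - {i}. 1)" by (intro sum_mono) simp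
      also have "\<dots> = k - 1" using that by simp
      finally show ?thesis .
    qed
    then have "degree r \<le> k - 1" unfolding r_def
      by (intro degree_sum_le) (auto intro: order_trans[OF degree_smult_le])
    then show ?thesis using False by simp
  qed
  have "p = r"
  proof (rule poly_eqI_degree[of "x ` {..<k}"])
    fix z assume "z \<in> x ` {..<k}"
    then obtain j where j: "j < k" "z = x j" by auto
    have "poly (l i) (x j) = (if i = j then 1 else 0)" if "i < k" for i
    proof (cases "i = j")
      case True
      have "x j - x m \<noteq> 0" if "m \<in> {..<k} - {j}" for m
        using that j inj by (auto dest: inj_onD)
      then show ?thesis using True by (simp add: pl)
    next
      case False
      then show ?thesis unfolding pl using j by (auto intro!: prod_zero)
    qed
    then have "poly r z = (\<Sum>i<k. if i = j then q (x i) else 0)"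
      unfolding r_def poly_sum j(2) by (intro sum.cong) auto
    also have "\<dots> = q z" using j by simp
    finally show "poly p z = poly r z" by (simp add: pq)
  qed (use degp degr inj in \<open>simp_all add: card_image\<close>)
  then have "q y = poly r y" by (simp add: pq[symmetric])
  then show ?thesis by (simp add: r_def poly_sum pl mult.commute)
qed

lemma sum_steps_backward: "m \<le> n \<Longrightarrow> (\<Sum>j = 1..m. step t (n - j)) = t n - t (n - m)"
proof (induction m)
  case (Suc m)
  have "Suc (n - Suc m) = n - m" using Suc.prems by simp
  then show ?case using Suc by (simp add: step_def)
qed simp

lemma lagrange_basis_eq:
  assumes "k \<ge> 1" "k - 1 \<le> n" "i < k"
  shows "lagrange_basis t k n i (y - t n)
    = (\<Prod>m\<in>{..<k} - {i}. (y - t (n - m)) / (t (n - i) - t (n - m)))"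
proof -
  have set: "{0..k - 1} - {i} = {..<k} - {i}" using assms(1) by auto
  show ?thesis unfolding lagrange_basis_def set
  proof (rule prod.cong[OF refl])
    fix m assume "m \<in> {..<k} - {i}"
    then have "m \<le> n" "i \<le> n" using assms by auto
    then show "((\<Sum>j = 1..m. step t (n - j)) + (y - t n)) /
        ((\<Sum>j = 1..m. step t (n - j)) - (\<Sum>j = 1..i. step t (n - j)))
      = (y - t (n - m)) / (t (n - i) - t (n - m))"
      by (simp only: sum_steps_backward) simp
  qed
qed

lemma time_grid_strict_mono: "time_grid t \<Longrightarrow> i < j \<Longrightarrow> t i < t j"
  by (auto simp: time_grid_def strict_mono_def)

lemma time_grid_mono: "time_grid t \<Longrightarrow> i \<le> j \<Longrightarrow> t i \<le> t j"
  by (auto simp: time_grid_def strict_mono_less_eq)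

lemma step_pos: "time_grid t \<Longrightarrow> step t n > 0"
  by (simp add: step_def time_grid_strict_mono)

lemma step_le_max_step: "time_grid t \<Longrightarrow> step t n \<le> max_step t"
  unfolding max_step_def time_grid_def by (auto intro: cSUP_upper)

lemma sum_steps: "m \<le> n \<Longrightarrow> t n - t m = (\<Sum>j = m..<n. step t j)"
  by (induction rule: dec_induct) (auto simp: step_def)

lemma interval_length_le:
  assumes "time_grid t" "m \<le> n" shows "t n - t m \<le> real (n - m) * max_step t"
proof -
  have "t n - t m \<le> (\<Sum>j = m..<n. max_step t)"
    unfolding sum_steps[OF assms(2)] by (intro sum_mono step_le_max_step assms(1))
  then show ?thesis by simp
qed

text \<open>
Each factor is a quotient of a length of at most \<open>k\<close> neighbouring steps and a length of at least one
of them, hence at most \<open>k r\<close>.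
\<close>

lemma lagrange_basis_bound:
  assumes t: "time_grid t" and r: "step_ratio_bounded k r t"
    and k: "k \<ge> 1" "k - 1 \<le> n" and i: "i < k" and y: "t n \<le> y" "y \<le> t (Suc n)"
  shows "\<bar>lagrange_basis t k n i (y - t n)\<bar> \<le> (real k * r) ^ k"
proof -
  have ratio: "step t a \<le> r * step t b" if "n + 1 - k \<le> a" "a \<le> n" "n + 1 - k \<le> b" "b \<le> n" for a b
  proof -
    have "\<bar>int a - int b\<bar> < int k" using that k by linarith
    then have "step t a / step t b \<le> r" using r by (simp add: step_ratio_bounded_def)
    then show ?thesis using step_pos[OF t, of b] by (simp add: divide_le_eq mult.commute)
  qed
  have r1: "1 \<le> r" using ratio[of n n] step_pos[OF t, of n] k by simp
  have kr: "1 \<le> real k * r" using mult_mono[of 1 "real k" 1 r] k r1 by simp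
  have fac: "\<bar>(y - t (n - m)) / (t (n - i) - t (n - m))\<bar> \<le> real k * r" if m: "m < k" "m \<noteq> i" for m
  proof -
    \<comment> \<open>The step that starts at the earlier of the two nodes in the denominator.\<close>
    define b where "b = n - max i m"
    have b: "n + 1 - k \<le> b" "b \<le> n" using m i k by (auto simp: b_def)
    have "y - t (n - m) \<le> t (Suc n) - t (n - m)" using y by simp
    also have "\<dots> = (\<Sum>j = n - m..<Suc n. step t j)" by (rule sum_steps) simp
    also have "\<dots> \<le> (\<Sum>j = n - m..<Suc n. r * step t b)"
      using m k b by (intro sum_mono ratio) auto
    also have "\<dots> = real (Suc n - (n - m)) * (r * step t b)" by simp
    also have "\<dots> \<le> real k * (r * step t b)"
      using m step_pos[OF t, of b] r1 by (intro mult_right_mono) auto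
    finally have num: "y - t (n - m) \<le> real k * r * step t b" by simp
    have num0: "0 \<le> y - t (n - m)" using time_grid_mono[OF t, of "n - m" n] y by simp
    have den: "step t b \<le> \<bar>t (n - i) - t (n - m)\<bar>"
    proof (cases "i < m")
      case True
      have "t (Suc b) \<le> t (n - i)" using True m k by (intro time_grid_mono[OF t]) (auto simp: b_def)
      then show ?thesis using True by (simp add: b_def step_def max_def)
    next
      case False
      then have "m < i" using m by simp
      moreover from this have "t (Suc b) \<le> t (n - m)" using i k by (intro time_grid_mono[OF t]) (auto simp: b_def)
      ultimately show ?thesis by (simp add: b_def step_def max_def)
    qed
    have "\<bar>(y - t (n - m)) / (t (n - i) - t (n - m))\<bar> = (y - t (n - m)) / \<bar>t (n - i) - t (n - m)\<bar>"
      using num0 by (simp add: abs_divide)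
    also have "\<dots> \<le> (real k * r * step t b) / step t b"
      using num num0 den step_pos[OF t, of b] kr by (intro frac_le) auto
    finally show ?thesis using step_pos[OF t, of b] by simp
  qed
  have "\<bar>lagrange_basis t k n i (y - t n)\<bar> \<le> (\<Prod>m\<in>{..<k} - {i}. real k * r)"
    unfolding lagrange_basis_eq[OF k i] abs_prod by (intro prod_mono) (use fac in auto)
  also have "\<dots> \<le> (real k * r) ^ k" using kr i by (simp add: power_increasing)
  finally show ?thesis .
qed

text \<open>
Polynomials of degree below \<open>k\<close> are reproduced, so only the deviation from a polynomial is
interpolated.  The polynomial may depend on the vector \<open>w\<close> tested with; it is chosen for the error
vector itself.
\<close>

lemma interpolation_error:
  fixes f :: "real \<Rightarrow> 'h::real_inner"
  assumes t: "time_grid t" and r: "step_ratio_bounded k r t"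
    and k: "k \<ge> 1" "k - 1 \<le> n" and y: "t n \<le> y" "y \<le> t (Suc n)" and K0: "0 \<le> K"
    and K: "\<And>w. \<exists>q\<in>poly_functions k. \<forall>s\<in>{t (n + 1 - k)..t (Suc n)}. \<bar>f s \<bullet> w - q s\<bar> \<le> K * norm w"
  shows "norm (f y - (\<Sum>i<k. lagrange_basis t k n i (y - t n) *\<^sub>R f (t (n - i))))
    \<le> (1 + real k * (real k * r) ^ k) * K"
proof -
  define w where "w = f y - (\<Sum>i<k. lagrange_basis t k n i (y - t n) *\<^sub>R f (t (n - i)))"
  define l where "l i = lagrange_basis t k n i (y - t n)" for i
  obtain q where q: "q \<in> poly_functions k"
    and qK: "\<And>s. s \<in> {t (n + 1 - k)..t (Suc n)} \<Longrightarrow> \<bar>f s \<bullet> w - q s\<bar> \<le> K * norm w"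
    using K by blast
  have inj: "inj_on (\<lambda>i. t (n - i)) {..<k}"
  proof (rule inj_onI)
    fix i j assume ij: "i \<in> {..<k}" "j \<in> {..<k}" "t (n - i) = t (n - j)"
    then have "n - i = n - j" using time_grid_strict_mono[OF t] by (metis linorder_neq_iff)
    then show "i = j" using ij k by auto
  qed
  have exact: "(\<Sum>i<k. l i * q (t (n - i))) = q y"
    using lagrange_interpolation_exact[OF q inj, of y] k
    by (simp add: l_def lagrange_basis_eq)
  have node: "t (n - i) \<in> {t (n + 1 - k)..t (Suc n)}" if "i < k" for i
    using that k by (auto intro!: time_grid_mono[OF t])
  have yy: "y \<in> {t (n + 1 - k)..t (Suc n)}"
  proof -
    have "t (n + 1 - k) \<le> t n" using k by (intro time_grid_mono[OF t]) simp
    then show ?thesis using y by simp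
  qed
  have "norm w * norm w = w \<bullet> w" by (simp add: dot_square_norm power2_eq_square)
  also have "\<dots> = (f y \<bullet> w - q y) - (\<Sum>i<k. l i * (f (t (n - i)) \<bullet> w - q (t (n - i))))"
    unfolding exact[symmetric]
    by (simp add: w_def l_def inner_diff_left inner_sum_left right_diff_distrib sum_subtractf)
  also have "\<dots> \<le> K * norm w + (\<Sum>i<k. (real k * r) ^ k * (K * norm w))"
  proof -
    have "\<bar>\<Sum>i<k. l i * (f (t (n - i)) \<bullet> w - q (t (n - i)))\<bar> \<le> (\<Sum>i<k. (real k * r) ^ k * (K * norm w))"
    proof (rule order_trans[OF sum_abs sum_mono])
      fix i assume i: "i \<in> {..<k}"
      have "\<bar>l i\<bar> \<le> (real k * r) ^ k"
        unfolding l_def using lagrange_basis_bound[OF t r k _ y] i by simp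
      then show "\<bar>l i * (f (t (n - i)) \<bullet> w - q (t (n - i)))\<bar> \<le> (real k * r) ^ k * (K * norm w)"
        unfolding abs_mult using qK[OF node] i by (intro mult_mono) auto
    qed
    then show ?thesis using qK[OF yy] by linarith
  qed
  also have "\<dots> = (1 + real k * (real k * r) ^ k) * K * norm w" by (simp add: algebra_simps)
  finally have main: "norm w * norm w \<le> (1 + real k * (real k * r) ^ k) * K * norm w" .
  show ?thesis
  proof (cases "w = 0")
    case True
    have "0 \<le> (real k * r) ^ k"
      using lagrange_basis_bound[OF t r k _ y, of 0] k by (auto intro: order_trans[OF abs_ge_zero])
    then have "0 \<le> (1 + real k * (real k * r) ^ k) * K" using K0 by simp
    then show ?thesis using True by (simp add: w_def)
  next
    case False
    then show ?thesis using main unfolding w_def by simp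
  qed
qed

section \<open>A discrete Gronwall inequality\<close>

text \<open>
The bound is proved for the maximum over all earlier indices, because the recursion refers to \<open>k\<close> of
them; \<open>D\<close> collects the inhomogeneous terms as increments.
\<close>

lemma discrete_gronwall:
  fixes E D t :: "nat \<Rightarrow> real"
  assumes k: "k \<ge> 1" and t0: "t 0 = 0" and t: "\<And>n. 0 \<le> t n" and c: "c \<ge> 0" and M: "M \<ge> 0"
    and start: "\<And>i. i < k \<Longrightarrow> i \<le> N \<Longrightarrow> E i \<le> M"
    and D0: "\<And>n. 0 \<le> D n" and Dmono: "\<And>n. k - 1 \<le> n \<Longrightarrow> D n \<le> D (Suc n)"
    and tmono: "\<And>n. t n \<le> t (Suc n)"
    and rec: "\<And>n. k - 1 \<le> n \<Longrightarrow> Suc n \<le> N \<Longrightarrow>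
      E (Suc n) \<le> E n + c * (t (Suc n) - t n) * (\<Sum>i<k. E (n - i)) + (D (Suc n) - D n)"
    and n: "n \<le> N"
  shows "E n \<le> exp (c * real k * t n) * (M + D n)"
proof -
  have claim: "\<forall>m\<le>n. E m \<le> exp (c * real k * t n) * (M + D n)" if "k - 1 \<le> n" "n \<le> N" for n
    using that
  proof (induction n rule: dec_induct)
    case base
    have "1 * (M + 0) \<le> exp (c * real k * t (k - 1)) * (M + D (k - 1))"
      using M D0 c t by (intro mult_mono add_mono) auto
    then show ?case using start base k by (auto intro!: order_trans[OF start])
  next
    case (step n)
    define X where "X = exp (c * real k * t n) * (M + D n)"
    define \<tau> where "\<tau> = t (Suc n) - t n"
    have \<tau>: "\<tau> \<ge> 0" using tmono by (simp add: \<tau>_def)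
    have IH: "\<And>m. m \<le> n \<Longrightarrow> E m \<le> X" using step by (simp add: X_def)
    have X0: "X \<ge> 0" unfolding X_def using M D0 by simp
    have dD: "0 \<le> D (Suc n) - D n" using Dmono step by simp
    have ex1: "1 \<le> exp (c * real k * t (Suc n))" using c t by simp
    have grow: "(1 + c * \<tau> * real k) * X + (D (Suc n) - D n) \<le> exp (c * real k * t (Suc n)) * (M + D (Suc n))"
    proof -
      have "1 + c * \<tau> * real k \<le> exp (c * real k * \<tau>)"
        using exp_ge_add_one_self[of "c * real k * \<tau>"] by (simp add: mult_ac)
      from mult_right_mono[OF this X0]
      have "(1 + c * \<tau> * real k) * X \<le> exp (c * real k * \<tau>) * X" .
      also have "\<dots> = exp (c * real k * t (Suc n)) * (M + D n)"
        by (simp add: X_def \<tau>_def right_diff_distrib flip: exp_add mult.assoc)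
      finally have "(1 + c * \<tau> * real k) * X \<le> exp (c * real k * t (Suc n)) * (M + D n)" .
      moreover have "D (Suc n) - D n \<le> exp (c * real k * t (Suc n)) * (D (Suc n) - D n)"
        using mult_right_mono[OF ex1 dD] by simp
      ultimately show ?thesis by (simp add: algebra_simps)
    qed
    have "E (Suc n) \<le> X + c * \<tau> * (\<Sum>i<k. X) + (D (Suc n) - D n)"
      using rec[of n] step IH c \<tau> unfolding \<tau>_def
      by (intro order_trans[OF rec] add_mono mult_left_mono sum_mono) auto
    also have "\<dots> = (1 + c * \<tau> * real k) * X + (D (Suc n) - D n)" by (simp add: algebra_simps)
    also note grow
    finally have new: "E (Suc n) \<le> exp (c * real k * t (Suc n)) * (M + D (Suc n))" .
    have "X \<le> (1 + c * \<tau> * real k) * X + (D (Suc n) - D n)"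
    proof -
      have "0 \<le> c * \<tau> * real k * X" using X0 c \<tau> by simp
      then show ?thesis using dD by (simp add: distrib_right)
    qed
    then have "X \<le> exp (c * real k * t (Suc n)) * (M + D (Suc n))" using grow by linarith
    then show ?case using new IH by (metis le_Suc_eq order_trans)
  qed
  show ?thesis
  proof (cases "k - 1 \<le> n")
    case True
    then show ?thesis using claim[of n] n by simp
  next
    case False
    have "1 * (M + 0) \<le> exp (c * real k * t n) * (M + D n)"
      using M D0 c t by (intro mult_mono add_mono) auto
    moreover have "n < k" using False k by linarith
    ultimately show ?thesis using start[of n] n by simp
  qed
qed

section \<open>The energy estimate on one step\<close>

lemma vector_derivative_quotient:
  assumes "(z has_vector_derivative z') (at s within S)"
  shows "((\<lambda>x. (1 / (x - s)) *\<^sub>R (z x - z s)) \<longlongrightarrow> z') (at s within S)"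
proof (rule LIM_zero_cancel, rule tendsto_norm_zero_cancel)
  have "((\<lambda>x. (1 / norm (x - s)) *\<^sub>R (z x - (z s + (x - s) *\<^sub>R z'))) \<longlongrightarrow> 0) (at s within S)"
    using assms by (simp add: has_vector_derivative_def has_derivative_within)
  from tendsto_norm_zero[OF this]
  show "((\<lambda>x. norm ((1 / (x - s)) *\<^sub>R (z x - z s) - z')) \<longlongrightarrow> 0) (at s within S)"
  proof (rule Lim_transform_eventually)
    show "\<forall>\<^sub>F x in at s within S. norm ((1 / norm (x - s)) *\<^sub>R (z x - (z s + (x - s) *\<^sub>R z')))
        = norm ((1 / (x - s)) *\<^sub>R (z x - z s) - z')"
    proof (simp only: eventually_at_topological, intro exI[of _ UNIV] conjI ballI impI)
      fix x assume x: "x \<noteq> s"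
      have "(1 / (x - s)) *\<^sub>R (z x - z s) - z' = (1 / (x - s)) *\<^sub>R (z x - (z s + (x - s) *\<^sub>R z'))"
        using x by (simp add: scaleR_diff_right scaleR_add_right)
      then show "norm ((1 / norm (x - s)) *\<^sub>R (z x - (z s + (x - s) *\<^sub>R z')))
        = norm ((1 / (x - s)) *\<^sub>R (z x - z s) - z')" by simp
    qed auto
  qed
qed

text \<open>
The product rule for \<open>z x \<bullet> v x\<close> would require \<open>v\<close> to be differentiable.  If the pairing is symmetric,
then \<open>z x \<bullet> v x - z s \<bullet> v s = (z x - z s) \<bullet> (v x + v s)\<close>, and continuity of \<open>v\<close> suffices.
\<close>

lemma symmetric_form_derivative:
  fixes z v :: "real \<Rightarrow> 'h::real_inner"
  assumes z: "(z has_vector_derivative z') (at s within S)" and v: "(v \<longlongrightarrow> v s) (at s within S)"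
    and sym: "\<And>x. z x \<bullet> v s = z s \<bullet> v x"
  shows "((\<lambda>x. z x \<bullet> v x) has_real_derivative 2 * (z' \<bullet> v s)) (at s within S)"
proof -
  have "((\<lambda>x. ((1 / (x - s)) *\<^sub>R (z x - z s)) \<bullet> (v x + v s)) \<longlongrightarrow> z' \<bullet> (v s + v s)) (at s within S)"
    by (intro tendsto_intros vector_derivative_quotient z v)
  moreover have "((1 / (x - s)) *\<^sub>R (z x - z s)) \<bullet> (v x + v s) = (z x \<bullet> v x - z s \<bullet> v s) / (x - s)" for x
  proof -
    have "(z x - z s) \<bullet> (v x + v s) = z x \<bullet> v x - z s \<bullet> v s"
      using sym[of x] by (simp add: inner_diff_left inner_add_right)
    then show ?thesis by simp
  qed
  ultimately show ?thesis
    by (simp add: has_field_derivative_iff inner_add_right)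
qed

text \<open>
Integration of \<open>\<phi>' \<le> K + m \<bar>Y'\<bar>\<^sup>2\<close> when \<open>Y'\<close> is known only through the increments of \<open>Y\<close>: difference
quotients satisfy \<open>\<bar>\<Delta>Y\<bar>\<^sup>2 / \<Delta>s \<le> \<Delta>\<Lambda>\<close>, so, up to a small slope \<open>\<eta>\<close>, the inequality holds near every point,
and it is additive over adjacent intervals, hence global (\<open>Bolzano\<close>).
\<close>

lemma growth_bound:
  fixes \<phi> \<phi>' \<Lambda> :: "real \<Rightarrow> real" and Y Y' :: "real \<Rightarrow> 'h::real_inner"
  assumes cd: "c \<le> d" and m: "m \<ge> 0"
    and \<phi>: "\<And>s. s \<in> {c..d} \<Longrightarrow> (\<phi> has_real_derivative \<phi>' s) (at s within {c..d})"
    and Y: "\<And>s. s \<in> {c..d} \<Longrightarrow> (Y has_vector_derivative Y' s) (at s within {c..d})"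
    and le: "\<And>s. s \<in> {c..d} \<Longrightarrow> \<phi>' s \<le> K + m * (norm (Y' s))\<^sup>2"
    and inc: "\<And>s s'. c \<le> s \<Longrightarrow> s \<le> s' \<Longrightarrow> s' \<le> d \<Longrightarrow> (norm (Y s' - Y s))\<^sup>2 \<le> (s' - s) * (\<Lambda> s' - \<Lambda> s)"
  shows "\<phi> d - \<phi> c \<le> K * (d - c) + m * (\<Lambda> d - \<Lambda> c)"
proof (rule field_le_epsilon)
  fix \<eta>' :: real assume "\<eta>' > 0"
  define \<eta> where "\<eta> = \<eta>' / (d - c + 1)"
  have \<eta>: "\<eta> > 0" using \<open>\<eta>' > 0\<close> cd by (simp add: \<eta>_def)
  define P where "P x y \<longleftrightarrow> (c \<le> x \<longrightarrow> y \<le> d \<longrightarrow> \<phi> y - \<phi> x \<le> (K + \<eta>) * (y - x) + m * (\<Lambda> y - \<Lambda> x))" for x y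
  have "P c d"
    using cd
  proof (induction rule: Bolzano)
    case (trans x y z)
    then show ?case unfolding P_def by (auto simp: algebra_simps)
  next
    case (local s)
    then have s: "s \<in> {c..d}" by simp
    have "((\<lambda>x. (\<phi> x - \<phi> s) / (x - s) - m * (norm ((1 / (x - s)) *\<^sub>R (Y x - Y s)))\<^sup>2)
        \<longlongrightarrow> \<phi>' s - m * (norm (Y' s))\<^sup>2) (at s within {c..d})"
      using \<phi>[OF s] by (intro tendsto_intros vector_derivative_quotient Y s)
        (simp add: has_field_derivative_iff)
    moreover have "\<phi>' s - m * (norm (Y' s))\<^sup>2 < K + \<eta>" using le[OF s] \<eta> by simp
    ultimately have "\<forall>\<^sub>F x in at s within {c..d}.
        (\<phi> x - \<phi> s) / (x - s) - m * (norm ((1 / (x - s)) *\<^sub>R (Y x - Y s)))\<^sup>2 < K + \<eta>"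
      by (rule order_tendstoD(2))
    then obtain \<delta> where \<delta>: "\<delta> > 0" "\<And>x. x \<in> {c..d} \<Longrightarrow> x \<noteq> s \<Longrightarrow> dist x s < \<delta> \<Longrightarrow>
        (\<phi> x - \<phi> s) / (x - s) - m * (norm ((1 / (x - s)) *\<^sub>R (Y x - Y s)))\<^sup>2 < K + \<eta>"
      unfolding eventually_at by blast
    have one: "\<phi> y - \<phi> x \<le> (K + \<eta>) * (y - x) + m * (\<Lambda> y - \<Lambda> x)"
      if xy: "x \<le> y" "c \<le> x" "y \<le> d" "x = s \<or> y = s" "y - x < \<delta>" for x y
    proof (cases "x = y")
      case False
      define h where "h = y - x"
      have h: "h > 0" using xy False by (simp add: h_def)
      have q: "(\<phi> y - \<phi> x) / h - m * ((norm (Y y - Y x))\<^sup>2 / h\<^sup>2) < K + \<eta>"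
      proof (cases "x = s")
        case True
        have "(norm ((1 / h) *\<^sub>R (Y y - Y x)))\<^sup>2 = (norm (Y y - Y x))\<^sup>2 / h\<^sup>2"
          by (simp add: power_divide)
        then show ?thesis using \<delta>(2)[of y] xy False True by (simp add: h_def dist_real_def)
      next
        case F: False
        then have ys: "y = s" using xy by simp
        have "(norm ((1 / (x - y)) *\<^sub>R (Y x - Y y)))\<^sup>2 = (norm (Y y - Y x))\<^sup>2 / h\<^sup>2"
          by (simp add: power_divide h_def norm_minus_commute power2_commute)
        moreover have "(\<phi> x - \<phi> y) / (x - y) = (\<phi> y - \<phi> x) / h"
          unfolding h_def by (metis minus_diff_eq minus_divide_divide)
        ultimately show ?thesis using \<delta>(2)[of x] xy False ys by (simp add: dist_real_def)
      qed
      have "(norm (Y y - Y x))\<^sup>2 \<le> h * (\<Lambda> y - \<Lambda> x)" unfolding h_def using inc xy by simp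
      then have "(norm (Y y - Y x))\<^sup>2 / h \<le> \<Lambda> y - \<Lambda> x" using h by (simp add: divide_le_eq mult.commute)
      then have "m * ((norm (Y y - Y x))\<^sup>2 / h) \<le> m * (\<Lambda> y - \<Lambda> x)" using m by (rule mult_left_mono)
      moreover have "\<phi> y - \<phi> x - m * ((norm (Y y - Y x))\<^sup>2 / h) < (K + \<eta>) * h"
      proof -
        have "h * ((\<phi> y - \<phi> x) / h - m * ((norm (Y y - Y x))\<^sup>2 / h\<^sup>2)) < h * (K + \<eta>)"
          using q h by simp
        moreover have "h * ((\<phi> y - \<phi> x) / h - m * ((norm (Y y - Y x))\<^sup>2 / h\<^sup>2))
           = \<phi> y - \<phi> x - m * ((norm (Y y - Y x))\<^sup>2 / h)"
          using h by (simp add: field_simps power2_eq_square)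
        ultimately show ?thesis by (simp add: mult.commute)
      qed
      ultimately show ?thesis unfolding h_def by linarith
    qed simp
    show ?case
    proof (intro exI[of _ \<delta>] conjI allI impI \<delta>(1))
      fix x y assume xy: "x \<le> s \<and> s \<le> y \<and> y - x < \<delta>"
      show "P x y"
        unfolding P_def
      proof (intro impI)
        assume "c \<le> x" "y \<le> d"
        then have "\<phi> s - \<phi> x \<le> (K + \<eta>) * (s - x) + m * (\<Lambda> s - \<Lambda> x)"
          "\<phi> y - \<phi> s \<le> (K + \<eta>) * (y - s) + m * (\<Lambda> y - \<Lambda> s)"
          using one[of x s] one[of s y] xy s by auto
        then show "\<phi> y - \<phi> x \<le> (K + \<eta>) * (y - x) + m * (\<Lambda> y - \<Lambda> x)"
          by (simp add: algebra_simps)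
      qed
    qed
  qed
  then have "\<phi> d - \<phi> c \<le> (K + \<eta>) * (d - c) + m * (\<Lambda> d - \<Lambda> c)" by (simp add: P_def)
  moreover have "\<eta> * (d - c) \<le> \<eta>'"
    unfolding \<eta>_def using \<open>\<eta>' > 0\<close> cd by (simp add: divide_le_eq mult_left_mono)
  ultimately show "\<phi> d - \<phi> c \<le> K * (d - c) + m * (\<Lambda> d - \<Lambda> c) + \<eta>'"
    by (simp add: distrib_right)
qed

lemma young_inner:
  fixes v x :: "'h::real_inner"
  assumes "\<epsilon> > 0" shows "2 * (v \<bullet> x - \<epsilon> * (norm x)\<^sup>2) \<le> (norm v)\<^sup>2 / (2 * \<epsilon>)"
proof -
  have "0 \<le> (norm (v - (2 * \<epsilon>) *\<^sub>R x))\<^sup>2" by simp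
  also have "\<dots> = (norm v)\<^sup>2 - 4 * \<epsilon> * (v \<bullet> x) + 4 * \<epsilon>\<^sup>2 * (norm x)\<^sup>2"
    unfolding power2_norm_eq_inner
    by (simp add: inner_diff_left inner_diff_right inner_commute power2_eq_square)
  finally show ?thesis using assms by (simp add: field_simps power2_eq_square)
qed

lemma norm_add_sq_le:
  fixes v x :: "'h::real_inner"
  shows "(norm (v + x))\<^sup>2 \<le> 2 * (norm v)\<^sup>2 + 2 * (norm x)\<^sup>2"
proof -
  have "0 \<le> (norm (v - x))\<^sup>2" by simp
  then show ?thesis unfolding power2_norm_eq_inner
    by (simp add: inner_diff_left inner_diff_right inner_add_left inner_add_right inner_commute)
qed

context positive_operator
begin

lemma W_inner_W: "x \<ge> 0 \<Longrightarrow> y \<ge> 0 \<Longrightarrow> W x v \<bullet> W y w = v \<bullet> W (x + y) w"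
  by (simp add: W_inner W_add)

lemma W_inner_shift:
  assumes "x \<ge> 0" "y \<ge> 0" "x' \<ge> 0" "y' \<ge> 0" "x + y = x' + y'"
  shows "W x v \<bullet> W y w = W x' v \<bullet> W y' w"
  using assms by (simp add: W_inner_W)

lemma W_bounded_linear: "s \<ge> 0 \<Longrightarrow> bounded_linear (W s)"
  by (rule calculus_bounded_linear[OF calculus_W])

text \<open>
The energy of \<open>P x\<close>, where \<open>P = W N Q\<close>: \<open>W (N - l/2) Q\<close> is \<open>L\<^sup>l\<^sup>/\<^sup>2 P\<close>.
\<close>

definition smoothed_energy :: "real \<Rightarrow> real \<Rightarrow> real \<Rightarrow> nat \<Rightarrow> ('h \<Rightarrow> 'h) \<Rightarrow> 'h \<Rightarrow> real" where
  "smoothed_energy a p l N Q x =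
     (norm (W (real N - l / 2) (Q x)))\<^sup>2 + a * (norm (W (real N - (p + l) / 2) (Q x)))\<^sup>2"

text \<open>
The energy identity.  With \<open>v = L\<^sup>l P e\<close> the energy is \<open>z \<bullet> v\<close>, a symmetric pairing, and each term of
\<open>z' \<bullet> v\<close> is redistributed to \<open>x = L\<^sup>(\<^sup>1\<^sup>+\<^sup>l\<^sup>)\<^sup>/\<^sup>2 P e\<close>; the exponents match because \<open>\<beta> / 2 + l = (1 + l) / 2\<close>.
\<close>

lemma smoothed_energy_derivative:
  assumes Q: "calculus Q" and par: "0 \<le> p" "0 \<le> l" "l \<le> 1" "\<beta> = 1 - l" "p + 2 \<le> real N"
    and z: "((\<lambda>s. W (real N) (Q (e s)) + a *\<^sub>R W (real N - p) (Q (e s))) has_vector_derivative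
      W (real N - \<beta> / 2) (Q \<sigma>) - \<epsilon> *\<^sub>R W (real N - 1) (Q (e s)) + a *\<^sub>R D) (at s within I)"
    and e: "(e \<longlongrightarrow> e s) (at s within I)"
  defines "x \<equiv> W (real N - (1 + l) / 2) (Q (e s))"
  shows "((\<lambda>s. smoothed_energy a p l N Q (e s)) has_real_derivative
     2 * ((W (real N) (Q \<sigma>) + a *\<^sub>R W (\<beta> / 2) D) \<bullet> x - \<epsilon> * (norm x)\<^sup>2)) (at s within I)"
proof -
  define z where "z s = W (real N) (Q (e s)) + a *\<^sub>R W (real N - p) (Q (e s))" for s
  define v where "v s = W (real N - l) (Q (e s))" for s
  have v_cont: "(v \<longlongrightarrow> v s) (at s within I)"
    unfolding v_def using par
    by (intro bounded_linear.tendsto[OF W_bounded_linear] bounded_linear.tendsto[OF calculus_bounded_linear[OF Q]] e) auto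
  have zv: "z x \<bullet> v y = W (real N - l / 2) (Q (e x)) \<bullet> W (real N - l / 2) (Q (e y))
      + a * (W (real N - (p + l) / 2) (Q (e x)) \<bullet> W (real N - (p + l) / 2) (Q (e y)))" for x y
  proof -
    have 1: "W (real N) (Q (e x)) \<bullet> W (real N - l) (Q (e y)) = W (real N - l / 2) (Q (e x)) \<bullet> W (real N - l / 2) (Q (e y))"
      by (rule W_inner_shift) (use par in \<open>auto simp: field_simps\<close>)
    have 2: "W (real N - p) (Q (e x)) \<bullet> W (real N - l) (Q (e y)) = W (real N - (p + l) / 2) (Q (e x)) \<bullet> W (real N - (p + l) / 2) (Q (e y))"
      by (rule W_inner_shift) (use par in \<open>auto simp: field_simps\<close>)
    show ?thesis unfolding z_def v_def inner_add_left inner_scaleR_left 1 2 ..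
  qed
  have E: "smoothed_energy a p l N Q (e s) = z s \<bullet> v s" for s
    unfolding zv smoothed_energy_def by (simp add: power2_norm_eq_inner)
  define z' where "z' = W (real N - \<beta> / 2) (Q \<sigma>) - \<epsilon> *\<^sub>R W (real N - 1) (Q (e s)) + a *\<^sub>R D"
  have "((\<lambda>s. z s \<bullet> v s) has_real_derivative 2 * (z' \<bullet> v s)) (at s within I)"
  proof (rule symmetric_form_derivative[OF _ v_cont])
    show "(z has_vector_derivative z') (at s within I)" using z unfolding z_def[abs_def] z'_def .
    show "z x \<bullet> v s = z s \<bullet> v x" for x unfolding zv by (simp add: inner_commute)
  qed
  moreover have "z' \<bullet> v s = (W (real N) (Q \<sigma>) + a *\<^sub>R W (\<beta> / 2) D) \<bullet> x - \<epsilon> * (norm x)\<^sup>2"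
  proof -
    have 1: "W (real N - \<beta> / 2) (Q \<sigma>) \<bullet> v s = W (real N) (Q \<sigma>) \<bullet> x"
      unfolding v_def x_def by (rule W_inner_shift) (use par in \<open>auto simp: field_simps\<close>)
    have 2: "W (real N - 1) (Q (e s)) \<bullet> v s = x \<bullet> x"
      unfolding v_def x_def by (rule W_inner_shift) (use par in \<open>auto simp: field_simps\<close>)
    have 3: "D \<bullet> v s = W (\<beta> / 2) D \<bullet> x"
    proof -
      have "D \<bullet> v s = W 0 D \<bullet> W (real N - l) (Q (e s))" by (simp add: v_def W_0)
      also have "\<dots> = W (\<beta> / 2) D \<bullet> x"
        unfolding x_def by (rule W_inner_shift) (use par in \<open>auto simp: field_simps\<close>)
      finally show ?thesis .
    qed
    show ?thesis
      unfolding z'_def inner_add_left inner_diff_left inner_scaleR_left 1 2 3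
      by (simp add: power2_norm_eq_inner)
  qed
  ultimately show ?thesis unfolding E by simp
qed

text \<open>
For each \<open>n\<close> the smoothed energy grows at most by the same amount, by Young's inequality and
\<open>growth_bound\<close>.  At \<open>c\<close> the smoothed energies converge, since \<open>e c\<close> is regular, so those at \<open>d\<close> are
bounded; as \<open>a > 0\<close> this puts \<open>e d\<close> into the range of \<open>W ((p + l) / 2)\<close>, and then they converge
there as well.
\<close>

lemma energy_step:
  assumes sm: "smoothing_family N B P Q"
    and par: "0 \<le> p" "0 \<le> l" "l \<le> 1" "\<beta> = 1 - l" "p + 2 \<le> real N"
    and cd: "c \<le> d" and a: "a > 0" and \<epsilon>: "\<epsilon> > 0" and B: "B \<ge> 0"
    and e: "continuous_on {c..d} e"
    and z: "\<And>n s. s \<in> {c..d} \<Longrightarrow>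
      ((\<lambda>s. W (real N) (Q n (e s)) + a *\<^sub>R W (real N - p) (Q n (e s))) has_vector_derivative
        W (real N - \<beta> / 2) (Q n (\<sigma> s)) - \<epsilon> *\<^sub>R W (real N - 1) (Q n (e s)) + a *\<^sub>R D n s) (at s within {c..d})"
    and u: "\<And>n s. s \<in> {c..d} \<Longrightarrow>
      ((\<lambda>s. W (real N - p) (Q n (u s))) has_vector_derivative D n s) (at s within {c..d})"
    and inc: "\<And>n s s'. c \<le> s \<Longrightarrow> s \<le> s' \<Longrightarrow> s' \<le> d \<Longrightarrow>
      (norm (W (\<beta> / 2) (W (real N - p) (Q n (u s'))) - W (\<beta> / 2) (W (real N - p) (Q n (u s)))))\<^sup>2
        \<le> (s' - s) * (\<Lambda> s' - \<Lambda> s)"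
    and \<sigma>: "\<And>s. s \<in> {c..d} \<Longrightarrow> (norm (\<sigma> s))\<^sup>2 \<le> \<kappa>"
    and init: "e c = W ((p + l) / 2) x0"
  obtains x1 where "e d = W ((p + l) / 2) x1"
    "(norm (W (p / 2) x1))\<^sup>2 + a * (norm x1)\<^sup>2
      \<le> (norm (W (p / 2) x0))\<^sup>2 + a * (norm x0)\<^sup>2 + (B\<^sup>2 * \<kappa> * (d - c) + a\<^sup>2 * (\<Lambda> d - \<Lambda> c)) / \<epsilon>"
proof -
  have Q: "calculus (Q n)" and P: "calculus (P n)" and PW: "P n x = W (real N) (Q n x)"
    and PB: "norm (P n x) \<le> B * norm x" and Plim: "(\<lambda>n. P n x) \<longlonglongrightarrow> x" for n x
    using sm by (auto simp: smoothing_family_def)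
  define R where "R = (B\<^sup>2 * \<kappa> * (d - c) + a\<^sup>2 * (\<Lambda> d - \<Lambda> c)) / \<epsilon>"
  define \<phi> where "\<phi> n x = smoothed_energy a p l N (Q n) x" for n x
  have b: "\<beta> / 2 \<ge> 0" using par by simp
  have step: "\<phi> n (e d) - \<phi> n (e c) \<le> R" for n
  proof -
    define v where "v s = W (real N) (Q n (\<sigma> s)) + a *\<^sub>R W (\<beta> / 2) (D n s)" for s
    define x where "x s = W (real N - (1 + l) / 2) (Q n (e s))" for s
    have "\<phi> n (e d) - \<phi> n (e c) \<le> (B\<^sup>2 * \<kappa> / \<epsilon>) * (d - c) + (a\<^sup>2 / \<epsilon>) * (\<Lambda> d - \<Lambda> c)"
    proof (rule growth_bound[OF cd, where Y = "\<lambda>s. W (\<beta> / 2) (W (real N - p) (Q n (u s)))"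
          and Y' = "\<lambda>s. W (\<beta> / 2) (D n s)"
          and \<phi>' = "\<lambda>s. 2 * (v s \<bullet> x s - \<epsilon> * (norm (x s))\<^sup>2)"])
      show "a\<^sup>2 / \<epsilon> \<ge> 0" using \<epsilon> by simp
      fix s assume s: "s \<in> {c..d}"
      have "(e \<longlongrightarrow> e s) (at s within {c..d})" using e s by (simp add: continuous_on_def)
      from smoothed_energy_derivative[OF Q par z[OF s] this]
      show "((\<lambda>s. \<phi> n (e s)) has_real_derivative 2 * (v s \<bullet> x s - \<epsilon> * (norm (x s))\<^sup>2)) (at s within {c..d})"
        unfolding \<phi>_def v_def x_def .
      show "((\<lambda>s. W (\<beta> / 2) (W (real N - p) (Q n (u s)))) has_vector_derivative W (\<beta> / 2) (D n s)) (at s within {c..d})"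
        by (rule bounded_linear.has_vector_derivative[OF W_bounded_linear[OF b] u[OF s]])
      show "2 * (v s \<bullet> x s - \<epsilon> * (norm (x s))\<^sup>2) \<le> B\<^sup>2 * \<kappa> / \<epsilon> + a\<^sup>2 / \<epsilon> * (norm (W (\<beta> / 2) (D n s)))\<^sup>2"
      proof -
        have "(norm (W (real N) (Q n (\<sigma> s))))\<^sup>2 \<le> (B * norm (\<sigma> s))\<^sup>2"
          using PB[of n "\<sigma> s"] by (intro power_mono) (simp_all add: PW)
        also have "\<dots> \<le> B\<^sup>2 * \<kappa>" using \<sigma>[OF s] by (simp add: power_mult_distrib mult_left_mono)
        finally have s1: "(norm (W (real N) (Q n (\<sigma> s))))\<^sup>2 \<le> B\<^sup>2 * \<kappa>" .
        have "(norm (v s))\<^sup>2 \<le> 2 * (norm (W (real N) (Q n (\<sigma> s))))\<^sup>2 + 2 * (norm (a *\<^sub>R W (\<beta> / 2) (D n s)))\<^sup>2"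
          unfolding v_def by (rule norm_add_sq_le)
        also have "\<dots> \<le> 2 * (B\<^sup>2 * \<kappa>) + 2 * (a\<^sup>2 * (norm (W (\<beta> / 2) (D n s)))\<^sup>2)"
          using s1 by (simp add: power_mult_distrib)
        finally have "(norm (v s))\<^sup>2 / (2 * \<epsilon>) \<le> (2 * (B\<^sup>2 * \<kappa>) + 2 * (a\<^sup>2 * (norm (W (\<beta> / 2) (D n s)))\<^sup>2)) / (2 * \<epsilon>)"
          using \<epsilon> by (intro divide_right_mono) auto
        also have "\<dots> = B\<^sup>2 * \<kappa> / \<epsilon> + a\<^sup>2 / \<epsilon> * (norm (W (\<beta> / 2) (D n s)))\<^sup>2"
          using \<epsilon> by (simp add: field_simps)
        finally show ?thesis using young_inner[OF \<epsilon>, of "v s" "x s"] by linarith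
      qed
    qed (rule inc)
    also have "\<dots> = R" by (simp add: R_def add_divide_distrib)
    finally show ?thesis .
  qed
  \<comment> \<open>On a regular vector the smoothed energy is the energy of the smoothed vector.\<close>
  have split1: "W (real N - l / 2) (Q n (W ((p + l) / 2) x)) = P n (W (p / 2) x)" for n x
  proof -
    have "W ((p + l) / 2) x = W (l / 2) (W (p / 2) x)"
      using W_add[of "l / 2" "p / 2" x] par by (simp add: add_divide_distrib add.commute)
    moreover have "Q n (W (l / 2) (W (p / 2) x)) = W (l / 2) (Q n (W (p / 2) x))"
      by (rule W_commute[OF _ Q]) (use par in simp)
    ultimately have "W (real N - l / 2) (Q n (W ((p + l) / 2) x))
        = W (real N - l / 2) (W (l / 2) (Q n (W (p / 2) x)))" by simp
    then show ?thesis using W_add[of "real N - l / 2" "l / 2"] par by (simp add: PW)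
  qed
  have split2: "W (real N - (p + l) / 2) (Q n (W ((p + l) / 2) x)) = P n x" for n x
    using W_add[of "real N - (p + l) / 2" "(p + l) / 2"] par by (simp add: W_commute[OF _ Q] PW)
  have lim: "(\<lambda>n. \<phi> n (W ((p + l) / 2) x)) \<longlonglongrightarrow> (norm (W (p / 2) x))\<^sup>2 + a * (norm x)\<^sup>2" for x
    unfolding \<phi>_def smoothed_energy_def split1 split2 by (intro tendsto_intros Plim)
  define y where "y n = W (real N - (p + l) / 2) (Q n (e d))" for n
  have "Bseq (\<lambda>n. \<phi> n (e c))" using lim[of x0] by (simp add: init convergentI convergent_imp_Bseq)
  then obtain C where C: "\<And>n. \<bar>\<phi> n (e c)\<bar> \<le> C" by (auto simp: Bseq_def)
  have "(norm (y n))\<^sup>2 \<le> (C + R) / a" for n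
  proof -
    have "a * (norm (y n))\<^sup>2 \<le> \<phi> n (e d)" by (simp add: \<phi>_def smoothed_energy_def y_def)
    also have "\<dots> \<le> C + R" using step[of n] C[of n] by linarith
    finally show ?thesis using a by (simp add: field_simps)
  qed
  then have ybd: "norm (y n) \<le> sqrt ((C + R) / a)" for n by (simp add: real_le_rsqrt)
  have "W ((p + l) / 2) (y n) = P n (e d)" for n
    unfolding y_def PW using W_add[of "(p + l) / 2" "real N - (p + l) / 2"] par by simp
  then have "(\<lambda>n. W ((p + l) / 2) (y n)) \<longlonglongrightarrow> e d" using Plim[of "e d"] by simp
  then have "e d \<in> range (W ((p + l) / 2))"
    by (intro in_range_W_if_bounded[OF _ ybd]) (use par in auto)
  then obtain x1 where x1: "e d = W ((p + l) / 2) x1" by blast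
  have "(norm (W (p / 2) x1))\<^sup>2 + a * (norm x1)\<^sup>2 - ((norm (W (p / 2) x0))\<^sup>2 + a * (norm x0)\<^sup>2) \<le> R"
  proof (rule LIMSEQ_le_const2)
    show "(\<lambda>n. \<phi> n (e d) - \<phi> n (e c)) \<longlonglongrightarrow>
      (norm (W (p / 2) x1))\<^sup>2 + a * (norm x1)\<^sup>2 - ((norm (W (p / 2) x0))\<^sup>2 + a * (norm x0)\<^sup>2)"
      unfolding x1 init by (intro tendsto_diff lim)
    show "\<exists>N. \<forall>n\<ge>N. \<phi> n (e d) - \<phi> n (e c) \<le> R" using step by blast
  qed
  then show ?thesis using that[OF x1] by (simp add: R_def)
qed

end

section \<open>The error of the scheme\<close>

locale semilinear_problem = operator_graph G
  for G :: "('h::{real_inner,banach} \<times> 'h) set" +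
  fixes F :: "'h \<Rightarrow> 'h \<Rightarrow> real" and u :: "real \<Rightarrow> 'h"
    and k :: nat and \<epsilon> T \<beta> \<gamma> lam CL A p :: real
  assumes \<epsilon>: "\<epsilon> > 0" and T: "T > 0" and \<beta>: "\<beta> \<ge> 0" and \<gamma>: "\<gamma> \<ge> 0" and CL: "CL > 0"
    and lip: "lipschitz_V G \<beta> \<gamma> CL F"
    and k: "k \<ge> 1" and A: "A > 0" and p: "p \<ge> 0"
    and lam: "lam = 1 - \<beta>" and \<beta>\<gamma>: "\<beta> + \<gamma> \<le> 1"
    and exact: "exact_solution G \<gamma> F \<epsilon> T u"
    and F_regular: "H_time_V_dual G \<beta> k 0 T (\<lambda>t. F (u t))"
    and u_regular: "H_time_V G (2 * p - \<beta>) 1 0 T u"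
begin

lemma lam_bounds: "0 \<le> lam" "lam \<le> 1" "\<beta> = 1 - lam" "\<gamma> \<le> lam"
  using lam \<beta> \<gamma> \<beta>\<gamma> by auto

text \<open>
\<open>F (u t)\<close> as an element of \<open>H\<close>, through the isometry \<open>V\<^sup>-\<^sup>\<beta> \<cong> H\<close>.
\<close>

definition forcing :: "real \<Rightarrow> 'h" where "forcing t = dual_op_pow G \<beta> (F (u t))"

lemma continuous_on_W: "s \<ge> 0 \<Longrightarrow> continuous_on I g \<Longrightarrow> continuous_on I (\<lambda>t. W s (g t))"
  by (rule bounded_linear.continuous_on[OF W_bounded_linear])

lemma continuous_on_calculus: "calculus R \<Longrightarrow> continuous_on I g \<Longrightarrow> continuous_on I (\<lambda>t. R (g t))"
  by (rule bounded_linear.continuous_on[OF calculus_bounded_linear])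

lemma u_V: "t \<in> {0..T} \<Longrightarrow> u t \<in> V_space G \<gamma>"
  using exact by (simp add: exact_solution_def)

lemma continuous_in_H:
  assumes "\<And>s. s \<in> I \<Longrightarrow> v s \<in> V_space G \<gamma>" "continuous_on I (\<lambda>s. op_pow G (\<gamma> / 2) (v s))"
  shows "continuous_on I v"
proof (rule continuous_on_eq)
  show "continuous_on I (\<lambda>s. W (\<gamma> / 2) (op_pow G (\<gamma> / 2) (v s)))"
    by (rule continuous_on_W) (use \<gamma> assms in auto)
  show "W (\<gamma> / 2) (op_pow G (\<gamma> / 2) (v s)) = v s" if "s \<in> I" for s
    by (rule W_op_pow[OF \<gamma> assms(1)[OF that]])
qed

lemma continuous_u: "continuous_on {0..T} u"
  by (rule continuous_in_H[OF u_V]) (use exact in \<open>auto simp: exact_solution_def\<close>)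

lemma continuous_forcing: "continuous_on {0..T} forcing"
  unfolding continuous_on_def
proof
  fix s assume s: "s \<in> {0..T}"
  let ?g = "\<lambda>t. op_pow G (\<gamma> / 2) (u t)"
  have g: "(?g \<longlongrightarrow> ?g s) (at s within {0..T})"
    using exact s unfolding exact_solution_def continuous_on_def by blast
  show "(forcing \<longlongrightarrow> forcing s) (at s within {0..T})"
  proof (rule LIM_zero_cancel, rule Lim_null_comparison)
    show "\<forall>\<^sub>F t in at s within {0..T}. norm (forcing t - forcing s) \<le> CL * norm (?g t - ?g s)"
    proof (simp only: eventually_at_topological, intro exI[of _ UNIV] conjI ballI impI)
      fix t assume t: "t \<in> {0..T}"
      have "norm (forcing t - forcing s) \<le> CL * V_norm G \<gamma> (u t - u s)"
        unfolding forcing_def by (rule lipschitz_dual_op_pow[OF \<beta> lip u_V[OF t] u_V[OF s]])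
      then show "norm (forcing t - forcing s) \<le> CL * norm (?g t - ?g s)"
        by (simp add: V_norm_def V_space_diff[OF \<gamma> u_V[OF t] u_V[OF s]])
    qed auto
    show "((\<lambda>t. CL * norm (?g t - ?g s)) \<longlongrightarrow> 0) (at s within {0..T})"
      by (intro tendsto_mult_right_zero tendsto_norm_zero LIM_zero g)
  qed
qed

lemma inner_W_calculus: "s \<ge> 0 \<Longrightarrow> calculus R \<Longrightarrow> x \<bullet> W s (R w) = W s (R x) \<bullet> w"
  by (metis W_commute W_inner calculus_inner)

lemma F_tested:
  assumes x: "x \<in> V_space G \<gamma>" and s: "\<beta> / 2 \<le> s" and R: "calculus R"
  shows "F x (W s (R w)) = W (s - \<beta> / 2) (R (dual_op_pow G \<beta> (F x))) \<bullet> w"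
proof -
  have "F x \<in> V_dual G \<beta>" using lip x by (auto simp: lipschitz_V_def)
  from dual_op_pow_W[OF \<beta> this, of "W (s - \<beta> / 2) (R w)"] show ?thesis
    using W_add[of "\<beta> / 2" "s - \<beta> / 2" "R w"] s \<beta> by (simp add: inner_W_calculus[OF _ R])
qed

text \<open>
\<open>W 1 (R u)\<close> is \<open>u\<close> smoothed by an operator with values in the domain of \<open>L\<close>.  Its derivative is the
equation for \<open>u\<close>, with the powers of \<open>L\<close> absorbed by \<open>W\<close>.
\<close>

lemma exact_smoothed:
  assumes R: "calculus R" and t: "t \<in> {0..T}"
  shows "((\<lambda>t. W 1 (R (u t))) has_vector_derivative W (1 - \<beta> / 2) (R (forcing t)) - \<epsilon> *\<^sub>R R (u t))
    (at t within {0..T})"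
proof (rule vector_derivative_if_tested[OF _ _ t])
  show "continuous_on {0..T} (\<lambda>t. W (1 - \<beta> / 2) (R (forcing t)) - \<epsilon> *\<^sub>R R (u t))"
    by (intro continuous_intros continuous_on_W continuous_on_calculus[OF R] continuous_forcing continuous_u)
       (use lam_bounds in simp)
  fix w s assume s: "s \<in> {0..T}"
  have v: "W 1 (R w) \<in> V_space G 2" by (rule W_in_V_space) auto
  have "((\<lambda>s. u s \<bullet> W 1 (R w)) has_real_derivative
      (F (u s) (W 1 (R w)) - \<epsilon> * (u s \<bullet> op_pow G 1 (W 1 (R w))))) (at s within {0..T})"
    using exact v s unfolding exact_solution_def by blast
  moreover have "F (u s) (W 1 (R w)) = W (1 - \<beta> / 2) (R (forcing s)) \<bullet> w"
    unfolding forcing_def by (rule F_tested[OF u_V[OF s] _ R]) (use lam_bounds in simp)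
  moreover have "u s \<bullet> op_pow G 1 (W 1 (R w)) = R (u s) \<bullet> w"
    by (simp add: op_pow_W calculus_inner[OF R])
  ultimately show "((\<lambda>t. W 1 (R (u t)) \<bullet> w) has_real_derivative
      (W (1 - \<beta> / 2) (R (forcing s)) - \<epsilon> *\<^sub>R R (u s)) \<bullet> w) (at s within {0..T})"
    by (simp add: inner_W_calculus[OF _ R] inner_diff_left)
qed

lemma continuous_on_lagrange_basis: "continuous_on I (\<lambda>s. lagrange_basis t m n i (s - c))"
  unfolding lagrange_basis_def divide_inverse by (intro continuous_intros)

text \<open>
The scheme tested with \<open>W N (Q w)\<close>, which lies in every \<open>V\<close> space that occurs.
\<close>

lemma scheme_smoothed:
  assumes sch: "scheme_solution G \<gamma> F \<epsilon> A p k t U" and n: "k - 1 \<le> n"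
    and V: "\<And>i. i < k \<Longrightarrow> U (n - i) (t (n - i)) \<in> V_space G \<gamma>"
    and Q: "calculus Q" and N: "p + 2 \<le> real N" and s: "s \<in> {t n..t (Suc n)}"
  shows "((\<lambda>s. W (real N) (Q (U (Suc n) s)) + (A * max_step t ^ k) *\<^sub>R W (real N - p) (Q (U (Suc n) s)))
    has_vector_derivative
      W (real N - \<beta> / 2) (Q (\<Sum>i<k. lagrange_basis t k n i (s - t n) *\<^sub>R dual_op_pow G \<beta> (F (U (n - i) (t (n - i))))))
      - \<epsilon> *\<^sub>R W (real N - 1) (Q (U (Suc n) s))) (at s within {t n..t (Suc n)})"
proof (rule vector_derivative_if_tested[OF _ _ s])
  let ?I = "{t n..t (Suc n)}"
  let ?\<phi> = "\<lambda>i. dual_op_pow G \<beta> (F (U (n - i) (t (n - i))))"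
  have cU: "continuous_on ?I (U (Suc n))"
    by (rule continuous_in_H) (use sch n in \<open>auto simp: scheme_solution_def\<close>)
  have b: "real N - \<beta> / 2 \<ge> 0" "real N - 1 \<ge> 0" "real N - p \<ge> 0" "\<beta> / 2 \<le> real N"
    using N p lam_bounds by auto
  show "continuous_on ?I (\<lambda>s. W (real N - \<beta> / 2) (Q (\<Sum>i<k. lagrange_basis t k n i (s - t n) *\<^sub>R ?\<phi> i))
      - \<epsilon> *\<^sub>R W (real N - 1) (Q (U (Suc n) s)))"
    by (intro continuous_intros continuous_on_W continuous_on_calculus[OF Q] cU
        continuous_on_lagrange_basis b)
  fix w s assume s: "s \<in> ?I"
  let ?v = "W (real N) (Q w)"
  have v: "?v \<in> V_space G 2 \<inter> V_space G (2 * p)"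
    using N p by (auto intro!: W_in_V_space)
  have "((\<lambda>r. U (Suc n) r \<bullet> ?v + A * max_step t ^ k * (U (Suc n) r \<bullet> op_pow G p ?v))
              has_real_derivative
                ((\<Sum>i = 0..k - 1. lagrange_basis t k n i (s - t n) * F (U (n - i) (t (n - i))) ?v)
                 - \<epsilon> * (U (Suc n) s \<bullet> op_pow G 1 ?v)))
             (at s within ?I)"
    using sch n v s unfolding scheme_solution_def by blast
  moreover have "x \<bullet> ?v = W (real N) (Q x) \<bullet> w" for x by (rule inner_W_calculus[OF _ Q]) simp
  moreover have "x \<bullet> op_pow G p ?v = W (real N - p) (Q x) \<bullet> w" for x
    using N p by (simp add: op_pow_W_ge inner_W_calculus[OF _ Q])
  moreover have "x \<bullet> op_pow G 1 ?v = W (real N - 1) (Q x) \<bullet> w" for x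
    using N p by (simp add: op_pow_W_ge inner_W_calculus[OF _ Q])
  moreover have "(\<Sum>i = 0..k - 1. lagrange_basis t k n i (s - t n) * F (U (n - i) (t (n - i))) ?v)
      = W (real N - \<beta> / 2) (Q (\<Sum>i<k. lagrange_basis t k n i (s - t n) *\<^sub>R ?\<phi> i)) \<bullet> w"
  proof -
    have ix: "{0..k - 1} = {..<k}" using k by auto
    have lin: "linear (\<lambda>x. W (real N - \<beta> / 2) (Q x))"
      using linear_compose[OF bounded_linear.linear[OF calculus_bounded_linear[OF Q]] W_linear[OF b(1)]]
      by (simp add: o_def)
    have "W (real N - \<beta> / 2) (Q (\<Sum>i<k. lagrange_basis t k n i (s - t n) *\<^sub>R ?\<phi> i)) \<bullet> w
      = (\<Sum>i<k. lagrange_basis t k n i (s - t n) * (W (real N - \<beta> / 2) (Q (?\<phi> i)) \<bullet> w))"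
      unfolding linear_sum[OF lin] linear_scale[OF lin] by (simp add: inner_sum_left)
    also have "\<dots> = (\<Sum>i<k. lagrange_basis t k n i (s - t n) * F (U (n - i) (t (n - i))) ?v)"
      by (intro sum.cong refl) (use F_tested[OF V b(4) Q] in simp)
    finally show ?thesis unfolding ix ..
  qed
  ultimately show "((\<lambda>s. (W (real N) (Q (U (Suc n) s)) + (A * max_step t ^ k) *\<^sub>R W (real N - p) (Q (U (Suc n) s))) \<bullet> w)
    has_real_derivative
      (W (real N - \<beta> / 2) (Q (\<Sum>i<k. lagrange_basis t k n i (s - t n) *\<^sub>R ?\<phi> i))
      - \<epsilon> *\<^sub>R W (real N - 1) (Q (U (Suc n) s))) \<bullet> w) (at s within ?I)"
    by (simp add: inner_diff_left inner_add_left)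
qed

text \<open>
The function differentiated is \<open>L\<^sup>p\<^sup>-\<^sup>\<beta>\<^sup>/\<^sup>2 P u\<close>.  It is continuous and agrees almost everywhere with
\<open>P g\<close>, where \<open>g\<close> represents \<open>u\<close> in the space of index \<open>2 p - \<beta>\<close>, so its increments are integrals of
\<open>P g'\<close>, in the weak sense; the Cauchy-Schwarz inequality in time gives the square.
\<close>

lemma regularization_increment:
  obtains g' :: "real \<Rightarrow> 'h" where "L2_time 0 T g'"
    "\<And>B N Q s s'. \<lbrakk>calculus Q; p + 2 \<le> real N; B \<ge> 0; \<And>x. norm (W (real N) (Q x)) \<le> B * norm x;
        0 \<le> s; s \<le> s'; s' \<le> T\<rbrakk> \<Longrightarrow>
      (norm (W (\<beta> / 2) (W (real N - p) (Q (u s'))) - W (\<beta> / 2) (W (real N - p) (Q (u s)))))\<^sup>2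
        \<le> (s' - s) * (B\<^sup>2 * integral {s..s'} (\<lambda>t. (norm (g' t))\<^sup>2))"
proof -
  define a where "a = 2 * p - \<beta>"
  define g where "g t = op_pow G (a / 2) (u t)" for t
  have H: "H_time 1 0 T g" and ae: "AE t in lebesgue_on {0..T}. u t \<in> V_space G a"
    using u_regular by (auto simp: H_time_V_def g_def[abs_def] a_def)
  obtain g' where g: "L2_time 0 T g" "weak_time_derivative 0 T g g'" "L2_time 0 T g'"
    using H by auto
  have "AE t in lebesgue. t \<in> {0..T} \<longrightarrow> u t \<in> V_space G a"
    using ae by (simp add: AE_restrict_space_iff)
  then obtain N0 where N0: "N0 \<in> null_sets lebesgue" "{t. \<not> (t \<in> {0..T} \<longrightarrow> u t \<in> V_space G a)} \<subseteq> N0"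
    unfolding eventually_ae_filter by auto
  have neg: "negligible N0" using N0(1) by (simp add: negligible_iff_null_sets)
  note ai = L2_time_real_absolutely_integrable[OF L2_time_inner]
  have main: "(norm (W (\<beta> / 2) (W (real N - p) (Q (u s'))) - W (\<beta> / 2) (W (real N - p) (Q (u s)))))\<^sup>2
        \<le> (s' - s) * (B\<^sup>2 * integral {s..s'} (\<lambda>t. (norm (g' t))\<^sup>2))"
    if Q: "calculus Q" and N: "p + 2 \<le> real N" and B: "B \<ge> 0"
      and QB: "\<And>x. norm (W (real N) (Q x)) \<le> B * norm x" and s: "0 \<le> s" "s \<le> s'" "s' \<le> T"
    for B N Q s s'
  proof -
    have b: "\<beta> / 2 \<ge> 0" "real N - p \<ge> 0" using \<beta> N by auto
    define Y where "Y t = W (\<beta> / 2) (W (real N - p) (Q (u t)))" for t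
    define P where "P x = W (real N) (Q x)" for x
    have P: "calculus P" unfolding P_def by (rule calculus_compose[OF calculus_W Q]) simp
    \<comment> \<open>The index \<open>a\<close> may be negative; then \<open>g = W (- a / 2) u\<close> rather than \<open>u = W (a / 2) g\<close>.\<close>
    have PY: "P (g t) = Y t" if t: "t \<in> {0..T} - N0" for t
    proof -
      have Vt: "u t \<in> V_space G a" using N0(2) t by auto
      have Y: "Y t = W (real N - a / 2) (Q (u t))"
        using W_add[OF b] by (simp add: Y_def a_def field_simps)
      show ?thesis
      proof (cases "a \<ge> 0")
        case True
        have "u t = W (a / 2) (g t)" unfolding g_def using W_op_pow[OF True Vt] by simp
        then have "Y t = W (real N - a / 2) (W (a / 2) (Q (g t)))"
          using True by (simp add: Y W_commute[OF _ Q])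
        then show ?thesis using W_add[of "real N - a / 2" "a / 2"] True N \<beta> by (simp add: P_def a_def)
      next
        case False
        then have "g t = W (- a / 2) (u t)" unfolding g_def by (simp add: op_pow_neg)
        then have "P (g t) = W (real N) (W (- a / 2) (Q (u t)))"
          using False by (simp add: P_def W_commute[OF _ Q])
        then show ?thesis using W_add[of "real N" "- a / 2"] False by (simp add: Y)
      qed
    qed
    have Yc: "continuous_on {0..T} Y"
      unfolding Y_def by (intro continuous_on_W b continuous_on_calculus[OF Q] continuous_u)
    have sub: "{s..s'} \<subseteq> {0..T}" using s by auto
    have ni: "(\<lambda>t. norm (g' t)) integrable_on {s..s'}"
      using absolutely_integrable_on_subinterval[OF L2_time_real_absolutely_integrable[OF L2_time_norm[OF g(3)]] sub]
      by (auto simp: absolutely_integrable_on_def)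
    define J where "J = integral {s..s'} (\<lambda>t. norm (g' t))"
    have J0: "0 \<le> J" unfolding J_def by (rule Henstock_Kurzweil_Integration.integral_nonneg[OF ni]) simp
    define w where "w = Y s' - Y s"
    have "Y s' \<bullet> w - Y s \<bullet> w = integral {s..s'} (\<lambda>t. g' t \<bullet> P w)"
    proof (rule weak_derivative_continuous_representative[OF weak_time_derivative_inner[OF g(2), of "P w"] T
          ai[OF g(1)] ai[OF g(3)] _ neg _ s])
      show "continuous_on {0..T} (\<lambda>t. Y t \<bullet> w)" by (intro continuous_intros Yc)
      show "g t \<bullet> P w = Y t \<bullet> w" if "t \<in> {0..T} - N0" for t
        using PY[OF that] calculus_inner[OF P, of "g t" w] by simp
    qed
    also have "\<dots> \<le> integral {s..s'} (\<lambda>t. (B * norm w) * norm (g' t))"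
    proof (rule integral_le)
      show "(\<lambda>t. g' t \<bullet> P w) integrable_on {s..s'}"
        using absolutely_integrable_on_subinterval[OF ai[OF g(3)] sub]
        by (auto simp: absolutely_integrable_on_def)
      show "(\<lambda>t. (B * norm w) * norm (g' t)) integrable_on {s..s'}" by (rule integrable_on_mult_right[OF ni])
      show "g' t \<bullet> P w \<le> (B * norm w) * norm (g' t)" for t
      proof -
        have "g' t \<bullet> P w \<le> norm (g' t) * norm (P w)" by (rule norm_cauchy_schwarz)
        also have "\<dots> \<le> norm (g' t) * (B * norm w)" using QB[of w] by (intro mult_left_mono) (auto simp: P_def)
        finally show ?thesis by (simp add: mult.commute)
      qed
    qed
    also have "\<dots> = B * norm w * J" by (simp add: J_def)
    finally have "norm w * norm w \<le> B * J * norm w"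
      by (simp add: w_def inner_diff_left[symmetric] dot_square_norm power2_eq_square mult_ac)
    then have "norm w \<le> B * J" using B J0 by (cases "w = 0") auto
    then have "(norm w)\<^sup>2 \<le> (B * J)\<^sup>2" by (intro power_mono) auto
    also have "\<dots> = B\<^sup>2 * J\<^sup>2" by (simp add: power_mult_distrib)
    also have "\<dots> \<le> B\<^sup>2 * ((s' - s) * integral {s..s'} (\<lambda>t. (norm (g' t))\<^sup>2))"
      unfolding J_def by (intro mult_left_mono square_integral_norm_le[OF g(3)] s) auto
    finally show ?thesis by (simp add: w_def Y_def mult_ac)
  qed
  show ?thesis by (rule that[OF g(3) main])
qed

lemma V_norms_W:
  "V_norm G lam (W ((p + lam) / 2) y) = norm (W (p / 2) y)"
  "V_norm G (p + lam) (W ((p + lam) / 2) y) = norm y"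
proof -
  have eq: "(p + lam) / 2 - lam / 2 = p / 2" by (simp add: add_divide_distrib)
  have "V_norm G lam (W ((p + lam) / 2) y) = norm (W ((p + lam) / 2 - lam / 2) y)"
    by (rule V_norm_W) (use p lam_bounds in auto)
  then show "V_norm G lam (W ((p + lam) / 2) y) = norm (W (p / 2) y)" unfolding eq .
  show "V_norm G (p + lam) (W ((p + lam) / 2) y) = norm y"
    using V_norm_W[of "p + lam" "(p + lam) / 2" y] p lam_bounds by (simp add: W_0)
qed

lemma V_space_W: "V_space G (p + lam) = range (W ((p + lam) / 2))"
  using p lam_bounds by (intro V_space_eq) simp

definition error :: "(nat \<Rightarrow> real) \<Rightarrow> (nat \<Rightarrow> real \<Rightarrow> 'h) \<Rightarrow> nat \<Rightarrow> 'h" where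
  "error t U n = u (t n) - U n (t n)"

definition error_energy :: "(nat \<Rightarrow> real) \<Rightarrow> (nat \<Rightarrow> real \<Rightarrow> 'h) \<Rightarrow> nat \<Rightarrow> real" where
  "error_energy t U n = (V_norm G lam (error t U n))\<^sup>2
     + A * max_step t ^ k * (V_norm G (p + lam) (error t U n))\<^sup>2"

text \<open>
\<open>\<gamma> \<le> \<lambda>\<close>, and \<open>L\<^sup>-\<^sup>(\<^sup>\<lambda>\<^sup>-\<^sup>\<gamma>\<^sup>)\<^sup>/\<^sup>2\<close> is bounded: the energy controls the norm in the Lipschitz condition.
\<close>

lemma V_norm_\<gamma>_le:
  obtains c where "c \<ge> 0" "\<And>x. x \<in> V_space G (p + lam) \<Longrightarrow> x \<in> V_space G \<gamma> \<and> V_norm G \<gamma> x \<le> c * V_norm G lam x"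
proof -
  obtain c where c: "c \<ge> 0" "\<And>x. norm (W ((lam - \<gamma>) / 2) x) \<le> norm x * c"
    using bounded_linear.nonneg_bounded[OF W_bounded_linear[of "(lam - \<gamma>) / 2"]] lam_bounds by auto
  show ?thesis
  proof (rule that[OF c(1)])
    fix x assume "x \<in> V_space G (p + lam)"
    then obtain y where y: "x = W ((p + lam) / 2) y" "V_norm G lam x = norm (W (p / 2) y)"
      using V_space_W V_norms_W by auto
    have "(lam - \<gamma>) / 2 + p / 2 = (p + lam) / 2 - \<gamma> / 2"
      by (simp add: add_divide_distrib diff_divide_distrib)
    then have "W ((lam - \<gamma>) / 2) (W (p / 2) y) = W ((p + lam) / 2 - \<gamma> / 2) y"
      using W_add[of "(lam - \<gamma>) / 2" "p / 2" y] lam_bounds p by simp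
    moreover have "V_norm G \<gamma> x = norm (W ((p + lam) / 2 - \<gamma> / 2) y)"
      unfolding y(1) by (rule V_norm_W) (use \<gamma> lam_bounds p in auto)
    moreover have "x \<in> V_space G \<gamma>" unfolding y(1) by (rule W_in_V_space) (use \<gamma> lam_bounds p in auto)
    ultimately show "x \<in> V_space G \<gamma> \<and> V_norm G \<gamma> x \<le> c * V_norm G lam x"
      using c(2)[of "W (p / 2) y"] y(2) by (simp add: mult.commute)
  qed
qed

text \<open>
Cut off at \<open>T\<close>, since the functions are known to be square integrable on \<open>[0, T]\<close> only, while the grid
goes on beyond \<open>T\<close>.
\<close>

definition sq_integral :: "(real \<Rightarrow> 'h) \<Rightarrow> real \<Rightarrow> real" where
  "sq_integral h s = integral {0..min s T} (\<lambda>t. (norm (h t))\<^sup>2)"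

lemma sq_integral:
  assumes "L2_time 0 T h"
  shows "0 \<le> sq_integral h s" "s \<le> s' \<Longrightarrow> sq_integral h s \<le> sq_integral h s'"
    "0 \<le> s \<Longrightarrow> s \<le> s' \<Longrightarrow> s' \<le> T \<Longrightarrow> integral {s..s'} (\<lambda>t. (norm (h t))\<^sup>2) = sq_integral h s' - sq_integral h s"
proof -
  have i: "(\<lambda>t. (norm (h t))\<^sup>2) integrable_on {0..min s T}" for s
    by (rule integrable_on_subinterval[of _ "{0..T}"]) (use assms in \<open>auto simp: L2_time_def\<close>)
  show "0 \<le> sq_integral h s"
    unfolding sq_integral_def by (rule Henstock_Kurzweil_Integration.integral_nonneg[OF i]) simp
  show "sq_integral h s \<le> sq_integral h s'" if "s \<le> s'"
    unfolding sq_integral_def by (rule integral_subset_le[OF _ i i]) (use that in auto)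
  show "integral {s..s'} (\<lambda>t. (norm (h t))\<^sup>2) = sq_integral h s' - sq_integral h s"
    if "0 \<le> s" "s \<le> s'" "s' \<le> T"
    using Henstock_Kurzweil_Integration.integral_combine[OF that(1,2), of "\<lambda>t. (norm (h t))\<^sup>2"] i[of s'] that
    by (simp add: sq_integral_def min_def)
qed

lemma error_energy_eq:
  assumes "error t U n = W ((p + lam) / 2) y"
  shows "error_energy t U n = (norm (W (p / 2) y))\<^sup>2 + A * max_step t ^ k * (norm y)\<^sup>2"
  by (simp add: error_energy_def assms V_norms_W)

text \<open>
The estimate of one step, in terms of the \<open>k\<close> preceding energies.  \<open>\<Theta>\<close> is a combination of the square
integrals of the \<open>k\<close>-th derivative of the forcing and of the derivative of \<open>u\<close>; its increment is taken
over the whole interpolation window \<open>[t (n + 1 - k), t (n + 1)]\<close>.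
\<close>

lemma error_recursion:
  obtains C :: real and \<Theta> :: "real \<Rightarrow> real" where "C \<ge> 0" "\<And>s s'. s \<le> s' \<Longrightarrow> \<Theta> s \<le> \<Theta> s'" "\<And>s. 0 \<le> \<Theta> s"
    "\<And>t U n. \<lbrakk>time_grid t; step_ratio_bounded k r t; scheme_solution G \<gamma> F \<epsilon> A p k t U;
       k - 1 \<le> n; t (Suc n) \<le> T; \<And>i. i < k \<Longrightarrow> error t U (n - i) \<in> V_space G (p + lam)\<rbrakk> \<Longrightarrow>
       error t U (Suc n) \<in> V_space G (p + lam) \<and>
       error_energy t U (Suc n) \<le> error_energy t U n
         + C * (t (Suc n) - t n) * (\<Sum>i<k. error_energy t U (n - i))
         + max_step t ^ (2 * k) * (\<Theta> (t (Suc n)) - \<Theta> (t (n + 1 - k)))"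
proof -
  \<comment> \<open>Large enough for all exponents below: \<open>p + 1\<close> for the derivative of \<open>L\<^sup>p P u\<close>, and \<open>(p + \<lambda>) / 2\<close>.\<close>
  define N where "N = nat \<lceil>p + 2\<rceil>"
  have N: "p + 2 \<le> real N" unfolding N_def by (rule real_nat_ceiling_ge)
  obtain B P Q where B: "B \<ge> 0" and sm: "smoothing_family N B P Q"
    using smoothing_family_exists by blast
  have Q: "calculus (Q n)" and QB: "norm (W (real N) (Q n x)) \<le> B * norm x" for n x
    using sm by (auto simp: smoothing_family_def)
  obtain g' :: "real \<Rightarrow> 'h" where g': "L2_time 0 T g'" and g'_inc:
    "\<And>B N Q s s'. \<lbrakk>calculus Q; p + 2 \<le> real N; B \<ge> 0; \<And>x. norm (W (real N) (Q x)) \<le> B * norm x;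
        0 \<le> s; s \<le> s'; s' \<le> T\<rbrakk> \<Longrightarrow>
      (norm (W (\<beta> / 2) (W (real N - p) (Q (u s'))) - W (\<beta> / 2) (W (real N - p) (Q (u s)))))\<^sup>2
        \<le> (s' - s) * (B\<^sup>2 * integral {s..s'} (\<lambda>t. (norm (g' t))\<^sup>2))"
    using regularization_increment by blast
  have "H_time (Suc (k - 1)) 0 T forcing"
    using F_regular k by (simp add: H_time_V_dual_def forcing_def[abs_def])
  then obtain h :: "real \<Rightarrow> 'h" where h: "L2_time 0 T h" and taylor: "\<And>w c d. 0 \<le> c \<Longrightarrow> c \<le> d \<Longrightarrow> d \<le> T \<Longrightarrow>
    \<exists>q\<in>poly_functions (Suc (k - 1)). \<forall>t\<in>{c..d}. \<bar>forcing t \<bullet> w - q t\<bar>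
        \<le> (d - c) ^ (k - 1) * (norm w * integral {c..d} (\<lambda>t. norm (h t)))"
    using H_time_taylor[OF _ T continuous_forcing] by blast
  obtain c\<^sub>1 where c\<^sub>1: "c\<^sub>1 \<ge> 0" and V\<gamma>: "\<And>x. x \<in> V_space G (p + lam) \<Longrightarrow>
      x \<in> V_space G \<gamma> \<and> V_norm G \<gamma> x \<le> c\<^sub>1 * V_norm G lam x"
    using V_norm_\<gamma>_le by blast
  define \<rho> where "\<rho> = (real k * r) ^ k"
  define C where "C = 2 * B\<^sup>2 * (\<rho> * (CL * c\<^sub>1))\<^sup>2 * real k / \<epsilon>"
  define C\<^sub>h where "C\<^sub>h = 2 * B\<^sup>2 * (1 + real k * \<rho>)\<^sup>2 * real k ^ (2 * k) / \<epsilon>"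
  define C\<^sub>g where "C\<^sub>g = A\<^sup>2 * B\<^sup>2 / \<epsilon>"
  have Cs: "C \<ge> 0" "C\<^sub>h \<ge> 0" "C\<^sub>g \<ge> 0" using \<epsilon> by (auto simp: C_def C\<^sub>h_def C\<^sub>g_def)
  define \<Theta> where "\<Theta> s = C\<^sub>h * sq_integral h s + C\<^sub>g * sq_integral g' s" for s
  show ?thesis
  proof (rule that[of C \<Theta>])
    show "C \<ge> 0" by (rule Cs)
    show "\<Theta> s \<le> \<Theta> s'" if "s \<le> s'" for s s'
      unfolding \<Theta>_def using that by (intro add_mono mult_left_mono sq_integral h g' Cs)
    show "0 \<le> \<Theta> s" for s
      unfolding \<Theta>_def by (intro add_nonneg_nonneg mult_nonneg_nonneg sq_integral h g' Cs)
    fix t U n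
    assume t: "time_grid t" and r: "step_ratio_bounded k r t"
      and sch: "scheme_solution G \<gamma> F \<epsilon> A p k t U"
      and n: "k - 1 \<le> n" and tT: "t (Suc n) \<le> T"
      and eV: "\<And>i. i < k \<Longrightarrow> error t U (n - i) \<in> V_space G (p + lam)"
    define \<tau> where "\<tau> = max_step t"
    define a where "a = A * \<tau> ^ k"
    define E where "E m = error_energy t U m" for m
    have \<tau>: "\<tau> > 0" using step_pos[OF t, of 0] step_le_max_step[OF t, of 0] by (simp add: \<tau>_def)
    have a: "a > 0" using A \<tau> by (simp add: a_def)
    have t_nonneg: "0 \<le> t m" for m using time_grid_mono[OF t, of 0 m] t by (simp add: time_grid_def)
    have tm: "t m \<in> {0..T}" if "m \<le> Suc n" for m
      using time_grid_mono[OF t that] t_nonneg tT by simp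
    have tn: "t n \<le> t (Suc n)" by (rule time_grid_mono[OF t]) simp
    let ?I = "{t n..t (Suc n)}"
    have sub: "?I \<subseteq> {0..T}" using t_nonneg[of n] tT by auto
    have UV: "U (n - i) (t (n - i)) \<in> V_space G \<gamma>" if i: "i < k" for i
    proof -
      have "u (t (n - i)) - error t U (n - i) \<in> V_space G \<gamma>"
        by (rule V_space_diff(1)[OF \<gamma> u_V[OF tm]]) (use V\<gamma>[OF eV[OF i]] in auto)
      then show ?thesis by (simp add: error_def)
    qed
    define \<phi> where "\<phi> i = dual_op_pow G \<beta> (F (U (n - i) (t (n - i))))" for i
    define l where "l s i = lagrange_basis t k n i (s - t n)" for s i
    define \<sigma> where "\<sigma> s = forcing s - (\<Sum>i<k. l s i *\<^sub>R \<phi> i)" for s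
    define e where "e s = u s - U (Suc n) s" for s
    have E0: "E m \<ge> 0" for m
      using a by (simp add: E_def error_energy_def a_def[unfolded \<tau>_def, symmetric])
    have E_ge: "(V_norm G lam (error t U m))\<^sup>2 \<le> E m" for m
      using a by (simp add: E_def error_energy_def a_def[unfolded \<tau>_def, symmetric])
    have l_bound: "\<bar>l s i\<bar> \<le> \<rho>" if "s \<in> ?I" "i < k" for s i
      unfolding l_def \<rho>_def using that by (intro lagrange_basis_bound[OF t r k n]) auto
    have \<rho>: "\<rho> \<ge> 0" using l_bound[of "t n" 0] tn k by fastforce
      define d where "d = t (Suc n) - t (n + 1 - k)"
    define H where "H = integral {t (n + 1 - k)..t (Suc n)} (\<lambda>t. norm (h t))"
    have win: "0 \<le> t (n + 1 - k)" "t (n + 1 - k) \<le> t n"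
      using t_nonneg k by (auto intro!: time_grid_mono[OF t])
    have d: "0 \<le> d" "t (Suc n) - t n \<le> d" using win tn by (auto simp: d_def)
    have H0: "0 \<le> H" unfolding H_def
      by (rule Henstock_Kurzweil_Integration.integral_nonneg)
         (use absolutely_integrable_on_subinterval[OF L2_time_real_absolutely_integrable[OF L2_time_norm[OF h]], of "t (n + 1 - k)" "t (Suc n)"]
              win tT in \<open>auto simp: absolutely_integrable_on_def\<close>)
    \<comment> \<open>Bound for the interpolation error of the forcing; the remaining part of \<open>\<sigma>\<close> is \<open>lipschitz\<close>.\<close>
    define \<kappa>\<^sub>1 where "\<kappa>\<^sub>1 = (1 + real k * \<rho>) * (d ^ (k - 1) * H)"
    have interp: "norm (forcing s - (\<Sum>i<k. l s i *\<^sub>R forcing (t (n - i)))) \<le> \<kappa>\<^sub>1" if s: "s \<in> ?I" for s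
      unfolding l_def \<kappa>\<^sub>1_def \<rho>_def
    proof (rule interpolation_error[OF t r k n])
      show "\<exists>q\<in>poly_functions k. \<forall>s\<in>{t (n + 1 - k)..t (Suc n)}. \<bar>forcing s \<bullet> w - q s\<bar> \<le> d ^ (k - 1) * H * norm w" for w
        using taylor[of "t (n + 1 - k)" "t (Suc n)" w] win tn tT k by (simp add: d_def H_def mult_ac)
    qed (use s d H0 in auto)
    have \<kappa>\<^sub>1_sq: "\<kappa>\<^sub>1\<^sup>2 * (t (Suc n) - t n) \<le> (1 + real k * \<rho>)\<^sup>2 * real k ^ (2 * k) * \<tau> ^ (2 * k)
        * (sq_integral h (t (Suc n)) - sq_integral h (t (n + 1 - k)))"
    proof -
      define \<Delta> where "\<Delta> = sq_integral h (t (Suc n)) - sq_integral h (t (n + 1 - k))"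
      have \<Delta>: "\<Delta> \<ge> 0" unfolding \<Delta>_def using sq_integral(2)[OF h, of "t (n + 1 - k)" "t (Suc n)"] win tn by simp
      have "H\<^sup>2 \<le> d * \<Delta>"
        unfolding H_def d_def \<Delta>_def
        using square_integral_norm_le[OF h win(1) _ tT] sq_integral(3)[OF h win(1) _ tT] win tn by simp
      then have "(d ^ (k - 1))\<^sup>2 * H\<^sup>2 * (t (Suc n) - t n) \<le> (d ^ (k - 1))\<^sup>2 * (d * \<Delta>) * d"
        using d tn \<Delta> by (intro mult_mono mult_nonneg_nonneg) auto
      also have "\<dots> = (d ^ (k - 1) * d)\<^sup>2 * \<Delta>" by (simp add: power2_eq_square mult_ac)
      also have "d ^ (k - 1) * d = d ^ k" using k by (metis power_minus_mult less_le_trans zero_less_one)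
      also have "(d ^ k)\<^sup>2 * \<Delta> \<le> ((real k * \<tau>) ^ k)\<^sup>2 * \<Delta>"
      proof -
        have "d \<le> real k * \<tau>"
          using interval_length_le[OF t, of "n + 1 - k" "Suc n"] k n by (simp add: d_def \<tau>_def)
        then show ?thesis using d \<Delta> by (intro mult_right_mono power_mono) auto
      qed
      finally have "(1 + real k * \<rho>)\<^sup>2 * ((d ^ (k - 1))\<^sup>2 * H\<^sup>2 * (t (Suc n) - t n))
          \<le> (1 + real k * \<rho>)\<^sup>2 * (((real k * \<tau>) ^ k)\<^sup>2 * \<Delta>)"
        by (rule mult_left_mono) simp
      then show ?thesis
        by (simp add: \<kappa>\<^sub>1_def \<Delta>_def power_mult_distrib power_mult mult_ac power_even_eq)
    qed
      have lipschitz: "norm (\<Sum>i<k. l s i *\<^sub>R (forcing (t (n - i)) - \<phi> i)) \<le> (\<Sum>i<k. (\<rho> * (CL * c\<^sub>1)) * V_norm G lam (error t U (n - i)))"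
      if s: "s \<in> ?I" for s
    proof (rule sum_norm_le)
      fix i assume i: "i \<in> {..<k}"
      have "norm (forcing (t (n - i)) - \<phi> i) \<le> CL * V_norm G \<gamma> (error t U (n - i))"
        unfolding forcing_def \<phi>_def error_def
        by (rule lipschitz_dual_op_pow[OF \<beta> lip u_V[OF tm] UV]) (use i in auto)
      also have "\<dots> \<le> CL * (c\<^sub>1 * V_norm G lam (error t U (n - i)))"
        using V\<gamma>[OF eV] i CL by (intro mult_left_mono) auto
      finally have "\<bar>l s i\<bar> * norm (forcing (t (n - i)) - \<phi> i) \<le> \<rho> * (CL * (c\<^sub>1 * V_norm G lam (error t U (n - i))))"
        using l_bound[OF s] i \<rho> by (intro mult_mono) auto
      then show "norm (l s i *\<^sub>R (forcing (t (n - i)) - \<phi> i)) \<le> \<rho> * (CL * c\<^sub>1) * V_norm G lam (error t U (n - i))"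
        by (simp add: mult_ac)
    qed
    define \<kappa> where "\<kappa> = 2 * \<kappa>\<^sub>1\<^sup>2 + 2 * ((\<rho> * (CL * c\<^sub>1))\<^sup>2 * real k * (\<Sum>i<k. E (n - i)))"
    have \<sigma>_bound: "(norm (\<sigma> s))\<^sup>2 \<le> \<kappa>" if s: "s \<in> ?I" for s
    proof -
      have "\<sigma> s = (forcing s - (\<Sum>i<k. l s i *\<^sub>R forcing (t (n - i)))) + (\<Sum>i<k. l s i *\<^sub>R (forcing (t (n - i)) - \<phi> i))"
        by (simp add: \<sigma>_def scaleR_diff_right sum_subtractf)
      then have "(norm (\<sigma> s))\<^sup>2 \<le> 2 * (norm (forcing s - (\<Sum>i<k. l s i *\<^sub>R forcing (t (n - i)))))\<^sup>2
          + 2 * (norm (\<Sum>i<k. l s i *\<^sub>R (forcing (t (n - i)) - \<phi> i)))\<^sup>2"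
        using norm_add_sq_le by metis
      also have "\<dots> \<le> 2 * \<kappa>\<^sub>1\<^sup>2 + 2 * (\<Sum>i<k. (\<rho> * (CL * c\<^sub>1)) * V_norm G lam (error t U (n - i)))\<^sup>2"
        using interp[OF s] lipschitz[OF s] by (intro add_mono mult_left_mono power_mono) auto
      also have "(\<Sum>i<k. (\<rho> * (CL * c\<^sub>1)) * V_norm G lam (error t U (n - i)))\<^sup>2
          \<le> (\<Sum>i<k. ((\<rho> * (CL * c\<^sub>1)) * V_norm G lam (error t U (n - i)))\<^sup>2) * real (card {..<k})"
        by (rule sum_squared_le_sum_of_squares)
      also have "\<dots> \<le> (\<Sum>i<k. (\<rho> * (CL * c\<^sub>1))\<^sup>2 * E (n - i)) * real k"
        unfolding power_mult_distrib card_lessThan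
        using E_ge by (intro mult_right_mono sum_mono mult_left_mono) auto
      also have "\<dots> = (\<rho> * (CL * c\<^sub>1))\<^sup>2 * real k * (\<Sum>i<k. E (n - i))"
        unfolding sum_distrib_left[symmetric] by (simp add: mult_ac)
      finally show ?thesis by (simp add: \<kappa>_def)
    qed
      have cU: "continuous_on ?I (U (Suc n))"
      by (rule continuous_in_H) (use sch n in \<open>auto simp: scheme_solution_def\<close>)
    have ce: "continuous_on ?I e"
      unfolding e_def by (intro continuous_on_diff cU continuous_on_subset[OF continuous_u sub])
    \<comment> \<open>The derivative of \<open>L\<^sup>p P u\<close>, taken from the equation for \<open>u\<close>: \<open>L\<^sup>p P\<close> has a factor \<open>S\<close> to spare.\<close>
    define D where "D m s = W (1 - \<beta> / 2) (W (real N - p - 1) (Q m (forcing s))) - \<epsilon> *\<^sub>R W (real N - p - 1) (Q m (u s))" for m s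
    have pars: "0 \<le> real N - p - 1" "0 \<le> real N - 1" "0 \<le> 1 - \<beta> / 2" "0 \<le> real N - \<beta> / 2"
      "0 \<le> real N" "0 \<le> real N - p" "\<beta> / 2 \<ge> 0"
      using N p lam_bounds by auto
    have Du: "((\<lambda>s. W (real N - p) (Q m (u s))) has_vector_derivative D m s) (at s within ?I)" if s: "s \<in> ?I" for m s
    proof -
      have "W 1 (W (real N - p - 1) (Q m x)) = W (real N - p) (Q m x)" for x
        using W_add[of 1 "real N - p - 1"] pars by simp
      then show ?thesis
        using exact_smoothed[OF calculus_compose[OF calculus_W[OF pars(1)] Q[of m]], of s] s sub
        unfolding D_def by (auto intro: has_vector_derivative_within_subset)
    qed
    have Pu: "((\<lambda>s. W (real N) (Q m (u s))) has_vector_derivative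
        W (real N - \<beta> / 2) (Q m (forcing s)) - \<epsilon> *\<^sub>R W (real N - 1) (Q m (u s))) (at s within ?I)" if s: "s \<in> ?I" for m s
    proof -
      have "W 1 (W (real N - 1) (Q m x)) = W (real N) (Q m x)"
        "W (1 - \<beta> / 2) (W (real N - 1) (Q m x)) = W (real N - \<beta> / 2) (Q m x)" for x
        using W_add[of 1 "real N - 1"] W_add[of "1 - \<beta> / 2" "real N - 1"] pars by simp_all
      then show ?thesis
        using exact_smoothed[OF calculus_compose[OF calculus_W[OF pars(2)] Q[of m]], of s] s sub
        by (auto intro: has_vector_derivative_within_subset)
    qed
    have z: "((\<lambda>s. W (real N) (Q m (e s)) + a *\<^sub>R W (real N - p) (Q m (e s))) has_vector_derivative
        W (real N - \<beta> / 2) (Q m (\<sigma> s)) - \<epsilon> *\<^sub>R W (real N - 1) (Q m (e s)) + a *\<^sub>R D m s) (at s within ?I)"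
      if s: "s \<in> ?I" for m s
    proof -
      have diff: "W x (Q m (v - w)) = W x (Q m v) - W x (Q m w)" if "x \<ge> 0" for x v w
        using linear_diff[OF bounded_linear.linear[OF calculus_bounded_linear[OF Q]]] linear_diff[OF W_linear[OF that]] by simp
      have zU: "((\<lambda>s. W (real N) (Q m (U (Suc n) s)) + a *\<^sub>R W (real N - p) (Q m (U (Suc n) s)))
        has_vector_derivative
          W (real N - \<beta> / 2) (Q m (\<Sum>i<k. l s i *\<^sub>R \<phi> i)) - \<epsilon> *\<^sub>R W (real N - 1) (Q m (U (Suc n) s))) (at s within ?I)"
        unfolding a_def \<tau>_def l_def \<phi>_def by (rule scheme_smoothed[OF sch n UV Q N s])
      have zu: "((\<lambda>s. W (real N) (Q m (u s)) + a *\<^sub>R W (real N - p) (Q m (u s))) has_vector_derivative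
          (W (real N - \<beta> / 2) (Q m (forcing s)) - \<epsilon> *\<^sub>R W (real N - 1) (Q m (u s))) + a *\<^sub>R D m s) (at s within ?I)"
        by (intro has_vector_derivative_add Pu[OF s]
            bounded_linear.has_vector_derivative[OF bounded_linear_scaleR_right Du[OF s]])
      show ?thesis
        using has_vector_derivative_diff[OF zu zU]
        by (simp add: e_def \<sigma>_def diff[OF pars(2)] diff[OF pars(4)] diff[OF pars(5)] diff[OF pars(6)]
            algebra_simps)
    qed
    have e_start: "e (t n) = error t U n"
      using sch n t_nonneg[of n] by (simp add: e_def error_def scheme_solution_def)
    have e_end: "e (t (Suc n)) = error t U (Suc n)" by (simp add: e_def error_def)
    obtain x0 where x0: "error t U n = W ((p + lam) / 2) x0"
      using eV[of 0] k unfolding V_space_W by auto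
    obtain x1 where x1: "e (t (Suc n)) = W ((p + lam) / 2) x1"
      "(norm (W (p / 2) x1))\<^sup>2 + a * (norm x1)\<^sup>2
      \<le> (norm (W (p / 2) x0))\<^sup>2 + a * (norm x0)\<^sup>2 + (B\<^sup>2 * \<kappa> * (t (Suc n) - t n)
        + a\<^sup>2 * (B\<^sup>2 * sq_integral g' (t (Suc n)) - B\<^sup>2 * sq_integral g' (t n))) / \<epsilon>"
    proof (rule energy_step[OF sm p lam_bounds(1-3) N tn a \<epsilon> B ce z Du _ \<sigma>_bound])
      fix m s s' assume s: "t n \<le> s" "s \<le> s'" "s' \<le> t (Suc n)"
      have "0 \<le> s" "s' \<le> T" using s t_nonneg[of n] tT by auto
      from g'_inc[OF Q N B QB this(1) s(2) this(2), of m] sq_integral(3)[OF g' this(1) s(2) this(2)]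
      show "(norm (W (\<beta> / 2) (W (real N - p) (Q m (u s'))) - W (\<beta> / 2) (W (real N - p) (Q m (u s)))))\<^sup>2
        \<le> (s' - s) * (B\<^sup>2 * sq_integral g' s' - B\<^sup>2 * sq_integral g' s)"
        by (simp add: right_diff_distrib)
    next
      show "e (t n) = W ((p + lam) / 2) x0" by (simp add: e_start x0)
    qed blast+
    have x1': "error t U (Suc n) = W ((p + lam) / 2) x1" using x1(1) by (simp add: e_end)
    have En: "E n = (norm (W (p / 2) x0))\<^sup>2 + a * (norm x0)\<^sup>2"
      "E (Suc n) = (norm (W (p / 2) x1))\<^sup>2 + a * (norm x1)\<^sup>2"
      using error_energy_eq[OF x0] error_energy_eq[OF x1'] by (simp_all add: E_def a_def \<tau>_def)
    define \<Delta>h where "\<Delta>h = sq_integral h (t (Suc n)) - sq_integral h (t (n + 1 - k))"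
    define \<Delta>g where "\<Delta>g = sq_integral g' (t (Suc n)) - sq_integral g' (t (n + 1 - k))"
    have "E (Suc n) \<le> E n + (B\<^sup>2 * \<kappa> * (t (Suc n) - t n)
        + a\<^sup>2 * (B\<^sup>2 * sq_integral g' (t (Suc n)) - B\<^sup>2 * sq_integral g' (t n))) / \<epsilon>"
      using x1(2) unfolding En .
    also have "\<dots> \<le> E n + C * (t (Suc n) - t n) * (\<Sum>i<k. E (n - i)) + \<tau> ^ (2 * k) * (C\<^sub>h * \<Delta>h + C\<^sub>g * \<Delta>g)"
    proof -
      have "B\<^sup>2 * \<kappa> * (t (Suc n) - t n) / \<epsilon>
         = 2 * B\<^sup>2 / \<epsilon> * (\<kappa>\<^sub>1\<^sup>2 * (t (Suc n) - t n)) + C * (t (Suc n) - t n) * (\<Sum>i<k. E (n - i))"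
        by (simp add: \<kappa>_def C_def distrib_left distrib_right add_divide_distrib mult_ac)
      also have "2 * B\<^sup>2 / \<epsilon> * (\<kappa>\<^sub>1\<^sup>2 * (t (Suc n) - t n)) \<le> 2 * B\<^sup>2 / \<epsilon> * ((1 + real k * \<rho>)\<^sup>2 * real k ^ (2 * k) * \<tau> ^ (2 * k) * \<Delta>h)"
        unfolding \<Delta>h_def by (rule mult_left_mono[OF \<kappa>\<^sub>1_sq]) (use \<epsilon> in simp)
      also have "\<dots> = \<tau> ^ (2 * k) * (C\<^sub>h * \<Delta>h)" by (simp add: C\<^sub>h_def mult_ac)
      finally have 1: "B\<^sup>2 * \<kappa> * (t (Suc n) - t n) / \<epsilon>
        \<le> \<tau> ^ (2 * k) * (C\<^sub>h * \<Delta>h) + C * (t (Suc n) - t n) * (\<Sum>i<k. E (n - i))" by simp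
      have "a\<^sup>2 * (B\<^sup>2 * sq_integral g' (t (Suc n)) - B\<^sup>2 * sq_integral g' (t n)) / \<epsilon>
        = \<tau> ^ (2 * k) * (C\<^sub>g * (sq_integral g' (t (Suc n)) - sq_integral g' (t n)))"
      proof -
        have "(\<tau> ^ k)\<^sup>2 = \<tau> ^ (2 * k)" by (simp add: power_even_eq)
        then have "a\<^sup>2 = A\<^sup>2 * \<tau> ^ (2 * k)" by (simp add: a_def power_mult_distrib)
        then show ?thesis by (simp add: C\<^sub>g_def right_diff_distrib mult_ac diff_divide_distrib)
      qed
      also have "\<dots> \<le> \<tau> ^ (2 * k) * (C\<^sub>g * \<Delta>g)"
        unfolding \<Delta>g_def using sq_integral(2)[OF g' win(2)] \<tau> Cs by (intro mult_left_mono) auto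
      finally show ?thesis using 1 by (simp add: add_divide_distrib distrib_left)
    qed
    also have "C\<^sub>h * \<Delta>h + C\<^sub>g * \<Delta>g = \<Theta> (t (Suc n)) - \<Theta> (t (n + 1 - k))"
      by (simp add: \<Theta>_def \<Delta>h_def \<Delta>g_def right_diff_distrib)
    finally show "error t U (Suc n) \<in> V_space G (p + lam) \<and>
       error_energy t U (Suc n) \<le> error_energy t U n
         + C * (t (Suc n) - t n) * (\<Sum>i<k. error_energy t U (n - i))
         + max_step t ^ (2 * k) * (\<Theta> (t (Suc n)) - \<Theta> (t (n + 1 - k)))"
      using x1' by (simp add: E_def \<tau>_def V_space_W)
  qed
qed

text \<open>
The windows of consecutive steps overlap.  The increments of \<open>\<Theta>\<close> over them are those of
\<open>D m = \<tau>\<^sup>2\<^sup>k (\<Theta> (t m) + \<dots> + \<Theta> (t (m - k + 1)))\<close>, so the sum of all of them is at most \<open>\<tau>\<^sup>2\<^sup>k k \<Theta> T\<close>.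
\<close>

lemma error_estimate:
  "\<exists>C. \<forall>t U. time_grid t \<and> step_ratio_bounded k r t \<and> scheme_solution G \<gamma> F \<epsilon> A p k t U \<and>
    (\<forall>i<k. t i \<le> T \<longrightarrow> error t U i \<in> V_space G (p + lam) \<and> error_energy t U i \<le> C\<^sub>0 * max_step t ^ (2 * k))
    \<longrightarrow> (\<forall>n. t n \<le> T \<longrightarrow> error t U n \<in> V_space G (p + lam) \<and> error_energy t U n \<le> C * max_step t ^ (2 * k))"
proof -
  obtain C :: real and \<Theta> :: "real \<Rightarrow> real" where C: "C \<ge> 0" and \<Theta>mono: "\<And>s s'. s \<le> s' \<Longrightarrow> \<Theta> s \<le> \<Theta> s'"
    and \<Theta>0: "\<And>s. 0 \<le> \<Theta> s" and rec:
    "\<And>t U n. \<lbrakk>time_grid t; step_ratio_bounded k r t; scheme_solution G \<gamma> F \<epsilon> A p k t U;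
       k - 1 \<le> n; t (Suc n) \<le> T; \<And>i. i < k \<Longrightarrow> error t U (n - i) \<in> V_space G (p + lam)\<rbrakk> \<Longrightarrow>
       error t U (Suc n) \<in> V_space G (p + lam) \<and>
       error_energy t U (Suc n) \<le> error_energy t U n
         + C * (t (Suc n) - t n) * (\<Sum>i<k. error_energy t U (n - i))
         + max_step t ^ (2 * k) * (\<Theta> (t (Suc n)) - \<Theta> (t (n + 1 - k)))"
    using error_recursion[where r = r] by metis
  define C' where "C' = exp (C * real k * T) * (\<bar>C\<^sub>0\<bar> + real k * \<Theta> T)"
  show ?thesis
  proof (rule exI[of _ C'], intro allI impI, elim conjE)
    fix t U n
    assume t: "time_grid t" and r: "step_ratio_bounded k r t"
      and sch: "scheme_solution G \<gamma> F \<epsilon> A p k t U"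
      and start: "\<forall>i<k. t i \<le> T \<longrightarrow> error t U i \<in> V_space G (p + lam) \<and>
        error_energy t U i \<le> C\<^sub>0 * max_step t ^ (2 * k)"
      and nT: "t n \<le> T"
    have tT: "t m \<le> T" if "m \<le> n" for m using time_grid_mono[OF t that] nT by simp
    have V: "error t U m \<in> V_space G (p + lam)" if "m \<le> n" for m
      using that
    proof (induction m rule: less_induct)
      case (less m)
      show ?case
      proof (cases "m < k")
        case True
        then show ?thesis using start tT[OF less.prems] by blast
      next
        case False
        then obtain m' where m': "m = Suc m'" using k by (cases m) auto
        have "error t U (Suc m') \<in> V_space G (p + lam)"
          by (rule rec[OF t r sch, THEN conjunct1]) (use less m' False tT[OF less.prems] in auto)
        then show ?thesis by (simp add: m')
      qed
    qed
    define D where "D m = max_step t ^ (2 * k) * (\<Sum>i<k. \<Theta> (t (m - i)))" for m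
    have \<tau>: "0 \<le> max_step t" using step_pos[OF t, of 0] step_le_max_step[OF t, of 0] by linarith
    have t0: "t 0 = 0" using t by (simp add: time_grid_def)
    have tpos: "0 \<le> t m" for m using time_grid_mono[OF t, of 0 m] t0 by simp
    have D_step: "D (Suc m) - D m = max_step t ^ (2 * k) * (\<Theta> (t (Suc m)) - \<Theta> (t (m + 1 - k)))"
      if m: "k - 1 \<le> m" for m
    proof -
      have "(\<Sum>i<k. \<Theta> (t (Suc m - i))) - (\<Sum>i<k. \<Theta> (t (m - i))) = \<Theta> (t (Suc m)) - \<Theta> (t (m + 1 - k))"
      proof -
        have "(\<Sum>i<k. \<Theta> (t (m - i))) = (\<Sum>i<k. \<Theta> (t (Suc m - Suc i)))" by simp
        then show ?thesis
          using sum_lessThan_telescope[of "\<lambda>i. \<Theta> (t (Suc m - i))" k] by (simp add: sum_subtractf)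
      qed
      then show ?thesis unfolding D_def right_diff_distrib[symmetric] by simp
    qed
    have "error_energy t U n \<le> exp (C * real k * t n) * (\<bar>C\<^sub>0\<bar> * max_step t ^ (2 * k) + D n)"
    proof (rule discrete_gronwall[where N = n and k = k])
      show "error_energy t U i \<le> \<bar>C\<^sub>0\<bar> * max_step t ^ (2 * k)" if "i < k" "i \<le> n" for i
      proof -
        have "error_energy t U i \<le> C\<^sub>0 * max_step t ^ (2 * k)" using start that tT by blast
        also have "\<dots> \<le> \<bar>C\<^sub>0\<bar> * max_step t ^ (2 * k)" using \<tau> by (intro mult_right_mono) auto
        finally show ?thesis .
      qed
      show "0 \<le> D m" for m unfolding D_def using \<tau> \<Theta>0 by (intro mult_nonneg_nonneg sum_nonneg) auto
      show "D m \<le> D (Suc m)" if "k - 1 \<le> m" for m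
      proof -
        have "\<Theta> (t (m + 1 - k)) \<le> \<Theta> (t (Suc m))" using k by (intro \<Theta>mono time_grid_mono[OF t]) auto
        then have "0 \<le> D (Suc m) - D m" unfolding D_step[OF that] using \<tau> by simp
        then show ?thesis by simp
      qed
      show "error_energy t U (Suc m) \<le> error_energy t U m
          + C * (t (Suc m) - t m) * (\<Sum>i<k. error_energy t U (m - i)) + (D (Suc m) - D m)"
        if "k - 1 \<le> m" "Suc m \<le> n" for m
        unfolding D_step[OF that(1)]
        by (rule rec[OF t r sch that(1), THEN conjunct2]) (use that tT V in auto)
      show "t m \<le> t (Suc m)" for m by (rule time_grid_mono[OF t]) simp
    qed (use k t0 tpos C \<tau> in auto)
    also have "\<dots> \<le> exp (C * real k * T) * (\<bar>C\<^sub>0\<bar> * max_step t ^ (2 * k) + max_step t ^ (2 * k) * (real k * \<Theta> T))"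
    proof (rule mult_mono)
      show "exp (C * real k * t n) \<le> exp (C * real k * T)" using C nT by (simp add: mult_left_mono)
      have "(\<Sum>i<k. \<Theta> (t (n - i))) \<le> (\<Sum>i<k. \<Theta> T)" by (intro sum_mono \<Theta>mono tT) simp
      then show "\<bar>C\<^sub>0\<bar> * max_step t ^ (2 * k) + D n \<le> \<bar>C\<^sub>0\<bar> * max_step t ^ (2 * k) + max_step t ^ (2 * k) * (real k * \<Theta> T)"
        unfolding D_def using \<tau> by (intro add_left_mono mult_left_mono) auto
      show "0 \<le> \<bar>C\<^sub>0\<bar> * max_step t ^ (2 * k) + D n"
        unfolding D_def using \<tau> \<Theta>0 by (intro add_nonneg_nonneg mult_nonneg_nonneg sum_nonneg) auto
    qed simp
    also have "\<dots> = C' * max_step t ^ (2 * k)" by (simp add: C'_def algebra_simps)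
    finally show "error t U n \<in> V_space G (p + lam) \<and> error_energy t U n \<le> C' * max_step t ^ (2 * k)"
      using V by simp
  qed
qed

end

section \<open>The convergence theorem\<close>

theorem theorem4p1:
  fixes j :: "'x::{real_inner,banach} \<Rightarrow> 'h::{real_inner,banach}"
    and L :: "'x \<Rightarrow> 'x \<Rightarrow>\<^sub>L real"
    and G :: "('h \<times> 'h) set"
    and \<Phi> :: "'h \<Rightarrow> real"
    and F :: "'h \<Rightarrow> 'h \<Rightarrow> real"
    and u :: "real \<Rightarrow> 'h"
    and p :: "nat \<Rightarrow> real"
    and k :: nat
    and c\<^sub>0 \<epsilon> T \<beta> \<gamma> lam C\<^sub>L A r\<^sub>c C\<^sub>0 :: real
  assumes "standard_triple j"
    and "linear L"
    and "G = realization j L"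
    and "selfadjoint G"
    and "positive_definite c\<^sub>0 G"
    and "\<epsilon> > 0" and "T > 0"
    and "\<beta> \<ge> 0" and "\<gamma> \<ge> 0" and "C\<^sub>L > 0"
    and "lipschitz_V G \<beta> \<gamma> C\<^sub>L F"
    and "neg_variational_derivative G \<Phi> F"
    and "k \<ge> 1" and "A > 0" and "p k \<ge> 0"
    and "lam = 1 - \<beta>"
    and "\<beta> + \<gamma> \<le> 1"
    and "exact_solution G \<gamma> F \<epsilon> T u"
    and "H_time_V_dual G \<beta> k 0 T (\<lambda>t. F (u t))"
    and "H_time_V G (2 * p k - \<beta>) 1 0 T u"
    and "r\<^sub>c > 0"
  shows "\<exists>C. \<forall>t U.
    time_grid t \<and> max_step t < 1 \<and> step_ratio_bounded k r\<^sub>c t \<and>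
    scheme_solution G \<gamma> F \<epsilon> A (p k) k t U \<and>
    (\<forall>i<k. t i \<le> T \<longrightarrow>
       u (t i) - U i (t i) \<in> V_space G (p k + lam) \<and>
       (V_norm G lam (u (t i) - U i (t i)))\<^sup>2
         + A * max_step t ^ k * (V_norm G (p k + lam) (u (t i) - U i (t i)))\<^sup>2
         \<le> C\<^sub>0 * max_step t ^ (2 * k))
    \<longrightarrow>
    (\<forall>n. t n \<le> T \<longrightarrow>
       u (t n) - U n (t n) \<in> V_space G (p k + lam) \<and>
       (V_norm G lam (u (t n) - U n (t n)))\<^sup>2
         + A * max_step t ^ k * (V_norm G (p k + lam) (u (t n) - U n (t n)))\<^sup>2
         \<le> C * max_step t ^ (2 * k))"
proof (cases "\<exists>x::'h. x \<noteq> 0")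
  case True
  interpret operator_graph G
    by (rule operator_graph.intro) (rule positive_operator_inverse_operator[OF assms(4,5) True])
  interpret semilinear_problem G F u k \<epsilon> T \<beta> \<gamma> lam C\<^sub>L A "p k"
    by unfold_locales (use assms in auto)
  obtain C where "\<forall>t U. time_grid t \<and> step_ratio_bounded k r\<^sub>c t \<and>
      scheme_solution G \<gamma> F \<epsilon> A (p k) k t U \<and>
      (\<forall>i<k. t i \<le> T \<longrightarrow> error t U i \<in> V_space G (p k + lam) \<and>
         error_energy t U i \<le> C\<^sub>0 * max_step t ^ (2 * k))
      \<longrightarrow> (\<forall>n. t n \<le> T \<longrightarrow> error t U n \<in> V_space G (p k + lam) \<and>
         error_energy t U n \<le> C * max_step t ^ (2 * k))"
    using error_estimate[of r\<^sub>c C\<^sub>0] by blast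
  then show ?thesis unfolding error_energy_def error_def by blast
next
  case False
  \<comment> \<open>In the zero space every norm vanishes; the calculus above needs \<open>onorm S > 0\<close>.\<close>
  have zero: "x = 0" for x :: 'h using False by blast
  have V: "v \<in> V_space G a" and norms: "V_norm G a v = 0" for a and v :: 'h
    using zero[of v] zero[of "frac_pow (inverse_operator G) (a / 2) 0"] zero[of "op_pow G (a / 2) v"]
    by (auto simp: V_space_def V_norm_def intro!: image_eqI[of _ _ 0])
  show ?thesis by (intro exI[of _ 0]) (simp add: V norms)
qed

end
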